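(* Let $F,c,\gamma,(b_m)_{m\in\mathbb Z},w$ satisfy the general assumptions (see context) and let $F'(-c)<\gamma^2<4F'(-c)$. Then there exists a neighborhood $D\subset\mathbb R$ of $0$ such that for all $\epsilon\in D$ there exist sequences $u(\epsilon)\in\mathcal L_{0,w}$ and $v(\epsilon)\in\mathcal L_{\sigma_0,w}$ ($\sigma_0>0$ defined in the context) such that $$x_n(t):=cn+\epsilon b_0-(u+v)(\epsilon)(0,0)+\sum_{m\in\mathbb Z}(u+v)(\epsilon)(n,m)e^{im\gamma t},\qquad n\ge1,$$ is a time periodic solution of the differential equation $$\ddot x_n(t)=F(x_{n-1}(t)-x_n(t))-F(x_n(t)-x_{n+1}(t)),\quad n\ge1,\qquad x_0(t):=\epsilon\sum_{m\in\mathbb Z}b_me^{i\gamma mt}.$$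
   Context: General assumptions: $c\in\mathbb R$; $F:\mathbb R\to\mathbb R$ is real analytic in a neighborhood of $-c$ with $F'(-c)>0$; $\gamma>0$ with $\frac{(m\gamma)^2}{F'(-c)}\ne4$ for all $m\in\mathbb Z$; $w:\mathbb Z\to\mathbb R$ is an admissible weight function, i.e. $w(m)\ge1$ and $w(m)\le w(m-n)w(n)$ for all $m,n\in\mathbb Z$; $(b_m)_{m\in\mathbb Z}$ is a complex sequence with $\sum_mw(m)|b_m|=1$ and $b_{-m}=\overline{b_m}$. For $\sigma\in\mathbb R$, $\mathcal L_{\sigma,w}$ is the Banach space of $u:\mathbb N_0\times\mathbb Z\to\mathbb C$ with $\|u\|_{\sigma,w}:=\sum_{m\in\mathbb Z}w(m)\sup_{n\ge0}e^{\sigma n}|u(n,m)|<\infty$. $\delta_m:=-2+\frac{(m\gamma)^2}{F'(-c)}$; $m_0:=\max\{m\in\mathbb Z:0\le\frac{(m\gamma)^2}{F'(-c)}\le4\}$ (here $m_0=1$); for $|m|>m_0$, $z_m:=-\frac{\delta_m}2+\sqrt{\frac{\delta_m^2}4-1}$; $\sigma_0:=\min(1,-\frac12\ln|z_{m_0+1}|)$. *)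

theory Defs
  imports "HOL-Analysis.Analysis"
begin

definition real_analytic_on :: "(real \<Rightarrow> real) \<Rightarrow> real set \<Rightarrow> bool" where
  "real_analytic_on f S \<longleftrightarrow> (\<forall>x\<in>S. \<exists>P. (\<lambda>h. f (x + h)) has_fps_expansion P)"

definition admissible_weight :: "(int \<Rightarrow> real) \<Rightarrow> bool" where
  "admissible_weight w \<longleftrightarrow> (\<forall>m. 1 \<le> w m) \<and> (\<forall>m n. w m \<le> w (m - n) * w n)"

text \<open>The space of all \<open>u\<close> with finite \<open>\<Sum>m. w m * (SUP n. exp (\<sigma> n) * \<bar>u n m\<bar>)\<close>.
  The boundedness condition says that each supremum is finite; the real-valued
  \<open>SUP\<close> is unspecified otherwise.\<close>

definition seq_space :: "real \<Rightarrow> (int \<Rightarrow> real) \<Rightarrow> (nat \<Rightarrow> int \<Rightarrow> complex) set" where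
  "seq_space \<sigma> w = {u.
     (\<forall>m. bdd_above (range (\<lambda>n. exp (\<sigma> * real n) * cmod (u n m)))) \<and>
     (\<lambda>m. w m * (SUP n. exp (\<sigma> * real n) * cmod (u n m))) summable_on UNIV}"

text \<open>In the following, the parameter \<open>a\<close> stands for \<open>F'(-c)\<close>.\<close>

definition delta :: "real \<Rightarrow> real \<Rightarrow> int \<Rightarrow> real" where
  "delta a \<gamma> m = - 2 + (real_of_int m * \<gamma>)\<^sup>2 / a"

definition m_zero :: "real \<Rightarrow> real \<Rightarrow> int" where
  "m_zero a \<gamma> = Max {m. 0 \<le> (real_of_int m * \<gamma>)\<^sup>2 / a \<and> (real_of_int m * \<gamma>)\<^sup>2 / a \<le> 4}"

text \<open>Only meaningful for \<open>\<bar>m\<bar> > m_zero a \<gamma>\<close>, where the radicand is positive.\<close>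

definition z_root :: "real \<Rightarrow> real \<Rightarrow> int \<Rightarrow> real" where
  "z_root a \<gamma> m = - (delta a \<gamma> m) / 2 + sqrt ((delta a \<gamma> m)\<^sup>2 / 4 - 1)"

definition sigma_zero :: "real \<Rightarrow> real \<Rightarrow> real" where
  "sigma_zero a \<gamma> = min 1 (- (1 / 2) * ln \<bar>z_root a \<gamma> (m_zero a \<gamma> + 1)\<bar>)"

lemma m_zero_eq_1:
  assumes "0 < a" "0 < \<gamma>" "a < \<gamma>\<^sup>2" "\<gamma>\<^sup>2 < 4 * a"
  shows "m_zero a \<gamma> = 1"
proof -
  have "(0 \<le> (real_of_int m * \<gamma>)\<^sup>2 / a \<and> (real_of_int m * \<gamma>)\<^sup>2 / a \<le> 4) \<longleftrightarrow> m \<in> {-1, 0, 1}"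
    for m :: int
  proof -
    have "(real_of_int m * \<gamma>)\<^sup>2 / a \<le> 4 \<longleftrightarrow> (real_of_int m)\<^sup>2 * \<gamma>\<^sup>2 \<le> 4 * a"
      using assms by (simp add: field_simps power_mult_distrib)
    also have "\<dots> \<longleftrightarrow> \<bar>m\<bar> \<le> 1"
    proof
      assume le: "(real_of_int m)\<^sup>2 * \<gamma>\<^sup>2 \<le> 4 * a"
      show "\<bar>m\<bar> \<le> 1"
      proof (rule ccontr)
        assume "\<not> \<bar>m\<bar> \<le> 1"
        then have "2 \<le> \<bar>real_of_int m\<bar>" by linarith
        then have "2\<^sup>2 \<le> \<bar>real_of_int m\<bar>\<^sup>2" by (intro power_mono) auto
        then have "4 * \<gamma>\<^sup>2 \<le> (real_of_int m)\<^sup>2 * \<gamma>\<^sup>2" by (intro mult_right_mono) auto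
        with le assms show False by linarith
      qed
    next
      assume "\<bar>m\<bar> \<le> 1"
      then have "m = -1 \<or> m = 0 \<or> m = 1" by linarith
      then show "(real_of_int m)\<^sup>2 * \<gamma>\<^sup>2 \<le> 4 * a" using assms by auto
    qed
    finally show ?thesis using assms by auto
  qed
  then have "{m. 0 \<le> (real_of_int m * \<gamma>)\<^sup>2 / a \<and> (real_of_int m * \<gamma>)\<^sup>2 / a \<le> 4} = {-1, 0, 1}"
    by blast
  then show ?thesis by (simp add: m_zero_def)
qed

lemma sigma_zero_pos:
  assumes "0 < a" "0 < \<gamma>" "a < \<gamma>\<^sup>2" "\<gamma>\<^sup>2 < 4 * a"
  shows "0 < sigma_zero a \<gamma>"
proof -
  define d where "d = delta a \<gamma> 2"
  have "d > 2"
    using assms by (simp add: d_def delta_def field_simps)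
  define s where "s = sqrt (d\<^sup>2 / 4 - 1)"
  have d2: "d\<^sup>2 > 4" using power_strict_mono[of 2 d 2] \<open>d > 2\<close> by simp
  then have ss: "s\<^sup>2 = d\<^sup>2 / 4 - 1" by (simp add: s_def)
  have "s \<ge> 0" using d2 by (simp add: s_def)
  have "s < d / 2"
    by (rule power2_less_imp_less) (use ss \<open>d > 2\<close> in \<open>auto simp: power_divide\<close>)
  moreover have "d / 2 - 1 < s"
  proof (rule power2_less_imp_less)
    show "(d / 2 - 1)\<^sup>2 < s\<^sup>2"
      unfolding ss using \<open>d > 2\<close> by (simp add: power2_eq_square field_simps)
  qed fact
  ultimately have "ln \<bar>- d / 2 + s\<bar> < 0" by (simp add: ln_less_zero)
  then show ?thesis
    using m_zero_eq_1[OF assms] by (simp add: sigma_zero_def z_root_def d_def s_def)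
qed

end

theory Submission
  imports Defs
begin

text \<open>
Write \<open>F (- c + s) = F (- c) + a s + G s\<close> with \<open>a = F' (- c)\<close> and \<open>G\<close> of second order. For a
time-periodic \<open>x n = c n + const + \<Sum>\<^sub>m y n m * cis (m \<gamma> t)\<close> the lattice equation becomes

  \<open>y (n+1) m + \<delta>\<^sub>m y n m + y (n-1) m = - (G\<^sub>n m - G\<^sub>n\<^sub>+\<^sub>1 m) / a\<close>,

where \<open>\<delta>\<^sub>m = - 2 + (m \<gamma>)\<^sup>2 / a\<close> and \<open>G\<^sub>n\<close> denotes the Fourier coefficients of \<open>G\<close> applied to the strain \<open>y (n-1) - y n\<close>. Linearly,
the modes \<open>m = \<plusminus>1\<close> are the only oscillating ones: they propagate as \<open>cis (\<plusminus>\<kappa> n)\<close>, the mean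
\<open>m = 0\<close> is neutral and all others are evanescent. In general a purely decaying solution can therefore not match the
prescribed first harmonic, and a linear wave of fixed wave number is destroyed by secular
terms. The solution is sought as \<open>y = u + v\<close>, where \<open>u\<close> is an exact nonlinear travelling wave,
whose wave number depends on its amplitude, and \<open>v\<close> decays exponentially in \<open>n\<close>.

Travelling waves (\<open>travelling_waves_exist\<close>). For the strain profile, normalised by its first
Fourier coefficient, the first harmonic of the wave equation determines the wave number, and
the other harmonics form a fixed point problem that contracts for small amplitude. The solution is
Lipschitz in the amplitude, because the linear operator that is inverted gains two derivatives.

The decaying part (\<open>decaying_part_exists\<close>). The force on \<open>v\<close> is \<open>G (Du + Dv) - G (Du)\<close>, which
decays as fast as \<open>v\<close>. For \<open>m = -1, 0, 1\<close> the decaying solution of the linear equation is obtained by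
summation from infinity, which leaves no freedom at \<open>n = 0\<close>. There the amplitude and phase
of \<open>u\<close> take care of the first harmonic, and the constant in \<open>x n\<close> takes care of the mean. For
\<open>\<bar>m\<bar> \<ge> 2\<close> the value at \<open>n = 0\<close> is prescribed, and the diagonal dominance \<open>\<delta>\<^sub>m > 2 cosh \<sigma>\<close> makes
the equation itself a contraction for sequences decaying with rate \<open>\<sigma>\<close>; the rate \<open>sigma_zero\<close>
is admissible (\<open>sigma_zero_admissible\<close>).

The difficulty is that \<open>u\<close>, as a sequence in \<open>n\<close>, is not continuous in its amplitude, since waves
with different wave numbers drift apart linearly. The map for \<open>v\<close> is therefore considered on a
ball for the rate \<open>\<sigma>\<close>, but shown to contract only for the rate \<open>\<sigma> / 2\<close>: the factor that grows in
\<open>n\<close> always multiplies a factor that decays with rate \<open>\<sigma>\<close>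
(\<open>conv_pow_second_difference\<close>, \<open>contraction_fixpoint\<close>).
\<close>

section \<open>Weighted Wiener norms\<close>

locale weighted =
  fixes w :: "int \<Rightarrow> real"
  assumes weight_ge_1: "1 \<le> w m"
    and weight_submult: "w m \<le> w (m - k) * w k"
begin

lemma weight_nonneg [simp]: "0 \<le> w m"
  using weight_ge_1[of m] by linarith

text \<open>The bound \<open>\<parallel>f\<parallel>\<^bsub>\<sigma>,w\<^esub> \<le> r\<close> is expressed by a majorant \<open>M\<close> of all the
  rows, so that neither suprema nor infinite sums have to be shown to exist
  before an estimate can be stated.\<close>

definition norm_le :: "real \<Rightarrow> (nat \<Rightarrow> int \<Rightarrow> complex) \<Rightarrow> real \<Rightarrow> bool" where
  "norm_le \<sigma> f r \<longleftrightarrow> (\<exists>M. (\<forall>n m. exp (\<sigma> * real n) * cmod (f n m) \<le> M m) \<and>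
     (\<forall>A. finite A \<longrightarrow> (\<Sum>m\<in>A. w m * M m) \<le> r))"

lemma norm_leI:
  assumes "\<And>n m. exp (\<sigma> * real n) * cmod (f n m) \<le> M m"
    and "\<And>A. finite A \<Longrightarrow> (\<Sum>m\<in>A. w m * M m) \<le> r"
  shows "norm_le \<sigma> f r"
  using assms unfolding norm_le_def by blast

lemma norm_leE:
  assumes "norm_le \<sigma> f r"
  obtains M where "\<And>n m. exp (\<sigma> * real n) * cmod (f n m) \<le> M m" "\<And>m. 0 \<le> M m"
    "\<And>A. finite A \<Longrightarrow> (\<Sum>m\<in>A. w m * M m) \<le> r"
proof -
  obtain M where M: "\<And>n m. exp (\<sigma> * real n) * cmod (f n m) \<le> M m"
    "\<And>A. finite A \<Longrightarrow> (\<Sum>m\<in>A. w m * M m) \<le> r"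
    using assms unfolding norm_le_def by blast
  have "0 \<le> M m" for m
    by (rule order_trans[OF _ M(1)[of 0 m]]) simp
  with M that show ?thesis by blast
qed

lemma norm_le_nonneg: "norm_le \<sigma> f r \<Longrightarrow> 0 \<le> r"
  by (metis norm_leE finite.emptyI sum.empty)

lemma norm_le_mono: "norm_le \<sigma> f r \<Longrightarrow> r \<le> s \<Longrightarrow> norm_le \<sigma> f s"
  unfolding norm_le_def by (meson order_trans)

lemma norm_le_zero: "norm_le \<sigma> (\<lambda>n m. 0) 0"
  by (rule norm_leI[where M = "\<lambda>_. 0"]) auto

text \<open>Restricting the mode sum to one mode, with weight at least \<open>1\<close>.\<close>

lemma norm_le_coeff:
  assumes "norm_le \<sigma> f r"
  shows "exp (\<sigma> * real n) * cmod (f n m) \<le> r"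
proof -
  obtain M where M: "\<And>n m. exp (\<sigma> * real n) * cmod (f n m) \<le> M m" "\<And>m. 0 \<le> M m"
    "\<And>A. finite A \<Longrightarrow> (\<Sum>m\<in>A. w m * M m) \<le> r" by (rule norm_leE[OF assms]) blast
  have "M m \<le> w m * M m" using weight_ge_1[of m] M(2)[of m] mult_right_mono by fastforce
  with M(1)[of n m] M(3)[of "{m}"] show ?thesis by simp
qed

lemma norm_le_coeff0: "norm_le \<sigma> f r \<Longrightarrow> cmod (f 0 m) \<le> r"
  using norm_le_coeff[of \<sigma> f r 0 m] by simp

lemma norm_le_pointwise: "norm_le \<sigma> f r \<Longrightarrow> cmod (f n m) \<le> exp (- \<sigma> * real n) * r"
  using norm_le_coeff[of \<sigma> f r n m] by (simp add: exp_minus field_simps)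

lemma norm_le_dominated:
  assumes "norm_le \<sigma> f r" "0 \<le> C"
    and "\<And>n m. exp (\<tau> * real n) * cmod (g n m) \<le> C * (exp (\<sigma> * real n) * cmod (f n m))"
  shows "norm_le \<tau> g (C * r)"
proof -
  obtain M where M: "\<And>n m. exp (\<sigma> * real n) * cmod (f n m) \<le> M m" "\<And>m. 0 \<le> M m"
    "\<And>A. finite A \<Longrightarrow> (\<Sum>m\<in>A. w m * M m) \<le> r" by (rule norm_leE[OF assms(1)]) blast
  show ?thesis
  proof (rule norm_leI[where M = "\<lambda>m. C * M m"])
    show "exp (\<tau> * real n) * cmod (g n m) \<le> C * M m" for n m
      using assms(3)[of n m] mult_left_mono[OF M(1)[of n m] assms(2)] by linarith
    show "(\<Sum>m\<in>A. w m * (C * M m)) \<le> C * r" if "finite A" for A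
      using mult_left_mono[OF M(3)[OF that] assms(2)] by (simp add: sum_distrib_left mult_ac)
  qed
qed

lemma norm_le_dominated_same:
  assumes "norm_le \<sigma> f r" "0 \<le> C" "\<And>n m. cmod (g n m) \<le> C * cmod (f n m)"
  shows "norm_le \<sigma> g (C * r)"
proof (rule norm_le_dominated[OF assms(1,2)])
  show "exp (\<sigma> * real n) * cmod (g n m) \<le> C * (exp (\<sigma> * real n) * cmod (f n m))" for n m
    using mult_left_mono[OF assms(3), of "exp (\<sigma> * real n)" n m] by (simp add: mult.left_commute)
qed

lemma norm_le_weaken:
  assumes "norm_le \<sigma> f r" "\<tau> \<le> \<sigma>"
  shows "norm_le \<tau> f r"
  using norm_le_dominated[OF assms(1), of 1 \<tau> f] assms(2)
  by (simp add: mult_right_mono)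

lemma norm_le_add:
  assumes "norm_le \<sigma> f r" "norm_le \<sigma> g s"
  shows "norm_le \<sigma> (\<lambda>n m. f n m + g n m) (r + s)"
proof -
  obtain M where M: "\<And>n m. exp (\<sigma> * real n) * cmod (f n m) \<le> M m" "\<And>m. 0 \<le> M m"
    "\<And>A. finite A \<Longrightarrow> (\<Sum>m\<in>A. w m * M m) \<le> r" by (rule norm_leE[OF assms(1)]) blast
  obtain N where N: "\<And>n m. exp (\<sigma> * real n) * cmod (g n m) \<le> N m" "\<And>m. 0 \<le> N m"
    "\<And>A. finite A \<Longrightarrow> (\<Sum>m\<in>A. w m * N m) \<le> s" by (rule norm_leE[OF assms(2)]) blast
  show ?thesis
  proof (rule norm_leI[where M = "\<lambda>m. M m + N m"])
    show "exp (\<sigma> * real n) * cmod (f n m + g n m) \<le> M m + N m" for n m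
      using mult_left_mono[OF norm_triangle_ineq[of "f n m" "g n m"], of "exp (\<sigma> * real n)"]
        M(1)[of n m] N(1)[of n m] by (simp add: distrib_left)
    show "(\<Sum>m\<in>A. w m * (M m + N m)) \<le> r + s" if "finite A" for A
      using M(3)[OF that] N(3)[OF that] by (simp add: distrib_left sum.distrib)
  qed
qed

lemma norm_le_cmult: "norm_le \<sigma> f r \<Longrightarrow> norm_le \<sigma> (\<lambda>n m. c * f n m) (cmod c * r)"
  by (rule norm_le_dominated_same) (auto simp: norm_mult)

lemma norm_le_uminus: "norm_le \<sigma> f r \<Longrightarrow> norm_le \<sigma> (\<lambda>n m. - f n m) r"
  using norm_le_cmult[of \<sigma> f r "-1"] by simp

lemma norm_le_diff:
  "norm_le \<sigma> f r \<Longrightarrow> norm_le \<sigma> g s \<Longrightarrow> norm_le \<sigma> (\<lambda>n m. f n m - g n m) (r + s)"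
  using norm_le_add[OF _ norm_le_uminus, of \<sigma> f r g s] by simp

lemma norm_le_minus_commute:
  "norm_le \<sigma> (\<lambda>n m. f n m - g n m) r \<Longrightarrow> norm_le \<sigma> (\<lambda>n m. g n m - f n m) r"
  using norm_le_uminus by fastforce

lemma norm_le_sum:
  assumes "\<And>i. i \<in> I \<Longrightarrow> norm_le \<sigma> (f i) (r i)"
  shows "norm_le \<sigma> (\<lambda>n m. \<Sum>i\<in>I. f i n m) (\<Sum>i\<in>I. r i)"
  using assms
proof (induction I rule: infinite_finite_induct)
  case (insert i I)
  then show ?case using norm_le_add[of \<sigma> "f i" "r i"] by simp
qed (simp_all add: norm_le_zero)

text \<open>Lower semicontinuity. The majorants of the approximants need not converge;
  instead the suprema \<open>M m\<close> of the limit are approximated at finitely many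
  sites \<open>\<nu> m\<close>, where the bound survives the limit.\<close>

lemma norm_le_limit:
  assumes F: "F \<noteq> bot"
    and lim: "\<And>n m. ((\<lambda>j. g j n m) \<longlongrightarrow> f n m) F"
    and le: "\<forall>\<^sub>F j in F. norm_le \<sigma> (g j) r"
  shows "norm_le \<sigma> f r"
proof -
  define q where "q n m = exp (\<sigma> * real n) * cmod (f n m)" for n m
  have finite_le: "(\<Sum>m\<in>A. w m * q (\<nu> m) m) \<le> r" if A: "finite A" for A \<nu>
  proof (rule tendsto_upperbound[OF _ _ F])
    show "((\<lambda>j. \<Sum>m\<in>A. w m * (exp (\<sigma> * real (\<nu> m)) * cmod (g j (\<nu> m) m)))
        \<longlongrightarrow> (\<Sum>m\<in>A. w m * q (\<nu> m) m)) F"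
      unfolding q_def by (intro tendsto_intros lim)
    show "\<forall>\<^sub>F j in F. (\<Sum>m\<in>A. w m * (exp (\<sigma> * real (\<nu> m)) * cmod (g j (\<nu> m) m))) \<le> r"
      using le
    proof eventually_elim
      case (elim j)
      obtain M where M: "\<And>n m. exp (\<sigma> * real n) * cmod (g j n m) \<le> M m"
        "\<And>A. finite A \<Longrightarrow> (\<Sum>m\<in>A. w m * M m) \<le> r" by (rule norm_leE[OF elim]) blast
      have "(\<Sum>m\<in>A. w m * (exp (\<sigma> * real (\<nu> m)) * cmod (g j (\<nu> m) m))) \<le> (\<Sum>m\<in>A. w m * M m)"
        by (intro sum_mono mult_left_mono M(1)) auto
      with M(2)[OF A] show ?case by linarith
    qed
  qed
  have q_le: "q n m \<le> r" for n m
  proof -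
    have "q n m \<le> w m * q n m"
      using mult_right_mono[OF weight_ge_1[of m], of "q n m"] by (simp add: q_def)
    with finite_le[of "{m}" "\<lambda>_. n"] show ?thesis by simp
  qed
  define M where "M m = (SUP n. q n m)" for m
  have bdd: "bdd_above (range (\<lambda>n. q n m))" for m using q_le by (auto intro!: bdd_aboveI)
  show ?thesis
  proof (rule norm_leI[where M = M])
    show "exp (\<sigma> * real n) * cmod (f n m) \<le> M m" for n m
      unfolding M_def q_def[symmetric] by (rule cSUP_upper[OF _ bdd]) simp
    show "(\<Sum>m\<in>A. w m * M m) \<le> r" if A: "finite A" for A
    proof (rule field_le_epsilon)
      fix e :: real assume e: "e > 0"
      define W where "W = (\<Sum>m\<in>A. w m)"
      have W: "0 \<le> W" unfolding W_def by (rule sum_nonneg) auto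
      define \<eta> where "\<eta> = e / (W + 1)"
      have \<eta>: "\<eta> > 0" "\<eta> * W \<le> e"
        using e W by (auto simp: \<eta>_def field_simps)
      have "\<exists>n. M m < q n m + \<eta>" for m
      proof -
        have "M m - \<eta> < (SUP n. q n m)" using \<eta>(1) by (simp add: M_def)
        then obtain n where "M m - \<eta> < q n m"
          using less_cSUP_iff[OF _ bdd] by auto
        then show ?thesis by (intro exI[of _ n]) linarith
      qed
      then obtain \<nu> where \<nu>: "\<And>m. M m < q (\<nu> m) m + \<eta>" by metis
      have "(\<Sum>m\<in>A. w m * M m) \<le> (\<Sum>m\<in>A. w m * (q (\<nu> m) m + \<eta>))"
        by (intro sum_mono mult_left_mono less_imp_le[OF \<nu>]) auto
      also have "\<dots> = (\<Sum>m\<in>A. w m * q (\<nu> m) m) + \<eta> * W"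
        by (simp add: W_def distrib_left sum.distrib sum_distrib_left mult.commute)
      also have "\<dots> \<le> r + e" using finite_le[OF A] \<eta>(2) by (intro add_mono) auto
      finally show "(\<Sum>m\<in>A. w m * M m) \<le> r + e" .
    qed
  qed
qed

lemma norm_le_suminf:
  assumes f: "\<And>k. norm_le \<sigma> (f k) (r k)" and r: "summable r"
  shows "norm_le \<sigma> (\<lambda>n m. \<Sum>k. f k n m) (\<Sum>k. r k)"
    and "summable (\<lambda>k. f k n m)"
proof -
  show sm: "summable (\<lambda>k. f k n m)" for n m
    by (rule summable_comparison_test'[OF summable_mult[OF r, of "exp (- \<sigma> * real n)"], of 0])
      (rule norm_le_pointwise[OF f])
  show "norm_le \<sigma> (\<lambda>n m. \<Sum>k. f k n m) (\<Sum>k. r k)"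
  proof (rule norm_le_limit[where F = sequentially])
    show "(\<lambda>j. \<Sum>k<j. f k n m) \<longlonglongrightarrow> (\<Sum>k. f k n m)" for n m
      by (rule summable_LIMSEQ[OF sm])
    show "\<forall>\<^sub>F j in sequentially. norm_le \<sigma> (\<lambda>n m. \<Sum>k<j. f k n m) (\<Sum>k. r k)"
    proof (rule always_eventually, rule allI, rule norm_le_mono)
      fix j
      show "norm_le \<sigma> (\<lambda>n m. \<Sum>k<j. f k n m) (\<Sum>k<j. r k)" by (rule norm_le_sum[OF f])
      show "(\<Sum>k<j. r k) \<le> (\<Sum>k. r k)"
        by (rule sum_le_suminf[OF r]) (auto intro: norm_le_nonneg[OF f])
    qed
  qed simp
qed

lemma norm_le_shift_up:
  assumes "norm_le \<sigma> f r"
  shows "norm_le \<sigma> (\<lambda>n m. f (n + i) m) (exp (- \<sigma> * real i) * r)"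
proof -
  obtain M where M: "\<And>n m. exp (\<sigma> * real n) * cmod (f n m) \<le> M m" "\<And>m. 0 \<le> M m"
    "\<And>A. finite A \<Longrightarrow> (\<Sum>m\<in>A. w m * M m) \<le> r" by (rule norm_leE[OF assms(1)]) blast
  show ?thesis
  proof (rule norm_leI[where M = "\<lambda>m. exp (- \<sigma> * real i) * M m"])
    show "exp (\<sigma> * real n) * cmod (f (n + i) m) \<le> exp (- \<sigma> * real i) * M m" for n m
    proof -
      have "exp (\<sigma> * real n) = exp (- \<sigma> * real i) * exp (\<sigma> * real (n + i))"
        by (simp add: mult_exp_exp distrib_left)
      then show ?thesis using mult_left_mono[OF M(1)[of "n + i" m], of "exp (- \<sigma> * real i)"]
        by (simp only: mult.assoc) simp
    qed
    show "(\<Sum>m\<in>A. w m * (exp (- \<sigma> * real i) * M m)) \<le> exp (- \<sigma> * real i) * r"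
      if "finite A" for A
      using mult_left_mono[OF M(3)[OF that], of "exp (- \<sigma> * real i)"]
      by (simp add: sum_distrib_left mult_ac)
  qed
qed

lemma norm_le_shift_down:
  assumes "norm_le \<sigma> f r"
  shows "norm_le \<sigma> (\<lambda>n m. if 1 \<le> n then f (n - 1) m else 0) (exp \<sigma> * r)"
proof -
  obtain M where M: "\<And>n m. exp (\<sigma> * real n) * cmod (f n m) \<le> M m" "\<And>m. 0 \<le> M m"
    "\<And>A. finite A \<Longrightarrow> (\<Sum>m\<in>A. w m * M m) \<le> r" by (rule norm_leE[OF assms(1)]) blast
  show ?thesis
  proof (rule norm_leI[where M = "\<lambda>m. exp \<sigma> * M m"])
    show "exp (\<sigma> * real n) * cmod (if 1 \<le> n then f (n - 1) m else 0) \<le> exp \<sigma> * M m" for n m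
    proof (cases n)
      case 0 then show ?thesis using M(2)[of m] by simp
    next
      case (Suc k)
      then show ?thesis
        using mult_left_mono[OF M(1)[of k m], of "exp \<sigma>"]
        by (simp add: exp_add distrib_left mult.assoc)
    qed
    show "(\<Sum>m\<in>A. w m * (exp \<sigma> * M m)) \<le> exp \<sigma> * r" if "finite A" for A
      using mult_left_mono[OF M(3)[OF that], of "exp \<sigma>"]
      by (simp add: sum_distrib_left mult_ac)
  qed
qed

lemma norm_le_abs_summable:
  assumes "norm_le \<sigma> f r"
  shows "(\<lambda>m. cmod (f n m)) summable_on UNIV"
    and "(\<Sum>\<^sub>\<infinity>m. cmod (f n m)) \<le> exp (- \<sigma> * real n) * r"
proof -
  obtain M where M: "\<And>n m. exp (\<sigma> * real n) * cmod (f n m) \<le> M m" "\<And>m. 0 \<le> M m"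
    "\<And>A. finite A \<Longrightarrow> (\<Sum>m\<in>A. w m * M m) \<le> r" by (rule norm_leE[OF assms(1)]) blast
  have le: "(\<Sum>m\<in>A. cmod (f n m)) \<le> exp (- \<sigma> * real n) * r" if "finite A" for A
  proof -
    have "cmod (f n m) \<le> exp (- \<sigma> * real n) * (w m * M m)" for m
    proof -
      have "cmod (f n m) \<le> exp (- \<sigma> * real n) * M m"
        using M(1)[of n m] by (simp add: exp_minus field_simps)
      also have "\<dots> \<le> exp (- \<sigma> * real n) * (w m * M m)"
        using mult_right_mono[OF weight_ge_1[of m] M(2)[of m]] by simp
      finally show ?thesis .
    qed
    then have "(\<Sum>m\<in>A. cmod (f n m)) \<le> (\<Sum>m\<in>A. exp (- \<sigma> * real n) * (w m * M m))"
      by (rule sum_mono)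
    also have "\<dots> \<le> exp (- \<sigma> * real n) * r"
      using M(3)[OF that] by (simp add: sum_distrib_left[symmetric])
    finally show ?thesis .
  qed
  show "(\<lambda>m. cmod (f n m)) summable_on UNIV"
    by (rule nonneg_bdd_above_summable_on) (auto intro!: bdd_aboveI le)
  then show "(\<Sum>\<^sub>\<infinity>m. cmod (f n m)) \<le> exp (- \<sigma> * real n) * r"
    by (rule infsum_le_finite_sums) (rule le)
qed

lemma norm_le_seq_space:
  assumes "norm_le \<sigma> f r"
  shows "f \<in> seq_space \<sigma> w"
proof -
  obtain M where M: "\<And>n m. exp (\<sigma> * real n) * cmod (f n m) \<le> M m" "\<And>m. 0 \<le> M m"
    "\<And>A. finite A \<Longrightarrow> (\<Sum>m\<in>A. w m * M m) \<le> r" by (rule norm_leE[OF assms(1)]) blast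
  have bdd: "bdd_above (range (\<lambda>n. exp (\<sigma> * real n) * cmod (f n m)))" for m
    using M(1) by (auto intro!: bdd_aboveI)
  define S where "S m = (SUP n. exp (\<sigma> * real n) * cmod (f n m))" for m
  have S: "S m \<le> M m" "0 \<le> S m" for m
  proof -
    show "S m \<le> M m" unfolding S_def by (rule cSUP_least) (auto intro: M(1))
    have "0 \<le> exp (\<sigma> * real 0) * cmod (f 0 m)" by simp
    also have "\<dots> \<le> S m" unfolding S_def by (rule cSUP_upper[OF _ bdd]) simp
    finally show "0 \<le> S m" .
  qed
  have "(\<lambda>m. w m * S m) summable_on UNIV"
  proof (rule nonneg_bdd_above_summable_on)
    have "(\<Sum>m\<in>A. w m * S m) \<le> r" if "finite A" for A
      using M(3)[OF that] sum_mono[of A "\<lambda>m. w m * S m" "\<lambda>m. w m * M m"]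
      by (force intro: mult_left_mono S)
    then show "bdd_above (sum (\<lambda>m. w m * S m) ` {F. F \<subseteq> UNIV \<and> finite F})"
      by (auto intro!: bdd_aboveI)
  qed (simp add: S)
  with bdd show ?thesis by (simp add: seq_space_def S_def)
qed

lemma norm_le_row:
  assumes "norm_le 0 f r"
  shows "norm_le 0 (\<lambda>_. f n) r"
proof -
  obtain M where M: "\<And>n m. exp (0 * real n) * cmod (f n m) \<le> M m"
    "\<And>A. finite A \<Longrightarrow> (\<Sum>m\<in>A. w m * M m) \<le> r" by (rule norm_leE[OF assms]) blast
  show ?thesis by (rule norm_leI[where M = M]) (use M(1)[of n] M(2) in auto)
qed

lemma norm_le_dominated2:
  assumes f: "norm_le \<sigma> f r" and g: "norm_le \<sigma> g s" and "0 \<le> A" "0 \<le> B"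
    and h: "\<And>n m. cmod (h n m) \<le> A * cmod (f n m) + B * cmod (g n m)"
  shows "norm_le \<sigma> h (A * r + B * s)"
proof -
  have 1: "norm_le \<sigma> (\<lambda>n m. of_real (A * cmod (f n m))) (A * r)"
    by (rule norm_le_dominated_same[OF f]) (use assms in \<open>auto simp: norm_mult\<close>)
  have 2: "norm_le \<sigma> (\<lambda>n m. of_real (B * cmod (g n m))) (B * s)"
    by (rule norm_le_dominated_same[OF g]) (use assms in \<open>auto simp: norm_mult\<close>)
  have "norm_le \<sigma> h (1 * (A * r + B * s))"
  proof (rule norm_le_dominated_same[OF norm_le_add[OF 1 2]])
    show "cmod (h n m) \<le> 1 * cmod (of_real (A * cmod (f n m)) + of_real (B * cmod (g n m)))" for n m
      using h[of n m] assms(3,4)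
      by (simp only: norm_of_real abs_of_nonneg mult_nonneg_nonneg add_nonneg_nonneg norm_ge_zero
          mult_1 flip: of_real_add)
  qed simp
  then show ?thesis by simp
qed

text \<open>A bound by every \<open>r + e\<close> is a bound by \<open>r\<close>: after scaling \<open>f\<close> down slightly this is lower
  semicontinuity.\<close>

lemma norm_le_closed_bound:
  assumes "\<And>e. 0 < e \<Longrightarrow> norm_le \<sigma> f (r + e)" "0 \<le> r"
  shows "norm_le \<sigma> f r"
proof (cases "r = 0")
  case True
  have "cmod (f n m) \<le> 0" for n m
  proof (rule field_le_epsilon)
    fix e :: real assume e: "0 < e"
    then have "norm_le \<sigma> f (exp (\<sigma> * real n) * e)" using assms(1)[of "exp (\<sigma> * real n) * e"] True by simp
    from norm_le_coeff[OF this, of n m] show "cmod (f n m) \<le> 0 + e" by simp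
  qed
  then have "f = (\<lambda>n m. 0)" by (intro ext) simp
  with True show ?thesis by (simp add: norm_le_zero)
next
  case False
  with assms have r: "0 < r" by simp
  define t where "t j = r / (r + inverse (real (Suc j)))" for j
  have "t \<longlonglongrightarrow> r / (r + 0)"
    unfolding t_def using r by (intro tendsto_intros LIMSEQ_inverse_real_of_nat) auto
  then have t: "t \<longlonglongrightarrow> 1" using r by simp
  show ?thesis
  proof (rule norm_le_limit[where F = sequentially])
    show "(\<lambda>j. of_real (t j) * f n m) \<longlonglongrightarrow> f n m" for n m
      using tendsto_mult[OF tendsto_of_real[OF t] tendsto_const[of "f n m"]] by simp
    show "\<forall>\<^sub>F j in sequentially. norm_le \<sigma> (\<lambda>n m. of_real (t j) * f n m) r"
    proof (rule always_eventually, rule allI)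
      fix j
      have "0 < r + inverse (real (Suc j))" using r by (simp add: add_pos_pos)
      then have "cmod (of_real (t j)) * (r + inverse (real (Suc j))) = r"
        using r by (simp add: t_def del: of_real_divide)
      with norm_le_cmult[OF assms(1)[of "inverse (real (Suc j))"], of "of_real (t j)"]
      show "norm_le \<sigma> (\<lambda>n m. of_real (t j) * f n m) r" by simp
    qed
  qed simp
qed

text \<open>A self-improving bound, starting from any finite bound, yields the bound that the
  contraction estimate suggests.\<close>

lemma norm_le_absorb:
  assumes improve: "\<And>d. norm_le \<tau> f d \<Longrightarrow> norm_le \<tau> f (q * d + c)" and start: "norm_le \<tau> f d0"
    and q: "0 \<le> q" "q < 1" and c: "0 \<le> c"
  shows "norm_le \<tau> f (c / (1 - q))"
proof (rule norm_le_closed_bound)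
  have iter: "norm_le \<tau> f (q ^ j * d0 + c / (1 - q))" for j
  proof (induction j)
    case 0
    show ?case by (rule norm_le_mono[OF start]) (use q c in simp)
  next
    case (Suc j)
    have "q * (q ^ j * d0 + c / (1 - q)) + c = q ^ Suc j * d0 + c / (1 - q)"
      using q by (simp add: field_simps)
    with improve[OF Suc] show ?case by simp
  qed
  fix e :: real assume e: "0 < e"
  have "(\<lambda>j. q ^ j * d0) \<longlonglongrightarrow> 0 * d0"
    using q by (intro tendsto_intros LIMSEQ_power_zero) auto
  then have "\<forall>\<^sub>F j in sequentially. q ^ j * d0 < e"
    using e by (intro order_tendstoD(2)) auto
  then obtain j where "q ^ j * d0 < e" by (auto simp: eventually_sequentially)
  with iter[of j] show "norm_le \<tau> f (c / (1 - q) + e)" by (auto intro: norm_le_mono)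
qed (use q c in simp)

text \<open>Banach's fixed point theorem. The set \<open>B\<close> may be bounded in a stronger norm
  than the one in which \<open>T\<close> contracts; its closedness under coefficientwise
  limits keeps the fixed point in it.\<close>

lemma contraction_fixpoint:
  fixes T :: "(nat \<Rightarrow> int \<Rightarrow> complex) \<Rightarrow> nat \<Rightarrow> int \<Rightarrow> complex"
  assumes x0: "x0 \<in> B" and T: "\<And>x. x \<in> B \<Longrightarrow> T x \<in> B"
    and closed: "\<And>X x. (\<And>j. X j \<in> B) \<Longrightarrow> (\<And>n m. (\<lambda>j. X j n m) \<longlonglongrightarrow> x n m) \<Longrightarrow> x \<in> B"
    and q: "0 \<le> q" "q < 1"
    and contr: "\<And>x y d. x \<in> B \<Longrightarrow> y \<in> B \<Longrightarrow> norm_le \<tau> (\<lambda>n m. x n m - y n m) d \<Longrightarrow>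
      norm_le \<tau> (\<lambda>n m. T x n m - T y n m) (q * d)"
    and fin: "norm_le \<tau> (\<lambda>n m. T x0 n m - x0 n m) d0"
  shows "\<exists>x\<in>B. T x = x"
proof -
  define X where "X j = (T ^^ j) x0" for j
  have XB: "X j \<in> B" for j by (induction j) (auto simp: X_def x0 T)
  have X_Suc: "X (Suc j) = T (X j)" for j by (simp add: X_def)
  have step: "norm_le \<tau> (\<lambda>n m. X (Suc j) n m - X j n m) (q ^ j * d0)" for j
  proof (induction j)
    case 0 then show ?case using fin by (simp add: X_def)
  next
    case (Suc j)
    show ?case using contr[OF XB XB Suc] by (simp add: X_Suc mult.assoc)
  qed
  have sq: "summable (\<lambda>j. q ^ j * d0)" using q by (intro summable_mult2 summable_geometric) auto
  define x where "x n m = x0 n m + (\<Sum>j. X (Suc j) n m - X j n m)" for n m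
  have X_tele: "X k n m = x0 n m + (\<Sum>j<k. X (Suc j) n m - X j n m)" for k n m
    by (subst sum_lessThan_telescope) (simp add: X_def)
  have sm: "summable (\<lambda>j. X (Suc j) n m - X j n m)" for n m
    by (rule norm_le_suminf(2)[OF step sq])
  have lim: "(\<lambda>k. X k n m) \<longlonglongrightarrow> x n m" for n m
    unfolding x_def by (subst X_tele) (intro tendsto_intros summable_LIMSEQ[OF sm])
  have xB: "x \<in> B" by (rule closed[OF XB lim])
  have tail: "norm_le \<tau> (\<lambda>n m. X k n m - x n m) (\<Sum>j. q ^ (j + k) * d0)" for k
  proof -
    have "norm_le \<tau> (\<lambda>n m. \<Sum>j. X (Suc (j + k)) n m - X (j + k) n m) (\<Sum>j. q ^ (j + k) * d0)"
      by (rule norm_le_suminf(1)[OF step]) (rule summable_ignore_initial_segment[OF sq])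
    moreover have "(\<Sum>j. X (Suc (j + k)) n m - X (j + k) n m) = x n m - X k n m" for n m
      unfolding suminf_minus_initial_segment[OF sm] x_def X_tele[of k n m]
      by (simp only: add_diff_cancel_left)
    ultimately show ?thesis by (simp add: norm_le_minus_commute)
  qed
  have tail0: "(\<lambda>k. \<Sum>j. q ^ (j + k) * d0) \<longlonglongrightarrow> 0" by (rule suminf_exist_split2[OF sq])
  have "T x n m = x n m" for n m
  proof -
    have "(\<lambda>k. X (Suc k) n m) \<longlonglongrightarrow> T x n m"
    proof (rule LIM_zero_cancel, rule Lim_null_comparison)
      show "\<forall>\<^sub>F k in sequentially. cmod (X (Suc k) n m - T x n m)
          \<le> exp (- \<tau> * real n) * (q * (\<Sum>j. q ^ (j + k) * d0))"
        by (rule always_eventually) (use norm_le_pointwise[OF contr[OF XB xB tail]] in \<open>simp add: X_Suc\<close>)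
      show "(\<lambda>k. exp (- \<tau> * real n) * (q * (\<Sum>j. q ^ (j + k) * d0))) \<longlonglongrightarrow> 0"
        using tail0 by (auto intro!: tendsto_mult_right_zero)
    qed
    then show ?thesis using LIMSEQ_unique[OF _ LIMSEQ_Suc[OF lim]] by blast
  qed
  with xB show ?thesis by blast
qed

end

section \<open>Convolution and power series\<close>

lemma infsum_diff:
  fixes f g :: "'a \<Rightarrow> complex"
  assumes "f summable_on A" "g summable_on A"
  shows "(\<Sum>\<^sub>\<infinity>x\<in>A. f x - g x) = (\<Sum>\<^sub>\<infinity>x\<in>A. f x) - (\<Sum>\<^sub>\<infinity>x\<in>A. g x)"
  using infsum_add[OF assms(1) summable_on_uminus[THEN iffD2, OF assms(2)]]
  by (simp add: infsum_uminus)

definition conv :: "(int \<Rightarrow> complex) \<Rightarrow> (int \<Rightarrow> complex) \<Rightarrow> int \<Rightarrow> complex" where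
  "conv f g m = (\<Sum>\<^sub>\<infinity>k. f k * g (m - k))"

abbreviation l1 :: "(int \<Rightarrow> complex) \<Rightarrow> bool" where
  "l1 f \<equiv> (\<lambda>m. cmod (f m)) summable_on UNIV"

lemma l1_diff: "l1 f \<Longrightarrow> l1 g \<Longrightarrow> l1 (\<lambda>m. f m - g m)"
  by (rule summable_on_comparison_test[OF summable_on_add[of "\<lambda>m. cmod (f m)" UNIV "\<lambda>m. cmod (g m)"]])
    (auto intro: norm_triangle_ineq4)

lemma l1_add: "l1 f \<Longrightarrow> l1 g \<Longrightarrow> l1 (\<lambda>m. f m + g m)"
  by (rule summable_on_comparison_test[OF summable_on_add[of "\<lambda>m. cmod (f m)" UNIV "\<lambda>m. cmod (g m)"]])
    (auto intro: norm_triangle_ineq)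

lemma l1_cmult: "l1 f \<Longrightarrow> l1 (\<lambda>m. c * f m)"
  by (simp add: norm_mult summable_on_cmult_right)

lemma l1_double:
  assumes "l1 f" "l1 g"
  shows "(\<lambda>(k, m). cmod (f k * g (m - k))) summable_on UNIV"
proof -
  define F where "F = (\<lambda>(k, l). f k * g l)"
  have "(\<lambda>p. norm (F p)) summable_on UNIV \<times> UNIV"
    unfolding Infinite_Sum.abs_summable_on_Sigma_iff
  proof (intro conjI ballI)
    fix k
    show "(\<lambda>l. norm (F (k, l))) summable_on UNIV"
      by (simp add: F_def norm_mult summable_on_cmult_right assms)
    have "(\<lambda>k. norm (\<Sum>\<^sub>\<infinity>l. norm (F (k, l)))) = (\<lambda>k. cmod (f k) * norm (\<Sum>\<^sub>\<infinity>l. cmod (g l)))"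
      by (simp add: F_def norm_mult infsum_cmult_right' abs_mult)
    then show "(\<lambda>k. norm (\<Sum>\<^sub>\<infinity>l. norm (F (k, l)))) summable_on UNIV"
      by (simp only: summable_on_cmult_left assms)
  qed
  then have "(\<lambda>(k, l). cmod (f k * g l)) summable_on UNIV"
    by (simp add: F_def case_prod_unfold)
  also have "?this \<longleftrightarrow> (\<lambda>(k, m). cmod (f k * g (m - k))) summable_on UNIV"
    by (rule summable_on_reindex_bij_witness
        [of _ "\<lambda>(k, m). (k, m - k)" "\<lambda>(k, l). (k, k + l)"]) auto
  finally show ?thesis .
qed

lemma conv_summable:
  assumes "l1 f" "l1 g"
  shows "l1 (\<lambda>k. f k * g (m - k))"
proof -
  have "(\<lambda>(k, m). cmod (f k * g (m - k))) summable_on (\<lambda>k. (k, m)) ` UNIV"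
    by (rule summable_on_subset_banach[OF l1_double[OF assms]]) simp
  then show ?thesis by (subst (asm) summable_on_reindex) (auto simp: inj_on_def o_def)
qed

lemma conv_summable': "l1 f \<Longrightarrow> l1 g \<Longrightarrow> (\<lambda>k. f k * g (m - k)) summable_on UNIV"
  by (rule abs_summable_summable[OF conv_summable])

lemma l1_conv:
  assumes "l1 f" "l1 g"
  shows "l1 (conv f g)"
proof -
  have sm: "(\<lambda>(m, k). cmod (f k * g (m - k))) summable_on UNIV \<times> UNIV"
    using l1_double[OF assms] summable_on_swap[of "\<lambda>(k, m). cmod (f k * g (m - k))" UNIV UNIV]
    by simp
  have "(\<lambda>m. \<Sum>\<^sub>\<infinity>k. cmod (f k * g (m - k))) summable_on UNIV"
    using summable_on_Sigma_banach[OF sm] by simp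
  then show ?thesis
    unfolding conv_def
    by (rule summable_on_comparison_test) (auto intro: norm_infsum_bound conv_summable[OF assms])
qed

lemma conv_diff_left:
  "l1 f \<Longrightarrow> l1 g \<Longrightarrow> l1 h \<Longrightarrow> conv (\<lambda>m. f m - g m) h m = conv f h m - conv g h m"
  unfolding conv_def left_diff_distrib by (intro infsum_diff conv_summable')

lemma conv_diff_right:
  "l1 f \<Longrightarrow> l1 g \<Longrightarrow> l1 h \<Longrightarrow> conv h (\<lambda>m. f m - g m) m = conv h f m - conv h g m"
  unfolding conv_def right_diff_distrib by (intro infsum_diff conv_summable')

lemma conv_modulate:
  "conv (\<lambda>m. f m * cis (of_int m * \<alpha>)) (\<lambda>m. g m * cis (of_int m * \<alpha>)) m
     = conv f g m * cis (of_int m * \<alpha>)"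
proof -
  have "f k * cis (of_int k * \<alpha>) * (g (m - k) * cis (of_int (m - k) * \<alpha>))
      = f k * g (m - k) * cis (of_int m * \<alpha>)" for k
  proof -
    have "cis (of_int k * \<alpha>) * cis (of_int (m - k) * \<alpha>) = cis (of_int m * \<alpha>)"
      by (simp add: cis_mult distrib_right[symmetric])
    then show ?thesis by (simp add: algebra_simps)
  qed
  then show ?thesis by (simp only: conv_def infsum_cmult_left')
qed

lemma conv_scale: "conv (\<lambda>m. c * f m) (\<lambda>m. d * g m) m = c * d * conv f g m"
proof -
  have "c * f k * (d * g (m - k)) = c * d * (f k * g (m - k))" for k by (simp add: algebra_simps)
  then show ?thesis by (simp only: conv_def infsum_cmult_right')
qed

text \<open>A Hermitian coefficient sequence is one whose Fourier series is real-valued.\<close>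

definition hermitian :: "(int \<Rightarrow> complex) \<Rightarrow> bool" where
  "hermitian f \<longleftrightarrow> (\<forall>m. f (- m) = cnj (f m))"

lemma hermitian_conv:
  assumes "hermitian f" "hermitian g"
  shows "hermitian (conv f g)"
proof -
  have "conv f g (- m) = cnj (conv f g m)" for m
  proof -
    have "conv f g (- m) = (\<Sum>\<^sub>\<infinity>k. f (- k) * g (- m - (- k)))"
      unfolding conv_def by (rule infsum_reindex_bij_witness[of _ uminus uminus]) auto
    also have "\<dots> = (\<Sum>\<^sub>\<infinity>k. cnj (f k * g (m - k)))"
    proof (rule infsum_cong)
      fix k :: int
      have "g (- m - (- k)) = g (- (m - k))" by simp
      then show "f (- k) * g (- m - (- k)) = cnj (f k * g (m - k))"
        using assms unfolding hermitian_def by (metis complex_cnj_mult)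
    qed
    finally show ?thesis by (simp only: conv_def infsum_cnj)
  qed
  then show ?thesis by (simp add: hermitian_def)
qed

definition fourier :: "(int \<Rightarrow> complex) \<Rightarrow> real \<Rightarrow> complex" where
  "fourier f \<theta> = (\<Sum>\<^sub>\<infinity>m. f m * cis (of_int m * \<theta>))"

lemma fourier_summable: "l1 f \<Longrightarrow> (\<lambda>m. f m * cis (of_int m * \<theta>)) summable_on UNIV"
  by (rule abs_summable_summable) (simp add: norm_mult)

lemma fourier_diff:
  "l1 f \<Longrightarrow> l1 g \<Longrightarrow> fourier (\<lambda>m. f m - g m) \<theta> = fourier f \<theta> - fourier g \<theta>"
  unfolding fourier_def left_diff_distrib by (intro infsum_diff fourier_summable)

lemma fourier_add:
  "l1 f \<Longrightarrow> l1 g \<Longrightarrow> fourier (\<lambda>m. f m + g m) \<theta> = fourier f \<theta> + fourier g \<theta>"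
  unfolding fourier_def distrib_right by (intro infsum_add fourier_summable)

lemma fourier_cmult: "fourier (\<lambda>m. c * f m) \<theta> = c * fourier f \<theta>"
  unfolding fourier_def by (simp add: mult.assoc infsum_cmult_right')

lemma norm_fourier_le: "l1 f \<Longrightarrow> cmod (fourier f \<theta>) \<le> (\<Sum>\<^sub>\<infinity>m. cmod (f m))"
  unfolding fourier_def
  by (rule order_trans[OF norm_infsum_bound]) (auto simp: norm_mult)

lemma fourier_real:
  assumes "hermitian f"
  shows "cnj (fourier f \<theta>) = fourier f \<theta>"
proof -
  have "fourier f \<theta> = (\<Sum>\<^sub>\<infinity>m. f (- m) * cis (of_int (- m) * \<theta>))"
    unfolding fourier_def by (rule infsum_reindex_bij_witness[of _ uminus uminus]) auto
  also have "\<dots> = (\<Sum>\<^sub>\<infinity>m. cnj (f m * cis (of_int m * \<theta>)))"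
    by (rule infsum_cong) (use assms in \<open>simp add: hermitian_def cis_cnj\<close>)
  finally show ?thesis by (simp only: fourier_def infsum_cnj)
qed

lemma fourier_conv:
  assumes "l1 f" "l1 g"
  shows "fourier (conv f g) \<theta> = fourier f \<theta> * fourier g \<theta>"
proof -
  define a b where "a m = f m * cis (of_int m * \<theta>)" and "b m = g m * cis (of_int m * \<theta>)" for m
  have ab: "l1 a" "l1 b" using assms by (simp_all add: a_def b_def norm_mult)
  have sm: "(\<lambda>(k, m). a k * b (m - k)) summable_on UNIV \<times> UNIV"
    using abs_summable_summable[of "\<lambda>(k, m). a k * b (m - k)" UNIV] l1_double[OF ab]
    by (simp add: case_prod_unfold)
  have inner: "(\<Sum>\<^sub>\<infinity>m. b (m - k)) = (\<Sum>\<^sub>\<infinity>m. b m)" for k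
    by (rule infsum_reindex_bij_witness[of _ "\<lambda>m. m + k" "\<lambda>m. m - k"]) auto
  have "fourier (conv f g) \<theta> = (\<Sum>\<^sub>\<infinity>m. \<Sum>\<^sub>\<infinity>k. a k * b (m - k))"
    unfolding fourier_def conv_modulate[symmetric] unfolding conv_def a_def b_def ..
  also have "\<dots> = (\<Sum>\<^sub>\<infinity>k. \<Sum>\<^sub>\<infinity>m. a k * b (m - k))"
    using infsum_swap_banach[OF sm] by simp
  also have "\<dots> = (\<Sum>\<^sub>\<infinity>k. a k * (\<Sum>\<^sub>\<infinity>m. b m))"
    by (simp add: infsum_cmult_right' inner)
  also have "\<dots> = (\<Sum>\<^sub>\<infinity>k. a k) * (\<Sum>\<^sub>\<infinity>m. b m)"
    by (simp add: infsum_cmult_left')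
  finally show ?thesis by (simp add: fourier_def a_def b_def)
qed

text \<open>The exponent is shifted by one: \<open>conv_pow k f\<close> is the \<open>(k+1)\<close>-st power, since the
  unit of convolution has norm \<open>w 0\<close>, which may exceed \<open>1\<close>.\<close>

primrec conv_pow :: "nat \<Rightarrow> (int \<Rightarrow> complex) \<Rightarrow> int \<Rightarrow> complex" where
  "conv_pow 0 f = f"
| "conv_pow (Suc k) f = conv f (conv_pow k f)"

definition conv_series :: "(nat \<Rightarrow> real) \<Rightarrow> (int \<Rightarrow> complex) \<Rightarrow> int \<Rightarrow> complex" where
  "conv_series c f m = (\<Sum>k. of_real (c k) * conv_pow k f m)"

lemma l1_conv_pow: "l1 f \<Longrightarrow> l1 (conv_pow k f)"
  by (induction k) (auto intro: l1_conv)

lemma conv_pow_scale: "conv_pow k (\<lambda>m. c * f m) m = c ^ Suc k * conv_pow k f m"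
proof (induction k arbitrary: m)
  case (Suc k)
  have "conv_pow k (\<lambda>m. c * f m) = (\<lambda>m. c ^ Suc k * conv_pow k f m)" using Suc by blast
  then show ?case by (simp add: conv_scale del: power_Suc) simp
qed simp

lemma conv_pow_modulate:
  "conv_pow k (\<lambda>m. f m * cis (of_int m * \<alpha>)) m = conv_pow k f m * cis (of_int m * \<alpha>)"
proof (induction k arbitrary: m)
  case (Suc k)
  have "conv_pow k (\<lambda>m. f m * cis (of_int m * \<alpha>)) = (\<lambda>m. conv_pow k f m * cis (of_int m * \<alpha>))"
    using Suc by blast
  then show ?case by (simp add: conv_modulate)
qed simp

lemma conv_series_modulate:
  assumes "summable (\<lambda>k. of_real (c k) * conv_pow k f m)"
  shows "conv_series c (\<lambda>m. f m * cis (of_int m * \<alpha>)) m = conv_series c f m * cis (of_int m * \<alpha>)"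
  using suminf_mult2[OF assms, of "cis (of_int m * \<alpha>)"]
  by (simp add: conv_series_def conv_pow_modulate mult.assoc)

lemma hermitian_conv_pow: "hermitian f \<Longrightarrow> hermitian (conv_pow k f)"
  by (induction k) (auto intro: hermitian_conv)

lemma hermitian_conv_series:
  assumes "hermitian f" "\<And>m. summable (\<lambda>k. of_real (c k) * conv_pow k f m)"
  shows "hermitian (conv_series c f)"
proof -
  have "conv_series c f (- m) = cnj (conv_series c f m)" for m
  proof -
    have "conv_series c f (- m) = (\<Sum>k. cnj (of_real (c k) * conv_pow k f m))"
      using hermitian_conv_pow[OF assms(1)] by (simp add: conv_series_def hermitian_def)
    also have "\<dots> = cnj (conv_series c f m)"
      unfolding conv_series_def
      by (rule bounded_linear.suminf[OF bounded_linear_cnj assms(2), symmetric])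
    finally show ?thesis .
  qed
  then show ?thesis by (simp add: hermitian_def)
qed

lemma real_conv_pow: "(\<And>m. cnj (f m) = f m) \<Longrightarrow> cnj (conv_pow k f m) = conv_pow k f m"
proof (induction k arbitrary: m)
  case (Suc k)
  then show ?case by (simp add: conv_def flip: infsum_cnj)
qed simp

lemma fourier_conv_pow: "l1 f \<Longrightarrow> fourier (conv_pow k f) \<theta> = fourier f \<theta> ^ Suc k"
  by (induction k) (simp_all add: fourier_conv l1_conv_pow)

context weighted
begin

lemma norm_le_l1: "norm_le \<sigma> f r \<Longrightarrow> l1 (f n)"
  using norm_le_abs_summable(1) by simp

text \<open>Submultiplicativity. The weights satisfy \<open>w m \<le> w (m - k) * w k\<close>, hence each
  term \<open>f k * g (\<cdot> - k)\<close> of the convolution has norm at most \<open>w k * \<bar>f k\<bar>\<close> times that of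
  \<open>g\<close>; the finite partial sums over \<open>k\<close> obey the bound, and it passes to the limit.
  The exponential weights in \<open>n\<close> multiply because the product in \<open>n\<close> is pointwise.\<close>

lemma norm_le_conv:
  assumes f: "norm_le \<sigma> f r" and g: "norm_le \<tau> g s"
  shows "norm_le (\<sigma> + \<tau>) (\<lambda>n. conv (f n) (g n)) (r * s)"
proof -
  obtain M where M: "\<And>n m. exp (\<sigma> * real n) * cmod (f n m) \<le> M m" "\<And>m. 0 \<le> M m"
    "\<And>A. finite A \<Longrightarrow> (\<Sum>m\<in>A. w m * M m) \<le> r" by (rule norm_leE[OF f]) blast
  obtain N where N: "\<And>n m. exp (\<tau> * real n) * cmod (g n m) \<le> N m" "\<And>m. 0 \<le> N m"
    "\<And>A. finite A \<Longrightarrow> (\<Sum>m\<in>A. w m * N m) \<le> s" by (rule norm_leE[OF g]) blast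
  have s: "0 \<le> s" by (rule norm_le_nonneg[OF g])
  have single: "norm_le (\<sigma> + \<tau>) (\<lambda>n m. f n k * g n (m - k)) (w k * M k * s)" for k
  proof (rule norm_leI[where M = "\<lambda>m. M k * N (m - k)"])
    show "exp ((\<sigma> + \<tau>) * real n) * cmod (f n k * g n (m - k)) \<le> M k * N (m - k)" for n m
    proof -
      have "exp ((\<sigma> + \<tau>) * real n) * cmod (f n k * g n (m - k))
        = (exp (\<sigma> * real n) * cmod (f n k)) * (exp (\<tau> * real n) * cmod (g n (m - k)))"
        by (simp add: norm_mult distrib_right exp_add)
      also have "\<dots> \<le> M k * N (m - k)" by (rule mult_mono[OF M(1) N(1) M(2)]) simp
      finally show ?thesis .
    qed
    show "(\<Sum>m\<in>A. w m * (M k * N (m - k))) \<le> w k * M k * s" if A: "finite A" for A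
    proof -
      have "(\<Sum>m\<in>A. w m * (M k * N (m - k))) \<le> (\<Sum>m\<in>A. (w (m - k) * w k) * (M k * N (m - k)))"
        by (intro sum_mono mult_right_mono weight_submult) (simp add: M(2) N(2))
      also have "\<dots> = w k * M k * (\<Sum>m\<in>A. w (m - k) * N (m - k))"
        by (simp add: sum_distrib_left mult_ac)
      also have "(\<Sum>m\<in>A. w (m - k) * N (m - k)) = (\<Sum>l\<in>(\<lambda>m. m - k) ` A. w l * N l)"
        by (subst sum.reindex) (auto simp: inj_on_def)
      also have "w k * M k * \<dots> \<le> w k * M k * s"
        by (intro mult_left_mono N(3)) (simp_all add: A M(2))
      finally show ?thesis .
    qed
  qed
  show ?thesis
  proof (rule norm_le_limit[where F = "finite_subsets_at_top UNIV"])
    show "((\<lambda>A. \<Sum>k\<in>A. f n k * g n (m - k)) \<longlongrightarrow> conv (f n) (g n) m) (finite_subsets_at_top UNIV)"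
      for n m
      unfolding conv_def by (rule infsum_tendsto[OF conv_summable'[OF norm_le_l1[OF f] norm_le_l1[OF g]]])
    show "\<forall>\<^sub>F A in finite_subsets_at_top UNIV.
        norm_le (\<sigma> + \<tau>) (\<lambda>n m. \<Sum>k\<in>A. f n k * g n (m - k)) (r * s)"
    proof (rule eventually_mono[OF eventually_finite_subsets_at_top_weakI])
      fix A :: "int set" assume A: "finite A"
      have "(\<Sum>k\<in>A. w k * M k * s) \<le> r * s"
        unfolding sum_distrib_right[symmetric] by (rule mult_right_mono[OF M(3)[OF A] s])
      then show "norm_le (\<sigma> + \<tau>) (\<lambda>n m. \<Sum>k\<in>A. f n k * g n (m - k)) (r * s)"
        by (rule norm_le_mono[OF norm_le_sum[OF single]])
    qed
  qed simp
qed

lemma norm_le_conv_pow: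
  assumes "norm_le 0 f s"
  shows "norm_le 0 (\<lambda>n. conv_pow k (f n)) (s ^ Suc k)"
proof (induction k)
  case (Suc k)
  then show ?case using norm_le_conv[OF assms Suc] by simp
qed (simp add: assms)

text \<open>By induction, from \<open>f ^ (k + 1) - g ^ (k + 1) = f * (f ^ k - g ^ k) + (f - g) * g ^ k\<close>. The
  difference \<open>f - g\<close> may be measured at any rate \<open>\<tau>\<close>, since it occurs exactly once in each
  product.\<close>

lemma conv_pow_lipschitz:
  assumes f: "norm_le 0 f s" and g: "norm_le 0 g s"
    and d: "norm_le \<tau> (\<lambda>n m. f n m - g n m) d"
  shows "norm_le \<tau> (\<lambda>n m. conv_pow k (f n) m - conv_pow k (g n) m) (real (Suc k) * s ^ k * d)"
proof (induction k)
  case (Suc k)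
  note l1 = norm_le_l1[OF f] norm_le_l1[OF g] l1_conv_pow l1_diff
  have eq: "conv_pow (Suc k) (f n) m - conv_pow (Suc k) (g n) m
     = conv (f n) (\<lambda>m. conv_pow k (f n) m - conv_pow k (g n) m) m
       + conv (\<lambda>m. f n m - g n m) (conv_pow k (g n)) m" for n m
    by (simp add: conv_diff_left conv_diff_right l1)
  have "norm_le \<tau> (\<lambda>n m. conv_pow (Suc k) (f n) m - conv_pow (Suc k) (g n) m)
      (s * (real (Suc k) * s ^ k * d) + d * s ^ Suc k)"
    unfolding eq
    using norm_le_add norm_le_conv[OF f Suc] norm_le_conv[OF d norm_le_conv_pow[OF g]] by simp
  then show ?case by (rule norm_le_mono) (simp add: algebra_simps)
qed (simp add: d)

text \<open>The second difference of the power map. The difference \<open>f - f'\<close> is only controlled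
  in a norm that tolerates growth in \<open>n\<close>; it always occurs multiplied by an increment
  \<open>g - f\<close> (or \<open>g' - f'\<close>) that decays twice as fast as the required rate \<open>\<tau>\<close>.\<close>

lemma conv_pow_second_difference:
  assumes \<tau>: "0 \<le> \<tau>"
    and f: "norm_le 0 f s" and g: "norm_le 0 g s" and f': "norm_le 0 f' s" and g': "norm_le 0 g' s"
    and gf: "norm_le (2 * \<tau>) (\<lambda>n m. g n m - f n m) \<beta>"
    and gf': "norm_le (2 * \<tau>) (\<lambda>n m. g' n m - f' n m) \<beta>"
    and d: "norm_le \<tau> (\<lambda>n m. (g n m - f n m) - (g' n m - f' n m)) d"
    and e: "norm_le (- \<tau>) (\<lambda>n m. f n m - f' n m) e"
  shows "norm_le \<tau> (\<lambda>n m. (conv_pow k (g n) m - conv_pow k (f n) m)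
      - (conv_pow k (g' n) m - conv_pow k (f' n) m))
    (real (Suc k) * s ^ k * d + real (k * Suc k) / 2 * s ^ (k - 1) * \<beta> * (2 * e + d))"
proof (induction k)
  case (Suc k)
  note l1 = norm_le_l1[OF f] norm_le_l1[OF g] norm_le_l1[OF f'] norm_le_l1[OF g'] l1_conv_pow l1_diff
  have eq: "(conv_pow (Suc k) (g n) m - conv_pow (Suc k) (f n) m)
      - (conv_pow (Suc k) (g' n) m - conv_pow (Suc k) (f' n) m)
    = conv (\<lambda>m. (g n m - f n m) - (g' n m - f' n m)) (conv_pow k (g n)) m
      + conv (\<lambda>m. g' n m - f' n m) (\<lambda>m. conv_pow k (g n) m - conv_pow k (g' n) m) m
      + conv (\<lambda>m. f n m - f' n m) (\<lambda>m. conv_pow k (g n) m - conv_pow k (f n) m) m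
      + conv (f' n) (\<lambda>m. (conv_pow k (g n) m - conv_pow k (f n) m)
          - (conv_pow k (g' n) m - conv_pow k (f' n) m)) m" for n m
    by (simp add: conv_diff_left conv_diff_right l1)
  have gg': "norm_le (- \<tau>) (\<lambda>n m. g n m - g' n m) (e + d)"
  proof -
    have "norm_le (- \<tau>) (\<lambda>n m. (g n m - f n m) - (g' n m - f' n m)) d"
      by (rule norm_le_weaken[OF d]) (use \<tau> in simp)
    from norm_le_add[OF e this] show ?thesis by (simp add: algebra_simps)
  qed
  have 1: "norm_le \<tau> (\<lambda>n. conv (\<lambda>m. (g n m - f n m) - (g' n m - f' n m)) (conv_pow k (g n)))
      (d * s ^ Suc k)"
    using norm_le_conv[OF d norm_le_conv_pow[OF g]] by simp
  have 2: "norm_le \<tau> (\<lambda>n. conv (\<lambda>m. g' n m - f' n m)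
      (\<lambda>m. conv_pow k (g n) m - conv_pow k (g' n) m)) (\<beta> * (real (Suc k) * s ^ k * (e + d)))"
    using norm_le_conv[OF gf' conv_pow_lipschitz[OF g g' gg']] by simp
  have 3: "norm_le \<tau> (\<lambda>n. conv (\<lambda>m. f n m - f' n m)
      (\<lambda>m. conv_pow k (g n) m - conv_pow k (f n) m)) (e * (real (Suc k) * s ^ k * \<beta>))"
    using norm_le_conv[OF e conv_pow_lipschitz[OF g f gf]] by simp
  have 4: "norm_le \<tau> (\<lambda>n. conv (f' n) (\<lambda>m. (conv_pow k (g n) m - conv_pow k (f n) m)
      - (conv_pow k (g' n) m - conv_pow k (f' n) m)))
     (s * (real (Suc k) * s ^ k * d + real (k * Suc k) / 2 * s ^ (k - 1) * \<beta> * (2 * e + d)))"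
    using norm_le_conv[OF f' Suc] by simp
  have s: "s * (real (k * Suc k) / 2 * s ^ (k - 1)) = real (k * Suc k) / 2 * s ^ k"
    by (cases k) auto
  have "d * s ^ Suc k + \<beta> * (real (Suc k) * s ^ k * (e + d)) + e * (real (Suc k) * s ^ k * \<beta>)
      + s * (real (Suc k) * s ^ k * d + real (k * Suc k) / 2 * s ^ (k - 1) * \<beta> * (2 * e + d))
    = d * s ^ Suc k + \<beta> * (real (Suc k) * s ^ k * (e + d)) + e * (real (Suc k) * s ^ k * \<beta>)
      + s * (real (Suc k) * s ^ k * d)
      + (s * (real (k * Suc k) / 2 * s ^ (k - 1))) * (\<beta> * (2 * e + d))"
    by (simp add: algebra_simps)
  also have "\<dots> = real (Suc (Suc k)) * s ^ Suc k * d
      + real (Suc k * Suc (Suc k)) / 2 * s ^ (Suc k - 1) * \<beta> * (2 * e + d)"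
    unfolding s by (simp add: field_simps)
  finally show ?case
    unfolding eq using norm_le_add[OF norm_le_add[OF norm_le_add[OF 1 2] 3] 4] by simp
qed (simp add: d)

lemma conv_series_summable:
  assumes f: "norm_le 0 f s" and c: "summable (\<lambda>k. \<bar>c k\<bar> * s ^ Suc k)"
  shows "summable (\<lambda>k. of_real (c k) * conv_pow k (f n) m)"
    and "norm_le 0 (\<lambda>n. conv_series c (f n)) (\<Sum>k. \<bar>c k\<bar> * s ^ Suc k)"
proof -
  have *: "norm_le 0 (\<lambda>n m. of_real (c k) * conv_pow k (f n) m) (\<bar>c k\<bar> * s ^ Suc k)" for k
    using norm_le_cmult[OF norm_le_conv_pow[OF f, of k], of "of_real (c k)"] by simp
  show "summable (\<lambda>k. of_real (c k) * conv_pow k (f n) m)"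
    by (rule norm_le_suminf(2)[OF * c])
  show "norm_le 0 (\<lambda>n. conv_series c (f n)) (\<Sum>k. \<bar>c k\<bar> * s ^ Suc k)"
    unfolding conv_series_def by (rule norm_le_suminf(1)[OF * c])
qed

lemma conv_series_lipschitz:
  assumes f: "norm_le 0 f s" and g: "norm_le 0 g s"
    and c: "summable (\<lambda>k. \<bar>c k\<bar> * s ^ Suc k)" "summable (\<lambda>k. \<bar>c k\<bar> * (real (Suc k) * s ^ k))"
    and d: "norm_le \<tau> (\<lambda>n m. f n m - g n m) d"
  shows "norm_le \<tau> (\<lambda>n m. conv_series c (f n) m - conv_series c (g n) m)
    ((\<Sum>k. \<bar>c k\<bar> * (real (Suc k) * s ^ k)) * d)"
proof -
  have *: "norm_le \<tau> (\<lambda>n m. of_real (c k) * (conv_pow k (f n) m - conv_pow k (g n) m))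
     (\<bar>c k\<bar> * (real (Suc k) * s ^ k) * d)" for k
    using norm_le_cmult[OF conv_pow_lipschitz[OF f g d, of k], of "of_real (c k)"]
    by (simp add: mult.assoc)
  have "norm_le \<tau> (\<lambda>n m. \<Sum>k. of_real (c k) * (conv_pow k (f n) m - conv_pow k (g n) m))
      (\<Sum>k. \<bar>c k\<bar> * (real (Suc k) * s ^ k) * d)"
    by (rule norm_le_suminf(1)[OF * summable_mult2[OF c(2)]])
  also have "(\<Sum>k. \<bar>c k\<bar> * (real (Suc k) * s ^ k) * d)
      = (\<Sum>k. \<bar>c k\<bar> * (real (Suc k) * s ^ k)) * d"
    by (rule suminf_mult2[OF c(2), symmetric])
  also have "(\<lambda>n m. \<Sum>k. of_real (c k) * (conv_pow k (f n) m - conv_pow k (g n) m))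
    = (\<lambda>n m. conv_series c (f n) m - conv_series c (g n) m)"
    unfolding conv_series_def right_diff_distrib
    by (intro ext suminf_diff[symmetric] conv_series_summable(1)[OF f c(1)]
        conv_series_summable(1)[OF g c(1)])
  finally show ?thesis .
qed

lemma conv_series_second_difference:
  assumes \<tau>: "0 \<le> \<tau>"
    and f: "norm_le 0 f s" and g: "norm_le 0 g s" and f': "norm_le 0 f' s" and g': "norm_le 0 g' s"
    and c: "summable (\<lambda>k. \<bar>c k\<bar> * s ^ Suc k)" "summable (\<lambda>k. \<bar>c k\<bar> * (real (Suc k) * s ^ k))"
      "summable (\<lambda>k. \<bar>c k\<bar> * (real (k * Suc k) / 2 * s ^ (k - 1)))"
    and gf: "norm_le (2 * \<tau>) (\<lambda>n m. g n m - f n m) \<beta>"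
    and gf': "norm_le (2 * \<tau>) (\<lambda>n m. g' n m - f' n m) \<beta>"
    and d: "norm_le \<tau> (\<lambda>n m. (g n m - f n m) - (g' n m - f' n m)) d"
    and e: "norm_le (- \<tau>) (\<lambda>n m. f n m - f' n m) e"
  shows "norm_le \<tau> (\<lambda>n m. (conv_series c (g n) m - conv_series c (f n) m)
      - (conv_series c (g' n) m - conv_series c (f' n) m))
    ((\<Sum>k. \<bar>c k\<bar> * (real (Suc k) * s ^ k)) * d
     + (\<Sum>k. \<bar>c k\<bar> * (real (k * Suc k) / 2 * s ^ (k - 1))) * (\<beta> * (2 * e + d)))"
proof -
  define D where "D k n m = of_real (c k) * ((conv_pow k (g n) m - conv_pow k (f n) m)
      - (conv_pow k (g' n) m - conv_pow k (f' n) m))" for k n m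
  have *: "norm_le \<tau> (D k) (\<bar>c k\<bar> * (real (Suc k) * s ^ k) * d
      + \<bar>c k\<bar> * (real (k * Suc k) / 2 * s ^ (k - 1)) * (\<beta> * (2 * e + d)))" for k
    unfolding D_def
    using norm_le_cmult[OF conv_pow_second_difference[OF \<tau> f g f' g' gf gf' d e, of k],
        of "of_real (c k)"]
    by (simp only: distrib_left mult.assoc norm_of_real)
  have "norm_le \<tau> (\<lambda>n m. \<Sum>k. D k n m)
      (\<Sum>k. \<bar>c k\<bar> * (real (Suc k) * s ^ k) * d
        + \<bar>c k\<bar> * (real (k * Suc k) / 2 * s ^ (k - 1)) * (\<beta> * (2 * e + d)))"
    by (rule norm_le_suminf(1)[OF * summable_add[OF summable_mult2[OF c(2)] summable_mult2[OF c(3)]]])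
  also have "(\<Sum>k. \<bar>c k\<bar> * (real (Suc k) * s ^ k) * d
        + \<bar>c k\<bar> * (real (k * Suc k) / 2 * s ^ (k - 1)) * (\<beta> * (2 * e + d)))
     = (\<Sum>k. \<bar>c k\<bar> * (real (Suc k) * s ^ k)) * d
     + (\<Sum>k. \<bar>c k\<bar> * (real (k * Suc k) / 2 * s ^ (k - 1))) * (\<beta> * (2 * e + d))"
    unfolding suminf_mult2[OF c(2)] suminf_mult2[OF c(3)]
    by (rule suminf_add[symmetric]) (intro summable_mult2 c)+
  also have "(\<lambda>n m. \<Sum>k. D k n m) = (\<lambda>n m. (conv_series c (g n) m - conv_series c (f n) m)
      - (conv_series c (g' n) m - conv_series c (f' n) m))"
  proof (intro ext)
    fix n m
    note sm = conv_series_summable(1)[OF f c(1), of n m] conv_series_summable(1)[OF g c(1), of n m]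
      conv_series_summable(1)[OF f' c(1), of n m] conv_series_summable(1)[OF g' c(1), of n m]
    show "(\<Sum>k. D k n m) = (conv_series c (g n) m - conv_series c (f n) m)
      - (conv_series c (g' n) m - conv_series c (f' n) m)"
      unfolding conv_series_def D_def right_diff_distrib
      by (simp only: suminf_diff[OF sm(2) sm(1)] suminf_diff[OF sm(4) sm(3)]
          suminf_diff[OF summable_diff[OF sm(2) sm(1)] summable_diff[OF sm(4) sm(3)]])
  qed
  finally show ?thesis .
qed

text \<open>A power series of convolution powers has the scalar power series as its Fourier
  series, because the Fourier series is continuous in the norm and multiplicative.\<close>

lemma fourier_conv_series:
  assumes f: "norm_le 0 (\<lambda>_. f) s" and c: "summable (\<lambda>k. \<bar>c k\<bar> * s ^ Suc k)"
  shows "(\<lambda>k. of_real (c k) * fourier f \<theta> ^ Suc k) sums fourier (conv_series c f) \<theta>"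
proof -
  note sm = conv_series_summable[OF f c]
  have *: "norm_le 0 (\<lambda>n m. of_real (c k) * conv_pow k f m) (\<bar>c k\<bar> * s ^ Suc k)" for k
    using norm_le_cmult[OF norm_le_conv_pow[OF f, of k], of "of_real (c k)"] by simp
  define p where "p K m = (\<Sum>k<K. of_real (c k) * conv_pow k f m)" for K m
  have l1f: "l1 f" by (rule norm_le_l1[OF f])
  have p: "l1 (p K) \<and> fourier (p K) \<theta> = (\<Sum>k<K. of_real (c k) * fourier f \<theta> ^ Suc k)" for K
  proof (induction K)
    case 0 then show ?case by (simp add: p_def fourier_def)
  next
    case (Suc K)
    have "p (Suc K) = (\<lambda>m. p K m + of_real (c K) * conv_pow K f m)" by (auto simp: p_def)
    then show ?case using Suc l1f
      by (simp add: l1_add l1_cmult l1_conv_pow fourier_add fourier_cmult fourier_conv_pow del: power_Suc)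
  qed
  have tail: "cmod (fourier (p K) \<theta> - fourier (conv_series c f) \<theta>)
      \<le> (\<Sum>k. \<bar>c (k + K)\<bar> * s ^ Suc (k + K))" for K
  proof -
    have "norm_le 0 (\<lambda>n m. \<Sum>k. of_real (c (k + K)) * conv_pow (k + K) f m)
        (\<Sum>k. \<bar>c (k + K)\<bar> * s ^ Suc (k + K))"
      by (rule norm_le_suminf(1)[OF *]) (use summable_ignore_initial_segment[OF c, of K] in simp)
    also have "(\<lambda>n m. \<Sum>k. of_real (c (k + K)) * conv_pow (k + K) f m)
        = (\<lambda>n::nat. \<lambda>m. conv_series c f m - p K m)"
      by (intro ext) (simp add: conv_series_def p_def suminf_minus_initial_segment[OF sm(1)])
    finally have n: "norm_le 0 (\<lambda>n m. conv_series c f m - p K m) (\<Sum>k. \<bar>c (k + K)\<bar> * s ^ Suc (k + K))" .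
    have "fourier (conv_series c f) \<theta> - fourier (p K) \<theta> = fourier (\<lambda>m. conv_series c f m - p K m) \<theta>"
      by (rule fourier_diff[symmetric]) (use norm_le_l1[OF sm(2)] p in auto)
    also have "cmod \<dots> \<le> (\<Sum>\<^sub>\<infinity>m. cmod (conv_series c f m - p K m))"
      by (rule norm_fourier_le[OF norm_le_l1[OF n]])
    also have "\<dots> \<le> (\<Sum>k. \<bar>c (k + K)\<bar> * s ^ Suc (k + K))"
      using norm_le_abs_summable(2)[OF n, of 0] by simp
    finally show ?thesis by (simp add: norm_minus_commute)
  qed
  have "(\<lambda>K. fourier (p K) \<theta>) \<longlonglongrightarrow> fourier (conv_series c f) \<theta>"
    by (rule LIM_zero_cancel, rule Lim_null_comparison[OF always_eventually suminf_exist_split2[OF c]])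
      (use tail in auto)
  then show ?thesis using p by (simp add: sums_def)
qed

end

section \<open>Travelling waves\<close>

lemma arccos_lipschitz:
  assumes "\<bar>x\<bar> \<le> X" "\<bar>y\<bar> \<le> X" "X < 1"
  shows "\<bar>arccos x - arccos y\<bar> \<le> \<bar>x - y\<bar> / sqrt (1 - X\<^sup>2)"
proof -
  have X: "0 \<le> X" using assms by linarith
  have X2: "X\<^sup>2 < 1" using X assms by (simp add: abs_square_less_1)
  have "norm (arccos x - arccos y) \<le> 1 / sqrt (1 - X\<^sup>2) * norm (x - y)"
  proof (rule field_differentiable_bound[where S = "{- X..X}"
        and f' = "\<lambda>z. inverse (- sqrt (1 - z\<^sup>2))"])
    fix z assume z: "z \<in> {- X..X}"
    then show "(arccos has_field_derivative inverse (- sqrt (1 - z\<^sup>2))) (at z within {- X..X})"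
      using assms(3) by (intro DERIV_subset[OF DERIV_arccos]) auto
    have "z\<^sup>2 \<le> X\<^sup>2" using z by (intro abs_le_square_iff[THEN iffD1]) auto
    then show "norm (inverse (- sqrt (1 - z\<^sup>2))) \<le> 1 / sqrt (1 - X\<^sup>2)"
      using X2 by (simp add: abs_inverse inverse_eq_divide frac_le)
  qed (use assms in auto)
  then show ?thesis by simp
qed

lemma abs_sin_diff_le: "\<bar>sin x - sin y\<bar> \<le> \<bar>x - y\<bar>" for x y :: real
proof -
  have "norm (sin x - sin y) \<le> 1 * norm (x - y)"
    by (rule field_differentiable_bound[where S = UNIV and f' = cos])
      (auto intro: DERIV_sin)
  then show ?thesis by simp
qed

lemma abs_cis_diff_le: "cmod (cis x - cis y) \<le> \<bar>x - y\<bar>"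
proof -
  have "(cmod (cis x - cis y))\<^sup>2 = (cos x - cos y)\<^sup>2 + (sin x - sin y)\<^sup>2"
    by (simp add: cmod_power2)
  also have "\<dots> = 2 - 2 * cos (x - y)"
    using sin_cos_squared_add[of x] sin_cos_squared_add[of y]
    by (simp add: cos_diff power2_eq_square algebra_simps)
  also have "\<dots> = (2 * sin ((x - y) / 2))\<^sup>2"
  proof -
    have "2 * ((x - y) / 2) = x - y" by simp
    then have "cos (x - y) = 1 - 2 * (sin ((x - y) / 2))\<^sup>2" by (metis cos_double_sin)
    then show ?thesis by (simp add: power_mult_distrib)
  qed
  finally have "cmod (cis x - cis y) = \<bar>2 * sin ((x - y) / 2)\<bar>"
    by (metis abs_norm_cancel power2_eq_iff_nonneg norm_ge_zero power2_abs abs_ge_zero)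
  also have "\<dots> \<le> \<bar>x - y\<bar>"
    using abs_sin_diff_le[of "(x - y) / 2" 0] by simp
  finally show ?thesis .
qed

lemma abs_power_diff_le:
  fixes x y :: real
  assumes "0 \<le> x" "x \<le> t" "0 \<le> y" "y \<le> t"
  shows "\<bar>x ^ k - y ^ k\<bar> \<le> real k * t ^ (k - 1) * \<bar>x - y\<bar>"
proof (cases k)
  case (Suc j)
  have "x ^ Suc j - y ^ Suc j = (x - y) * (\<Sum>p<Suc j. x ^ p * y ^ (j - p))"
    using diff_power_eq_sum[of x j y] by (simp only: mult_ac)
  moreover have "\<bar>\<Sum>p<Suc j. x ^ p * y ^ (j - p)\<bar> \<le> (\<Sum>p<Suc j. t ^ j)"
  proof (rule order_trans[OF sum_abs sum_mono])
    fix p assume p: "p \<in> {..<Suc j}"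
    have "\<bar>x ^ p * y ^ (j - p)\<bar> \<le> t ^ p * t ^ (j - p)"
      using assms by (simp add: abs_mult) (intro mult_mono power_mono; simp)
    also have "\<dots> = t ^ j" using p by (simp flip: power_add)
    finally show "\<bar>x ^ p * y ^ (j - p)\<bar> \<le> t ^ j" .
  qed
  ultimately show ?thesis
    using Suc mult_left_mono[of "\<bar>\<Sum>p<Suc j. x ^ p * y ^ (j - p)\<bar>" "real k * t ^ (k - 1)" "\<bar>x - y\<bar>"]
    by (simp add: abs_mult mult.commute)
qed simp

lemma real_conv_series:
  assumes "\<And>m. cnj (f m) = f m" "summable (\<lambda>k. of_real (c k) * conv_pow k f m)"
  shows "cnj (conv_series c f m) = conv_series c f m"
proof -
  have "cnj (conv_series c f m) = (\<Sum>k. cnj (of_real (c k) * conv_pow k f m))"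
    unfolding conv_series_def by (rule bounded_linear.suminf[OF bounded_linear_cnj assms(2)])
  then show ?thesis by (simp add: conv_series_def real_conv_pow assms(1))
qed

text \<open>The linearised chain \<open>y'' = a (y\<^sub>n\<^sub>-\<^sub>1 - 2 y\<^sub>n + y\<^sub>n\<^sub>+\<^sub>1)\<close> forced at frequency \<open>\<gamma>\<close> propagates exactly the
  modes \<open>m = -1, 0, 1\<close>. The nonlinear part of the force is \<open>\<Sum>k. cf k * s ^ (k + 1)\<close>, which
  starts with a quadratic term.\<close>

locale chain = weighted +
  fixes a \<gamma> s1 :: real and cf :: "nat \<Rightarrow> real"
  assumes a_pos: "0 < a" and \<gamma>_pos: "0 < \<gamma>" and \<gamma>_lower: "a < \<gamma>\<^sup>2" and \<gamma>_upper: "\<gamma>\<^sup>2 < 4 * a"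
    and s1_pos: "0 < s1" and cf_0: "cf 0 = 0"
    and cf_summable: "summable (\<lambda>k. \<bar>cf k\<bar> * (real (Suc k))\<^sup>2 * s1 ^ k)"
begin

text \<open>One constant for the force and its first two derivatives: for \<open>0 \<le> s \<le> s1\<close> the majorant series
  of the force is at most \<open>CF * s\<^sup>2\<close>, that of its derivative at most \<open>CF * s\<close>, and that of
  half its second derivative at most \<open>CF\<close>. The first two use that the series starts at degree two.\<close>

definition CF :: real where
  "CF = (\<Sum>k. \<bar>cf k\<bar> * (real (Suc k))\<^sup>2 * s1 ^ k) / s1"

lemma CF_nonneg: "0 \<le> CF"
  unfolding CF_def using s1_pos by (intro divide_nonneg_pos suminf_nonneg cf_summable) auto

lemma cf_term_le:
  assumes s: "0 \<le> s" "s \<le> s1"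
  shows "\<bar>cf k\<bar> * (real (Suc k) * s ^ k) \<le> s / s1 * (\<bar>cf k\<bar> * (real (Suc k))\<^sup>2 * s1 ^ k)" (is ?A)
    and "\<bar>cf k\<bar> * (real (k * Suc k) / 2 * s ^ (k - 1))
      \<le> 1 / s1 * (\<bar>cf k\<bar> * (real (Suc k))\<^sup>2 * s1 ^ k)" (is ?B)
proof -
  have "?A \<and> ?B"
  proof (cases k)
    case 0 then show ?thesis by (simp add: cf_0)
  next
    case (Suc j)
    have sj: "s ^ j \<le> s1 ^ j" by (rule power_mono[OF s(2,1)])
    have 1: "real (Suc k) \<le> (real (Suc k))\<^sup>2" by (simp add: power2_eq_square)
    have 2: "real (k * Suc k) / 2 \<le> (real (Suc k))\<^sup>2"
    proof -
      have "real (k * Suc k) \<le> real (Suc k) * real (Suc k)"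
        by (simp only: of_nat_mult flip: of_nat_mult) simp
      moreover have "0 \<le> real (Suc k) * real (Suc k)" by simp
      ultimately show ?thesis unfolding power2_eq_square by linarith
    qed
    have "real (Suc k) * s ^ j \<le> (real (Suc k))\<^sup>2 * s1 ^ j"
      using 1 sj s s1_pos by (intro mult_mono) auto
    then have A: "\<bar>cf k\<bar> * s * (real (Suc k) * s ^ j) \<le> \<bar>cf k\<bar> * s * ((real (Suc k))\<^sup>2 * s1 ^ j)"
      using s by (intro mult_left_mono) auto
    have "real (k * Suc k) / 2 * s ^ j \<le> (real (Suc k))\<^sup>2 * s1 ^ j"
      using 2 sj s s1_pos by (intro mult_mono) auto
    then have B: "\<bar>cf k\<bar> * (real (k * Suc k) / 2 * s ^ j) \<le> \<bar>cf k\<bar> * ((real (Suc k))\<^sup>2 * s1 ^ j)"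
      by (rule mult_left_mono) simp
    show ?thesis using A B Suc s1_pos by (simp add: mult_ac)
  qed
  then show ?A ?B by auto
qed

lemma cf_sums:
  assumes s: "0 \<le> s" "s \<le> s1"
  shows "summable (\<lambda>k. \<bar>cf k\<bar> * (real (Suc k) * s ^ k))"
    and "(\<Sum>k. \<bar>cf k\<bar> * (real (Suc k) * s ^ k)) \<le> CF * s"
    and "summable (\<lambda>k. \<bar>cf k\<bar> * (real (k * Suc k) / 2 * s ^ (k - 1)))"
    and "(\<Sum>k. \<bar>cf k\<bar> * (real (k * Suc k) / 2 * s ^ (k - 1))) \<le> CF"
    and "summable (\<lambda>k. \<bar>cf k\<bar> * s ^ Suc k)"
    and "(\<Sum>k. \<bar>cf k\<bar> * s ^ Suc k) \<le> CF * s * s"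
proof -
  note le = cf_term_le[OF s]
  have sm: "summable (\<lambda>k. t * (\<bar>cf k\<bar> * (real (Suc k))\<^sup>2 * s1 ^ k))" for t
    by (rule summable_mult[OF cf_summable])
  show A: "summable (\<lambda>k. \<bar>cf k\<bar> * (real (Suc k) * s ^ k))"
    by (rule summable_comparison_test'[OF sm[of "s / s1"]]) (use le(1) s in auto)
  show A': "(\<Sum>k. \<bar>cf k\<bar> * (real (Suc k) * s ^ k)) \<le> CF * s"
    using suminf_le[OF le(1) A sm] suminf_mult[OF cf_summable, of "s / s1"]
    by (simp add: CF_def mult.commute del: of_nat_Suc)
  show B: "summable (\<lambda>k. \<bar>cf k\<bar> * (real (k * Suc k) / 2 * s ^ (k - 1)))"
    by (rule summable_comparison_test'[OF sm[of "1 / s1"]]) (use le(2) s in auto)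
  show "(\<Sum>k. \<bar>cf k\<bar> * (real (k * Suc k) / 2 * s ^ (k - 1))) \<le> CF"
    using suminf_le[OF le(2) B sm] suminf_mult[OF cf_summable, of "1 / s1"]
    by (simp add: CF_def del: of_nat_Suc)
  have le': "\<bar>cf k\<bar> * s ^ Suc k \<le> s * (\<bar>cf k\<bar> * (real (Suc k) * s ^ k))" for k
    using s mult_right_mono[of 1 "real (Suc k)" "s * (\<bar>cf k\<bar> * s ^ k)"] by (simp add: mult_ac)
  show C: "summable (\<lambda>k. \<bar>cf k\<bar> * s ^ Suc k)"
    by (rule summable_comparison_test'[OF summable_mult[OF A, of s]]) (use le' s in auto)
  have "(\<Sum>k. \<bar>cf k\<bar> * s ^ Suc k) \<le> s * (\<Sum>k. \<bar>cf k\<bar> * (real (Suc k) * s ^ k))"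
    using suminf_le[OF le' C summable_mult[OF A]] suminf_mult[OF A, of s] by simp
  also have "\<dots> \<le> s * (CF * s)" by (rule mult_left_mono[OF A' s(1)])
  finally show "(\<Sum>k. \<bar>cf k\<bar> * s ^ Suc k) \<le> CF * s * s" by (simp add: mult_ac)
qed

lemma force_summable:
  assumes "norm_le 0 f s" "s \<le> s1"
  shows "summable (\<lambda>k. of_real (cf k) * conv_pow k (f n) m)"
  using conv_series_summable(1)[OF assms(1) cf_sums(5)[OF norm_le_nonneg[OF assms(1)] assms(2)]] .

lemma force_norm:
  assumes "norm_le 0 f s" "s \<le> s1"
  shows "norm_le 0 (\<lambda>n. conv_series cf (f n)) (CF * s * s)"
  using conv_series_summable(2)[OF assms(1)] cf_sums(5,6)[OF norm_le_nonneg[OF assms(1)] assms(2)]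
    norm_le_mono by blast

lemma force_lipschitz:
  assumes "norm_le 0 f s" "norm_le 0 g s" "s \<le> s1" "norm_le \<tau> (\<lambda>n m. f n m - g n m) d"
  shows "norm_le \<tau> (\<lambda>n m. conv_series cf (f n) m - conv_series cf (g n) m) (CF * s * d)"
proof -
  note s = norm_le_nonneg[OF assms(1)] assms(3)
  show ?thesis
    by (rule norm_le_mono[OF conv_series_lipschitz[OF assms(1,2) cf_sums(5,1)[OF s] assms(4)]])
      (rule mult_right_mono[OF cf_sums(2)[OF s] norm_le_nonneg[OF assms(4)]])
qed

lemma force_second_difference:
  assumes "0 \<le> \<tau>" "norm_le 0 f s" "norm_le 0 g s" "norm_le 0 f' s" "norm_le 0 g' s" "s \<le> s1"
    and gf: "norm_le (2 * \<tau>) (\<lambda>n m. g n m - f n m) \<beta>" "norm_le (2 * \<tau>) (\<lambda>n m. g' n m - f' n m) \<beta>"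
    and d: "norm_le \<tau> (\<lambda>n m. (g n m - f n m) - (g' n m - f' n m)) d"
    and e: "norm_le (- \<tau>) (\<lambda>n m. f n m - f' n m) e"
  shows "norm_le \<tau> (\<lambda>n m. (conv_series cf (g n) m - conv_series cf (f n) m)
      - (conv_series cf (g' n) m - conv_series cf (f' n) m)) (CF * s * d + CF * (\<beta> * (2 * e + d)))"
proof -
  note s = norm_le_nonneg[OF assms(2)] assms(6)
  note nn = norm_le_nonneg[OF gf(1)] norm_le_nonneg[OF d] norm_le_nonneg[OF e]
  show ?thesis
    by (rule norm_le_mono[OF conv_series_second_difference[OF assms(1-5) cf_sums(5,1,3)[OF s] gf d e]],
        intro add_mono mult_right_mono cf_sums(2,4)[OF s]) (use nn in auto)
qed

text \<open>A travelling wave \<open>x\<^sub>n(t) = c n + \<Phi>(\<kappa> n + \<gamma> t)\<close> is determined by its strain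
  \<open>\<Phi>(\<theta> - \<kappa>/2) - \<Phi>(\<theta> + \<kappa>/2) = \<rho> * Q(\<theta>)\<close>, whose Fourier coefficients may be taken real
  and even. With \<open>H\<close> the nonlinear force divided by the amplitude \<open>\<rho>\<close>, the wave equation becomes
  \<open>(m \<gamma>)\<^sup>2 Q\<^sub>m = 4 sin\<^sup>2(m \<kappa>/2) (a Q\<^sub>m + H\<^sub>m)\<close>. Normalising \<open>Q\<^sub>1 = 1\<close>, the equation for
  \<open>m = 1\<close> determines the wave number \<open>\<kappa>\<close> from \<open>H\<^sub>1\<close>.\<close>

definition wave_number :: "real \<Rightarrow> real" where
  "wave_number h = arccos (1 - \<gamma>\<^sup>2 / (2 * (a + h)))"

definition wave_number_controlled :: "real \<Rightarrow> real \<Rightarrow> bool" where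
  "wave_number_controlled h0 L \<longleftrightarrow> (\<forall>h. \<bar>h\<bar> \<le> h0 \<longrightarrow> 0 < wave_number h \<and> wave_number h < pi \<and>
       4 * (sin (wave_number h / 2))\<^sup>2 * (a + h) = \<gamma>\<^sup>2) \<and>
     (\<forall>h h'. \<bar>h\<bar> \<le> h0 \<longrightarrow> \<bar>h'\<bar> \<le> h0 \<longrightarrow> \<bar>wave_number h - wave_number h'\<bar> \<le> L * \<bar>h - h'\<bar>)"

lemma wave_number_controlledD:
  assumes "wave_number_controlled h0 L" "\<bar>h\<bar> \<le> h0"
  shows "0 < wave_number h \<and> wave_number h < pi \<and> 4 * (sin (wave_number h / 2))\<^sup>2 * (a + h) = \<gamma>\<^sup>2"
    and "\<bar>h'\<bar> \<le> h0 \<Longrightarrow> \<bar>wave_number h - wave_number h'\<bar> \<le> L * \<bar>h - h'\<bar>"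
  using assms by (simp_all add: wave_number_controlled_def)

lemma wave_number_control:
  obtains h0 L where "0 < h0" "0 \<le> L" "wave_number_controlled h0 L"
proof -
  define h0 where "h0 = min (a / 2) ((4 * a - \<gamma>\<^sup>2) / 8)"
  have h0: "0 < h0" "h0 \<le> a / 2" "4 * h0 \<le> (4 * a - \<gamma>\<^sup>2) / 2"
    using a_pos \<gamma>_upper by (auto simp: h0_def)
  define x where "x h = 1 - \<gamma>\<^sup>2 / (2 * (a + h))" for h
  have \<gamma>2: "0 < \<gamma>\<^sup>2" using \<gamma>_pos by simp
  have ah: "a / 2 \<le> a + h" "\<gamma>\<^sup>2 < 4 * (a + h)" if "\<bar>h\<bar> \<le> h0" for h
    using that h0 \<gamma>_upper by (auto simp: abs_le_iff)
  have ah0: "0 < a + h" if "\<bar>h\<bar> \<le> h0" for h using ah(1)[OF that] a_pos by linarith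
  have x: "- 1 < x h" "x h < 1" if "\<bar>h\<bar> \<le> h0" for h
  proof -
    have "\<gamma>\<^sup>2 / (2 * (a + h)) < 2" "0 < \<gamma>\<^sup>2 / (2 * (a + h))"
    proof -
      define t where "t = 2 * (a + h)"
      have t: "0 < t" "\<gamma>\<^sup>2 < 2 * t" using ah(2)[OF that] ah0[OF that] by (auto simp: t_def)
      show "\<gamma>\<^sup>2 / (2 * (a + h)) < 2" "0 < \<gamma>\<^sup>2 / (2 * (a + h))"
        unfolding t_def[symmetric] using pos_divide_less_eq[OF t(1)] t(2) divide_pos_pos[OF \<gamma>2 t(1)]
        by simp_all
    qed
    then show "- 1 < x h" "x h < 1" by (auto simp: x_def)
  qed
  have x_mono: "x h \<le> x h'" if "\<bar>h\<bar> \<le> h0" "\<bar>h'\<bar> \<le> h0" "h \<le> h'" for h h'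
    unfolding x_def using ah0[OF that(1)] that(3) \<gamma>2 by (simp add: frac_le)
  define X where "X = max \<bar>x (- h0)\<bar> \<bar>x h0\<bar>"
  have X1: "X < 1" using x[of h0] x[of "- h0"] h0(1) by (auto simp: X_def abs_less_iff)
  have X: "\<bar>x h\<bar> \<le> X" if "\<bar>h\<bar> \<le> h0" for h
    using x_mono[of h h0] x_mono[of "- h0" h] that h0(1) by (auto simp: X_def abs_le_iff)
  have X2: "X\<^sup>2 < 1" using X1 by (simp add: abs_square_less_1 X_def)
  define L where "L = 2 * \<gamma>\<^sup>2 / a\<^sup>2 / sqrt (1 - X\<^sup>2)"
  have L: "0 \<le> L" unfolding L_def using X2 by simp
  have 1: "0 < wave_number h \<and> wave_number h < pi \<and>
     4 * (sin (wave_number h / 2))\<^sup>2 * (a + h) = \<gamma>\<^sup>2" if h: "\<bar>h\<bar> \<le> h0" for h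
  proof -
    have "cos (wave_number h) = x h"
      unfolding wave_number_def x_def[symmetric] by (rule cos_arccos) (use x[OF h] in auto)
    then have "2 * (sin (wave_number h / 2))\<^sup>2 = \<gamma>\<^sup>2 / (2 * (a + h))"
      using cos_double_sin[of "wave_number h / 2"] by (simp add: x_def)
    then have "4 * (sin (wave_number h / 2))\<^sup>2 * (a + h) = \<gamma>\<^sup>2"
      using ah0[OF h] by (simp add: field_simps)
    moreover have "0 < wave_number h \<and> wave_number h < pi"
      unfolding wave_number_def x_def[symmetric] using arccos_lt_bounded x[OF h] by simp
    ultimately show ?thesis by simp
  qed
  have 2: "\<bar>wave_number h - wave_number h'\<bar> \<le> L * \<bar>h - h'\<bar>"
    if h: "\<bar>h\<bar> \<le> h0" and h': "\<bar>h'\<bar> \<le> h0" for h h'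
  proof -
    have "x h - x h' = \<gamma>\<^sup>2 * (h - h') / (2 * ((a + h) * (a + h')))"
    proof -
      have "\<gamma>\<^sup>2 / (2 * t') - \<gamma>\<^sup>2 / (2 * t) = \<gamma>\<^sup>2 * (t - t') / (2 * (t * t'))"
        if "0 < t" "0 < t'" for t t'
        using that by (simp add: divide_simps) (simp add: algebra_simps)
      from this[OF ah0[OF h] ah0[OF h']] show ?thesis by (simp add: x_def)
    qed
    then have "\<bar>x h - x h'\<bar> = \<gamma>\<^sup>2 * \<bar>h - h'\<bar> / (2 * ((a + h) * (a + h')))"
      using ah0[OF h] ah0[OF h'] \<gamma>2 by (simp add: abs_mult)
    also have "\<dots> \<le> \<gamma>\<^sup>2 * \<bar>h - h'\<bar> / (2 * ((a / 2) * (a / 2)))"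
      using ah(1)[OF h] ah(1)[OF h'] a_pos by (intro divide_left_mono mult_left_mono mult_mono) auto
    also have "\<dots> = 2 * \<gamma>\<^sup>2 / a\<^sup>2 * \<bar>h - h'\<bar>" by (simp add: power2_eq_square)
    finally have "\<bar>x h - x h'\<bar> / sqrt (1 - X\<^sup>2) \<le> 2 * \<gamma>\<^sup>2 / a\<^sup>2 * \<bar>h - h'\<bar> / sqrt (1 - X\<^sup>2)"
      using X2 by (intro divide_right_mono) auto
    then show ?thesis
      using arccos_lipschitz[OF X[OF h] X[OF h'] X1]
      by (simp add: wave_number_def x_def L_def)
  qed
  show ?thesis by (rule that[OF h0(1) L]) (simp add: wave_number_controlled_def 1 2)
qed

definition gain :: "real \<Rightarrow> int \<Rightarrow> real" where
  "gain \<kappa> m = 4 * (sin (of_int m * \<kappa> / 2))\<^sup>2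
     / ((of_int m * \<gamma>)\<^sup>2 - 4 * a * (sin (of_int m * \<kappa> / 2))\<^sup>2)"

lemma gain_denominator:
  assumes "2 \<le> \<bar>m\<bar>"
  shows "(\<gamma>\<^sup>2 - a) * (of_int m)\<^sup>2 \<le> (of_int m * \<gamma>)\<^sup>2 - 4 * a * (sin (of_int m * \<kappa> / 2))\<^sup>2"
proof -
  have "(2::real)\<^sup>2 \<le> \<bar>of_int m\<bar>\<^sup>2" using assms by (intro power_mono) linarith+
  then have "4 * a \<le> a * (of_int m)\<^sup>2" using a_pos by simp
  moreover have "4 * a * (sin (of_int m * \<kappa> / 2))\<^sup>2 \<le> 4 * a * 1"
    using a_pos by (intro mult_left_mono) (auto simp: abs_square_le_1)
  ultimately show ?thesis by (simp add: power_mult_distrib algebra_simps)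
qed

text \<open>The resolvent \<open>gain\<close> gains two derivatives. One of them pays for its dependence on
  the wave number, the other is kept for the dependence of the wave on its phase.\<close>

lemma gain_bounds:
  obtains C where "0 \<le> C"
    "\<And>\<kappa> m. 2 \<le> \<bar>m\<bar> \<Longrightarrow> \<bar>of_int m\<bar> * \<bar>gain \<kappa> m\<bar> \<le> C"
    "\<And>\<kappa> \<kappa>' m. 2 \<le> \<bar>m\<bar> \<Longrightarrow> \<bar>of_int m\<bar> * \<bar>gain \<kappa> m - gain \<kappa>' m\<bar> \<le> C * \<bar>\<kappa> - \<kappa>'\<bar>"
proof -
  define g where "g = \<gamma>\<^sup>2 - a"
  have g: "0 < g" using \<gamma>_lower by (simp add: g_def)
  define C where "C = max (4 / g) (4 * \<gamma>\<^sup>2 / g\<^sup>2)"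
  show ?thesis
  proof (rule that[of C])
    show "0 \<le> C" using g by (simp add: C_def le_max_iff_disj)
    fix \<kappa> \<kappa>' :: real and m :: int assume m: "2 \<le> \<bar>m\<bar>"
    define M where "M = \<bar>real_of_int m\<bar>"
    have M: "2 \<le> M" "M\<^sup>2 = (of_int m)\<^sup>2" using m by (auto simp: M_def)
    define S where "S x = (sin (of_int m * x / 2))\<^sup>2" for x :: real
    define D where "D x = (of_int m * \<gamma>)\<^sup>2 - 4 * a * S x" for x :: real
    have S: "0 \<le> S x" "S x \<le> 1" for x by (auto simp: S_def abs_square_le_1)
    have D: "g * M\<^sup>2 \<le> D x" for x
      using gain_denominator[OF m, of x] by (simp add: D_def S_def M g_def)
    have gM: "0 < g * M\<^sup>2" using g M(1) by simp
    have D0: "0 < D x" for x using D[of x] gM by linarith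
    have gain: "gain x m = 4 * S x / D x" for x by (simp add: gain_def S_def D_def)
    have "\<bar>gain \<kappa> m\<bar> = 4 * S \<kappa> / D \<kappa>" using S(1)[of \<kappa>] D0[of \<kappa>] by (simp add: gain)
    also have "\<dots> \<le> 4 * 1 / (g * M\<^sup>2)" using S[of \<kappa>] D[of \<kappa>] gM by (intro frac_le) auto
    finally have "M * \<bar>gain \<kappa> m\<bar> \<le> M * (4 / (g * M\<^sup>2))" using M by (intro mult_left_mono) auto
    also have "\<dots> = 4 / g / M" using M(1) g by (simp add: power2_eq_square)
    also have "\<dots> \<le> 4 / g / 1" using M g by (intro divide_left_mono) auto
    finally show "\<bar>of_int m\<bar> * \<bar>gain \<kappa> m\<bar> \<le> C" by (simp add: C_def M_def le_max_iff_disj)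
    have "gain \<kappa> m - gain \<kappa>' m = 4 * (S \<kappa> - S \<kappa>') * (\<gamma>\<^sup>2 * M\<^sup>2) / (D \<kappa> * D \<kappa>')"
    proof -
      have "S \<kappa> * D \<kappa>' - S \<kappa>' * D \<kappa> = (S \<kappa> - S \<kappa>') * (\<gamma>\<^sup>2 * M\<^sup>2)"
        by (simp add: D_def M power_mult_distrib algebra_simps)
      then show ?thesis using D0[of \<kappa>] D0[of \<kappa>'] by (simp add: gain diff_frac_eq mult.assoc)
        (simp add: algebra_simps)
    qed
    then have "\<bar>gain \<kappa> m - gain \<kappa>' m\<bar> = 4 * \<bar>S \<kappa> - S \<kappa>'\<bar> * (\<gamma>\<^sup>2 * M\<^sup>2) / (D \<kappa> * D \<kappa>')"
      using D0[of \<kappa>] D0[of \<kappa>'] by (simp add: abs_mult del: right_diff_distrib_numeral)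
    also have "\<dots> \<le> 4 * (M * \<bar>\<kappa> - \<kappa>'\<bar>) * (\<gamma>\<^sup>2 * M\<^sup>2) / (g * M\<^sup>2 * (g * M\<^sup>2))"
    proof (intro frac_le mult_mono mult_right_mono mult_left_mono)
      have "S \<kappa> - S \<kappa>' = (sin (of_int m * \<kappa> / 2) - sin (of_int m * \<kappa>' / 2))
          * (sin (of_int m * \<kappa> / 2) + sin (of_int m * \<kappa>' / 2))"
        by (simp add: S_def power2_eq_square algebra_simps)
      also have "\<bar>\<dots>\<bar> \<le> \<bar>of_int m * \<kappa> / 2 - of_int m * \<kappa>' / 2\<bar> * (1 + 1)"
        unfolding abs_mult
        by (intro mult_mono abs_sin_diff_le order_trans[OF abs_triangle_ineq] add_mono) auto
      also have "\<dots> = M * \<bar>\<kappa> - \<kappa>'\<bar>"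
        by (simp add: M_def flip: right_diff_distrib diff_divide_distrib abs_mult)
      finally show "\<bar>S \<kappa> - S \<kappa>'\<bar> \<le> M * \<bar>\<kappa> - \<kappa>'\<bar>" .
    qed (use D gM D0 M(1) in \<open>auto intro: less_imp_le\<close>)
    also have "\<dots> = 4 * \<gamma>\<^sup>2 / g\<^sup>2 * \<bar>\<kappa> - \<kappa>'\<bar> / M"
      using M(1) g by (simp add: power2_eq_square mult_ac)
    finally have "M * \<bar>gain \<kappa> m - gain \<kappa>' m\<bar> \<le> M * (4 * \<gamma>\<^sup>2 / g\<^sup>2 * \<bar>\<kappa> - \<kappa>'\<bar> / M)"
      using M by (intro mult_left_mono) auto
    also have "\<dots> = 4 * \<gamma>\<^sup>2 / g\<^sup>2 * \<bar>\<kappa> - \<kappa>'\<bar>" using M by simp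
    also have "\<dots> \<le> C * \<bar>\<kappa> - \<kappa>'\<bar>" unfolding C_def by (intro mult_right_mono) auto
    finally show "\<bar>of_int m\<bar> * \<bar>gain \<kappa> m - gain \<kappa>' m\<bar> \<le> C * \<bar>\<kappa> - \<kappa>'\<bar>" by (simp add: M_def)
  qed
qed

text \<open>The force on the strain \<open>\<rho> * Q\<close> divided by \<open>\<rho>\<close>, in a form that makes sense at \<open>\<rho> = 0\<close> and
  is Lipschitz in \<open>\<rho>\<close>.\<close>

definition scaled_force :: "real \<Rightarrow> (int \<Rightarrow> complex) \<Rightarrow> int \<Rightarrow> complex" where
  "scaled_force \<rho> = conv_series (\<lambda>k. cf k * \<rho> ^ k)"

lemma scaled_coeff_sums:
  assumes "0 \<le> \<rho>" "0 \<le> M" "\<rho> * M \<le> s1"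
  shows "summable (\<lambda>k. \<bar>cf k * \<rho> ^ k\<bar> * (real (Suc k) * M ^ k))"
    and "(\<Sum>k. \<bar>cf k * \<rho> ^ k\<bar> * (real (Suc k) * M ^ k)) \<le> CF * (\<rho> * M)"
    and "summable (\<lambda>k. \<bar>cf k * \<rho> ^ k\<bar> * M ^ Suc k)"
    and "(\<Sum>k. \<bar>cf k * \<rho> ^ k\<bar> * M ^ Suc k) \<le> CF * (\<rho> * M) * M"
proof -
  have eq: "\<bar>cf k * \<rho> ^ k\<bar> * (real (Suc k) * M ^ k) = \<bar>cf k\<bar> * (real (Suc k) * (\<rho> * M) ^ k)" for k
    using assms by (simp add: abs_mult power_mult_distrib)
  have s: "0 \<le> \<rho> * M" using assms by simp
  show A: "summable (\<lambda>k. \<bar>cf k * \<rho> ^ k\<bar> * (real (Suc k) * M ^ k))"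
    and A': "(\<Sum>k. \<bar>cf k * \<rho> ^ k\<bar> * (real (Suc k) * M ^ k)) \<le> CF * (\<rho> * M)"
    unfolding eq by (rule cf_sums[OF s assms(3)])+
  have le: "\<bar>cf k * \<rho> ^ k\<bar> * M ^ Suc k \<le> M * (\<bar>cf k * \<rho> ^ k\<bar> * (real (Suc k) * M ^ k))" for k
    using assms mult_right_mono[of 1 "real (Suc k)" "M * (\<bar>cf k * \<rho> ^ k\<bar> * M ^ k)"]
    by (simp add: mult_ac)
  show B: "summable (\<lambda>k. \<bar>cf k * \<rho> ^ k\<bar> * M ^ Suc k)"
    by (rule summable_comparison_test'[OF summable_mult[OF A, of M]]) (use le assms in auto)
  have "(\<Sum>k. \<bar>cf k * \<rho> ^ k\<bar> * M ^ Suc k) \<le> M * (\<Sum>k. \<bar>cf k * \<rho> ^ k\<bar> * (real (Suc k) * M ^ k))"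
    using suminf_le[OF le B summable_mult[OF A]] suminf_mult[OF A, of M] by simp
  also have "\<dots> \<le> M * (CF * (\<rho> * M))" by (rule mult_left_mono[OF A' assms(2)])
  finally show "(\<Sum>k. \<bar>cf k * \<rho> ^ k\<bar> * M ^ Suc k) \<le> CF * (\<rho> * M) * M" by (simp add: mult_ac)
qed

lemma scaled_force_bound:
  assumes "norm_le 0 Q M" "0 \<le> \<rho>" "\<rho> * M \<le> s1"
  shows "norm_le 0 (\<lambda>n. scaled_force \<rho> (Q n)) (CF * (\<rho> * M) * M)"
    and "summable (\<lambda>k. of_real (cf k * \<rho> ^ k) * conv_pow k (Q n) m)"
proof -
  note sums = scaled_coeff_sums[OF assms(2) norm_le_nonneg[OF assms(1)] assms(3)]
  show "norm_le 0 (\<lambda>n. scaled_force \<rho> (Q n)) (CF * (\<rho> * M) * M)"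
    unfolding scaled_force_def
    by (rule norm_le_mono[OF conv_series_summable(2)[OF assms(1) sums(3)] sums(4)])
  show "summable (\<lambda>k. of_real (cf k * \<rho> ^ k) * conv_pow k (Q n) m)"
    by (rule conv_series_summable(1)[OF assms(1) sums(3)])
qed

lemma scaled_force_lipschitz:
  assumes Q: "norm_le 0 Q M" "norm_le 0 Q' M" "norm_le 0 (\<lambda>n m. Q n m - Q' n m) d"
    and \<rho>: "0 \<le> \<rho>" "\<rho> \<le> t" "0 \<le> \<rho>'" "\<rho>' \<le> t" "t * M \<le> s1"
  shows "norm_le 0 (\<lambda>n m. scaled_force \<rho> (Q n) m - scaled_force \<rho>' (Q' n) m)
    (CF * (t * M) * d + 2 * M\<^sup>2 * CF * \<bar>\<rho> - \<rho>'\<bar>)"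
proof -
  note M = norm_le_nonneg[OF Q(1)]
  have \<rho>M: "\<rho> * M \<le> s1" "\<rho>' * M \<le> s1"
    using \<rho> M mult_right_mono[of \<rho> t M] mult_right_mono[of \<rho>' t M] by auto
  note sums = scaled_coeff_sums[OF \<rho>(1) M \<rho>M(1)]
  have "norm_le 0 (\<lambda>n m. scaled_force \<rho> (Q n) m - scaled_force \<rho> (Q' n) m)
      ((\<Sum>k. \<bar>cf k * \<rho> ^ k\<bar> * (real (Suc k) * M ^ k)) * d)"
    unfolding scaled_force_def by (rule conv_series_lipschitz[OF Q(1,2) sums(3,1) Q(3)])
  moreover have "(\<Sum>k. \<bar>cf k * \<rho> ^ k\<bar> * (real (Suc k) * M ^ k)) * d \<le> CF * (t * M) * d"
    using order_trans[OF sums(2), of "CF * (t * M)"] \<rho> M CF_nonneg norm_le_nonneg[OF Q(3)]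
    by (intro mult_right_mono) (auto intro!: mult_left_mono mult_right_mono)
  ultimately have 1: "norm_le 0 (\<lambda>n m. scaled_force \<rho> (Q n) m - scaled_force \<rho> (Q' n) m)
      (CF * (t * M) * d)" by (rule norm_le_mono)
  have tM: "0 \<le> t * M" using M \<rho> by auto
  define D where "D k n m = of_real (cf k * (\<rho> ^ k - \<rho>' ^ k)) * conv_pow k (Q' n) m" for k n m
  define r where "r k = 2 * M\<^sup>2 * (\<bar>cf k\<bar> * (real (k * Suc k) / 2 * (t * M) ^ (k - 1))) * \<bar>\<rho> - \<rho>'\<bar>" for k
  have D: "norm_le 0 (D k) (r k)" for k
  proof (cases k)
    case 0
    then have "D k = (\<lambda>n m. 0)" "r k = 0" by (auto simp: D_def r_def intro!: ext)
    then show ?thesis by (simp add: norm_le_zero)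
  next
    case (Suc j)
    have "norm_le 0 (D k) (cmod (of_real (cf k * (\<rho> ^ k - \<rho>' ^ k))) * M ^ Suc k)"
      unfolding D_def by (rule norm_le_cmult[OF norm_le_conv_pow[OF Q(2)]])
    moreover have "cmod (of_real (cf k * (\<rho> ^ k - \<rho>' ^ k))) * M ^ Suc k \<le> r k"
    proof -
      have "\<bar>\<rho> ^ k - \<rho>' ^ k\<bar> \<le> real k * t ^ (k - 1) * \<bar>\<rho> - \<rho>'\<bar>"
        using \<rho> by (intro abs_power_diff_le) auto
      also have "\<dots> \<le> real (k * Suc k) * t ^ (k - 1) * \<bar>\<rho> - \<rho>'\<bar>"
        using \<rho> by (intro mult_right_mono) auto
      finally have "\<bar>cf k\<bar> * \<bar>\<rho> ^ k - \<rho>' ^ k\<bar> * M ^ Suc k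
          \<le> \<bar>cf k\<bar> * (real (k * Suc k) * t ^ (k - 1) * \<bar>\<rho> - \<rho>'\<bar>) * M ^ Suc k"
        using M by (intro mult_right_mono mult_left_mono) auto
      also have "\<dots> = r k"
        using Suc by (simp add: r_def power_mult_distrib power2_eq_square)
      finally show ?thesis by (simp add: abs_mult del: of_real_mult of_real_diff of_real_power)
    qed
    ultimately show ?thesis by (rule norm_le_mono)
  qed
  note cs = cf_sums(3,4)[OF tM \<rho>(5)]
  have r: "summable r" unfolding r_def by (intro summable_mult2 summable_mult cs)
  have "suminf r = 2 * M\<^sup>2 * (\<Sum>k. \<bar>cf k\<bar> * (real (k * Suc k) / 2 * (t * M) ^ (k - 1))) * \<bar>\<rho> - \<rho>'\<bar>"
    unfolding r_def suminf_mult2[OF summable_mult[OF cs(1)], symmetric] suminf_mult[OF cs(1)] ..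
  also have "\<dots> \<le> 2 * M\<^sup>2 * CF * \<bar>\<rho> - \<rho>'\<bar>" by (intro mult_right_mono mult_left_mono cs(2)) auto
  finally have "norm_le 0 (\<lambda>n m. \<Sum>k. D k n m) (2 * M\<^sup>2 * CF * \<bar>\<rho> - \<rho>'\<bar>)"
    using norm_le_suminf(1)[OF D r] norm_le_mono by blast
  also have "(\<lambda>n m. \<Sum>k. D k n m) = (\<lambda>n m. scaled_force \<rho> (Q' n) m - scaled_force \<rho>' (Q' n) m)"
    unfolding scaled_force_def conv_series_def
    by (intro ext, subst suminf_diff[OF scaled_force_bound(2)[OF Q(2) \<rho>(1) \<rho>M(1)]
          scaled_force_bound(2)[OF Q(2) \<rho>(3) \<rho>M(2)]])
      (simp add: D_def algebra_simps)
  finally have 2: "norm_le 0 (\<lambda>n m. scaled_force \<rho> (Q' n) m - scaled_force \<rho>' (Q' n) m)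
      (2 * M\<^sup>2 * CF * \<bar>\<rho> - \<rho>'\<bar>)" .
  show ?thesis using norm_le_add[OF 1 2] by simp
qed

lemma force_scale:
  assumes "summable (\<lambda>k. of_real (cf k * \<rho> ^ k) * conv_pow k Q m)"
  shows "conv_series cf (\<lambda>m. of_real \<rho> * Q m) m = of_real \<rho> * scaled_force \<rho> Q m"
  unfolding scaled_force_def conv_series_def suminf_mult[OF assms, symmetric] conv_pow_scale
  by (simp add: mult_ac)

end

lemma mult_small:
  fixes k t x :: real
  assumes "0 \<le> k" "0 \<le> t" "t \<le> x / (k + 1)"
  shows "k * t \<le> x"
proof -
  have "(k + 1) * t \<le> x" using assms by (simp add: pos_le_divide_eq mult.commute)
  then show ?thesis using assms by (simp add: distrib_right)
qed

context chain
begin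

text \<open>The wave equation in the modes \<open>\<bar>m\<bar> \<ge> 2\<close>, solved for \<open>Q\<^sub>m\<close>, with the wave number eliminated by
  means of the mode \<open>m = 1\<close>.\<close>

definition resolve :: "(int \<Rightarrow> complex) \<Rightarrow> int \<Rightarrow> complex" where
  "resolve h m = (if 2 \<le> \<bar>m\<bar> then of_real (gain (wave_number (Re (h 1))) m) * h m else 0)"

lemma resolve_bounds:
  obtains h0 C where "0 < h0" "0 \<le> C" "wave_number_controlled h0 C"
    "\<And>X r. norm_le 0 X r \<Longrightarrow> norm_le 0 (\<lambda>n m. of_int m * resolve (X n) m) (C * r)"
    "\<And>X Y d. norm_le 0 X h0 \<Longrightarrow> norm_le 0 Y h0 \<Longrightarrow> norm_le 0 (\<lambda>n m. X n m - Y n m) d \<Longrightarrow>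
       norm_le 0 (\<lambda>n m. of_int m * (resolve (X n) m - resolve (Y n) m)) (C * d)"
proof -
  obtain h0 L where h0: "0 < h0" and L: "0 \<le> L" and wn: "wave_number_controlled h0 L"
    by (rule wave_number_control)
  note lip = wave_number_controlledD(2)[OF wn]
  obtain K where K: "0 \<le> K"
    "\<And>\<kappa> m. 2 \<le> \<bar>m\<bar> \<Longrightarrow> \<bar>of_int m\<bar> * \<bar>gain \<kappa> m\<bar> \<le> K"
    "\<And>\<kappa> \<kappa>' m. 2 \<le> \<bar>m\<bar> \<Longrightarrow> \<bar>of_int m\<bar> * \<bar>gain \<kappa> m - gain \<kappa>' m\<bar> \<le> K * \<bar>\<kappa> - \<kappa>'\<bar>"
    by (rule gain_bounds) blast
  define C where "C = max L (K + K * L * h0)"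
  have C: "L \<le> C" "K + K * L * h0 \<le> C" "0 \<le> C" "K \<le> C"
    using L K(1) h0 by (auto simp: C_def le_max_iff_disj)
  show ?thesis
  proof (rule that[of h0 C])
    have "\<bar>wave_number h - wave_number h'\<bar> \<le> C * \<bar>h - h'\<bar>" if "\<bar>h\<bar> \<le> h0" "\<bar>h'\<bar> \<le> h0" for h h'
      using lip[OF that] mult_right_mono[OF C(1), of "\<bar>h - h'\<bar>"] by simp
    then show "wave_number_controlled h0 C" using wn by (simp add: wave_number_controlled_def)
    show "norm_le 0 (\<lambda>n m. of_int m * resolve (X n) m) (C * r)" if X: "norm_le 0 X r" for X r
    proof (rule norm_le_mono[OF norm_le_dominated_same[OF X K(1)]])
      show "cmod (of_int m * resolve (X n) m) \<le> K * cmod (X n m)" for n m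
        using mult_right_mono[OF K(2)[of m "wave_number (Re (X n 1))"], of "cmod (X n m)"] K(1)
        by (simp add: resolve_def norm_mult mult.assoc)
      show "K * r \<le> C * r" by (rule mult_right_mono[OF C(4) norm_le_nonneg[OF X]])
    qed
    show "norm_le 0 (\<lambda>n m. of_int m * (resolve (X n) m - resolve (Y n) m)) (C * d)"
      if X: "norm_le 0 X h0" and Y: "norm_le 0 Y h0" and d: "norm_le 0 (\<lambda>n m. X n m - Y n m) d" for X Y d
    proof (rule norm_le_mono[OF norm_le_dominated2[OF d Y]])
      have dn: "0 \<le> d" by (rule norm_le_nonneg[OF d])
      show "0 \<le> K" "0 \<le> K * (L * d)" using K(1) L dn by auto
      show "K * d + K * (L * d) * h0 \<le> C * d"
        using mult_right_mono[OF C(2) dn] by (simp add: algebra_simps)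
      fix n m
      show "cmod (of_int m * (resolve (X n) m - resolve (Y n) m))
          \<le> K * cmod (X n m - Y n m) + K * (L * d) * cmod (Y n m)"
      proof (cases "2 \<le> \<bar>m\<bar>")
        case m: True
        define x y where "x = wave_number (Re (X n 1))" and "y = wave_number (Re (Y n 1))"
        have b: "\<bar>Re (X n 1)\<bar> \<le> h0" "\<bar>Re (Y n 1)\<bar> \<le> h0" "\<bar>Re (X n 1) - Re (Y n 1)\<bar> \<le> d"
          using norm_le_coeff[OF X, of n 1] norm_le_coeff[OF Y, of n 1] norm_le_coeff[OF d, of n 1]
            abs_Re_le_cmod[of "X n 1"] abs_Re_le_cmod[of "Y n 1"] abs_Re_le_cmod[of "X n 1 - Y n 1"]
          by auto
        have "\<bar>x - y\<bar> \<le> L * \<bar>Re (X n 1) - Re (Y n 1)\<bar>" unfolding x_def y_def by (rule lip[OF b(1,2)])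
        also have "\<dots> \<le> L * d" by (rule mult_left_mono[OF b(3) L])
        finally have xy: "K * \<bar>x - y\<bar> \<le> K * (L * d)" by (rule mult_left_mono[OF _ K(1)])
        have "of_int m * (resolve (X n) m - resolve (Y n) m)
            = of_real (of_int m * gain x m) * (X n m - Y n m)
              + of_real (of_int m * (gain x m - gain y m)) * Y n m"
          using m by (simp add: resolve_def x_def y_def algebra_simps)
        then have "cmod (of_int m * (resolve (X n) m - resolve (Y n) m))
          \<le> cmod (of_real (of_int m * gain x m) * (X n m - Y n m))
            + cmod (of_real (of_int m * (gain x m - gain y m)) * Y n m)"
          using norm_triangle_ineq by simp
        also have "\<dots> = \<bar>of_int m\<bar> * \<bar>gain x m\<bar> * cmod (X n m - Y n m)
            + \<bar>of_int m\<bar> * \<bar>gain x m - gain y m\<bar> * cmod (Y n m)"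
          by (simp only: norm_mult norm_of_real abs_mult)
        also have "\<dots> \<le> K * cmod (X n m - Y n m) + K * (L * d) * cmod (Y n m)"
          using K(2)[OF m, of x] order_trans[OF K(3)[OF m, of x y] xy]
          by (intro add_mono mult_right_mono) auto
        finally show ?thesis .
      qed (use K(1) L dn in \<open>simp add: resolve_def\<close>)
    qed
  qed (use h0 C(3) in auto)
qed

end

text \<open>The profiles \<open>Q \<rho>\<close> with first coefficient \<open>1\<close>; they tend to \<open>2 cos \<theta>\<close> as the amplitude
  tends to \<open>0\<close>, since \<open>resolve\<close>, which only affects \<open>\<bar>m\<bar> \<ge> 2\<close>, is of the order of \<open>\<rho>\<close>.\<close>

locale wave_profiles = chain +
  fixes t M C h0 :: real and Q :: "real \<Rightarrow> int \<Rightarrow> complex"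
  assumes t_pos: "0 < t" and C_nonneg: "0 \<le> C" and h0_pos: "0 < h0" and tM: "t * M \<le> s1"
    and force_small: "CF * (t * M) * M \<le> h0" and controlled: "wave_number_controlled h0 C"
    and Q_norm: "0 \<le> \<rho> \<Longrightarrow> \<rho> \<le> t \<Longrightarrow> norm_le 0 (\<lambda>_. Q \<rho>) M"
    and Q_real: "0 \<le> \<rho> \<Longrightarrow> \<rho> \<le> t \<Longrightarrow> cnj (Q \<rho> m) = Q \<rho> m"
    and Q_even: "0 \<le> \<rho> \<Longrightarrow> \<rho> \<le> t \<Longrightarrow> Q \<rho> (- m) = Q \<rho> m"
    and Q_equation: "0 \<le> \<rho> \<Longrightarrow> \<rho> \<le> t \<Longrightarrow>
      Q \<rho> m = (if \<bar>m\<bar> = 1 then 1 else 0) + resolve (scaled_force \<rho> (Q \<rho>)) m"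
    and Q_high: "0 \<le> \<rho> \<Longrightarrow> \<rho> \<le> t \<Longrightarrow>
      norm_le 0 (\<lambda>_ m. of_int m * resolve (scaled_force \<rho> (Q \<rho>)) m) (C * \<rho>)"
    and Q_lipschitz: "0 \<le> \<rho> \<Longrightarrow> \<rho> \<le> t \<Longrightarrow> 0 \<le> \<rho>' \<Longrightarrow> \<rho>' \<le> t \<Longrightarrow>
      norm_le 0 (\<lambda>_ m. Q \<rho> m - Q \<rho>' m) (C * \<bar>\<rho> - \<rho>'\<bar>)"

lemma (in chain) wave_profiles_exist:
  obtains t M C h0 Q where "wave_profiles w a \<gamma> s1 cf t M C h0 Q"
proof -
  obtain h0 C where h0: "0 < h0" and C: "0 \<le> C" and wn: "wave_number_controlled h0 C"
    and res: "\<And>X r. norm_le 0 X r \<Longrightarrow> norm_le 0 (\<lambda>n m. of_int m * resolve (X n) m) (C * r)"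
    and res_lip: "\<And>X Y d. norm_le 0 X h0 \<Longrightarrow> norm_le 0 Y h0 \<Longrightarrow>
       norm_le 0 (\<lambda>n m. X n m - Y n m) d \<Longrightarrow>
       norm_le 0 (\<lambda>n m. of_int m * (resolve (X n) m - resolve (Y n) m)) (C * d)"
    by (rule resolve_bounds) blast
  define e :: "int \<Rightarrow> complex" where "e m = (if \<bar>m\<bar> = 1 then 1 else 0)" for m
  define M where "M = w 1 + w (- 1) + 1"
  have M: "1 \<le> M" using weight_ge_1[of 1] weight_ge_1[of "- 1"] by (simp add: M_def)
  have e_norm: "norm_le 0 (\<lambda>_. e) (w 1 + w (- 1))"
  proof (rule norm_leI[where M = "\<lambda>m. if \<bar>m\<bar> = 1 then 1 else 0"])
    fix A :: "int set" assume A: "finite A"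
    have "(\<Sum>m\<in>A. w m * (if \<bar>m\<bar> = 1 then 1 else 0)) = (\<Sum>m\<in>A \<inter> {1, - 1}. w m)"
      unfolding sum.inter_restrict[OF A] by (rule sum.cong) auto
    also have "\<dots> \<le> (\<Sum>m\<in>{1, - 1}. w m)" by (rule sum_mono2) auto
    finally show "(\<Sum>m\<in>A. w m * (if \<bar>m\<bar> = 1 then 1 else 0)) \<le> w 1 + w (- 1)" by simp
  qed (auto simp: e_def)
  \<comment> \<open>The three bounds on the amplitude keep the strain in the domain of the force, the first
    harmonic of the force in the domain of the wave number, and make the iteration contract.\<close>
  define t where "t = min (s1 / M) (min (h0 / (CF * M * M + 1)) ((1 / 2) / (C * (CF * M * M) + 1)))"
  have CFM: "0 \<le> CF * M * M" using CF_nonneg M by simp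
  have "0 < C * (CF * M * M) + 1" using C CFM by (simp add: add_nonneg_pos)
  then have t0: "0 < t" unfolding t_def using s1_pos M h0 CFM by simp
  have tM: "t * M \<le> s1" using M by (simp add: t_def pos_le_divide_eq[symmetric])
  have th: "CF * (t * M) * M \<le> h0"
    using mult_small[OF CFM, of t h0] t0 by (simp add: t_def mult_ac)
  have tC: "C * (CF * (t * M) * M) \<le> 1 / 2"
    using mult_small[of "C * (CF * M * M)" t "1 / 2"] t0 C CFM by (simp add: t_def mult_ac)
  have tC': "C * (CF * (t * M)) \<le> 1 / 2"
  proof -
    have "C * (CF * (t * M)) * 1 \<le> C * (CF * (t * M)) * M"
      using M C CF_nonneg t0 by (intro mult_left_mono) auto
    with tC show ?thesis by (simp add: mult_ac)
  qed
  define V where "V \<rho> X m = e m + resolve (scaled_force \<rho> X) m" for \<rho> X m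
  have force_le: "norm_le 0 (\<lambda>n. scaled_force \<rho> (X n)) (CF * (\<rho> * M) * M)"
    "norm_le 0 (\<lambda>n. scaled_force \<rho> (X n)) h0"
    if "norm_le 0 X M" "0 \<le> \<rho>" "\<rho> \<le> t" for X \<rho>
  proof -
    have "\<rho> * M \<le> t * M" using that M by (intro mult_right_mono) auto
    moreover from this show "norm_le 0 (\<lambda>n. scaled_force \<rho> (X n)) (CF * (\<rho> * M) * M)"
      using scaled_force_bound(1)[OF that(1,2)] tM by simp
    moreover from calculation have "CF * (\<rho> * M) * M \<le> CF * (t * M) * M"
      using CF_nonneg M by (intro mult_right_mono mult_left_mono) auto
    ultimately show "norm_le 0 (\<lambda>n. scaled_force \<rho> (X n)) h0"
      using th norm_le_mono order_trans by blast
  qed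
  have V_lip: "norm_le 0 (\<lambda>n m. V \<rho> (X n) m - V \<rho>' (Y n) m)
      (1 / 2 * d + C * (2 * M\<^sup>2 * CF * \<bar>\<rho> - \<rho>'\<bar>))"
    if X: "norm_le 0 X M" and Y: "norm_le 0 Y M" and d: "norm_le 0 (\<lambda>n m. X n m - Y n m) d"
      and \<rho>: "0 \<le> \<rho>" "\<rho> \<le> t" "0 \<le> \<rho>'" "\<rho>' \<le> t" for X Y d \<rho> \<rho>'
  proof -
    have R: "norm_le 0 (\<lambda>n m. of_int m * (resolve (scaled_force \<rho> (X n)) m
        - resolve (scaled_force \<rho>' (Y n)) m)) (C * (CF * (t * M) * d + 2 * M\<^sup>2 * CF * \<bar>\<rho> - \<rho>'\<bar>))"
      by (rule res_lip[OF force_le(2)[OF X \<rho>(1,2)] force_le(2)[OF Y \<rho>(3,4)]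
            scaled_force_lipschitz[OF X Y d \<rho> tM]])
    have le: "cmod (V \<rho> (X n) m - V \<rho>' (Y n) m) \<le> 1 * cmod (of_int m *
        (resolve (scaled_force \<rho> (X n)) m - resolve (scaled_force \<rho>' (Y n)) m))" for n m
    proof (cases "2 \<le> \<bar>m\<bar>")
      case True
      then have "1 \<le> \<bar>real_of_int m\<bar>" by linarith
      from mult_right_mono[OF this, of "cmod (V \<rho> (X n) m - V \<rho>' (Y n) m)"]
      show ?thesis by (simp add: V_def norm_mult)
    qed (simp add: V_def resolve_def)
    have "norm_le 0 (\<lambda>n m. V \<rho> (X n) m - V \<rho>' (Y n) m)
        (C * (CF * (t * M) * d + 2 * M\<^sup>2 * CF * \<bar>\<rho> - \<rho>'\<bar>))"
      using norm_le_dominated_same[OF R _ le] by simp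
    then show ?thesis
    proof (rule norm_le_mono)
      show "C * (CF * (t * M) * d + 2 * M\<^sup>2 * CF * \<bar>\<rho> - \<rho>'\<bar>)
          \<le> 1 / 2 * d + C * (2 * M\<^sup>2 * CF * \<bar>\<rho> - \<rho>'\<bar>)"
        using mult_right_mono[OF tC' norm_le_nonneg[OF d]] by (simp add: algebra_simps)
    qed
  qed
  define B where "B = {X. norm_le 0 X M \<and> (\<forall>n m. cnj (X n m) = X n m \<and> X n (- m) = X n m)}"
  have ex: "\<exists>Q. norm_le 0 (\<lambda>_. Q) M \<and> (\<forall>m. cnj (Q m) = Q m \<and> Q (- m) = Q m) \<and> V \<rho> Q = Q"
    if \<rho>: "0 \<le> \<rho>" "\<rho> \<le> t" for \<rho>
  proof -
    define T where "T X n = V \<rho> (X n)" for X and n :: nat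
    have "\<exists>X\<in>B. T X = X"
    proof (rule contraction_fixpoint[where q = "1 / 2" and \<tau> = 0])
      show "(\<lambda>_. e) \<in> B"
        using norm_le_mono[OF e_norm] by (auto simp: B_def M_def e_def)
      show TB: "T X \<in> B" if "X \<in> B" for X
      proof -
        have X: "norm_le 0 X M" and sym: "\<And>n m. cnj (X n m) = X n m" "\<And>n m. X n (- m) = X n m"
          using that by (auto simp: B_def)
        have \<rho>M: "\<rho> * M \<le> s1"
          by (rule order_trans[OF mult_right_mono[OF \<rho>(2)] tM]) (use M in simp)
        note sm = scaled_force_bound(2)[OF X \<rho>(1) \<rho>M]
        have "hermitian (X n)" for n by (simp add: hermitian_def sym)
        then have h: "hermitian (scaled_force \<rho> (X n))" for n
          unfolding scaled_force_def using sm by (intro hermitian_conv_series)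
        have r: "cnj (scaled_force \<rho> (X n) m) = scaled_force \<rho> (X n) m" for n m
          unfolding scaled_force_def by (rule real_conv_series[OF sym(1) sm])
        have "scaled_force \<rho> (X n) (- m) = scaled_force \<rho> (X n) m" for n m
          using h[of n] r[of n m] by (simp add: hermitian_def)
        then have ev: "T X n (- m) = T X n m" for n m
          by (simp add: T_def V_def e_def resolve_def gain_def)
        have re: "cnj (T X n m) = T X n m" for n m
          using r by (simp add: T_def V_def e_def resolve_def)
        have "norm_le 0 (\<lambda>n m. resolve (scaled_force \<rho> (X n)) m) (1 * (C * (CF * (\<rho> * M) * M)))"
        proof (rule norm_le_dominated_same[OF res[OF force_le(1)[OF X \<rho>]]])
          show "cmod (resolve (scaled_force \<rho> (X n)) m)
              \<le> 1 * cmod (of_int m * resolve (scaled_force \<rho> (X n)) m)" for n m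
          proof (cases "2 \<le> \<bar>m\<bar>")
            case True
            then have "1 \<le> \<bar>real_of_int m\<bar>" by linarith
            from mult_right_mono[OF this, of "cmod (resolve (scaled_force \<rho> (X n)) m)"]
            show ?thesis by (simp add: norm_mult)
          qed (simp add: resolve_def)
        qed simp
        from norm_le_add[OF e_norm this]
        have "norm_le 0 (T X) (w 1 + w (- 1) + C * (CF * (\<rho> * M) * M))"
          by (simp add: T_def[abs_def] V_def[abs_def])
        moreover have "C * (CF * (\<rho> * M) * M) \<le> C * (CF * (t * M) * M)"
          using C CF_nonneg M \<rho> by (intro mult_left_mono mult_right_mono) auto
        ultimately have "norm_le 0 (T X) M"
          using tC by (auto simp: M_def elim: norm_le_mono)
        with ev re show ?thesis by (simp add: B_def)
      qed
      show "x \<in> B" if "\<And>j. X j \<in> B" "\<And>n m. (\<lambda>j. X j n m) \<longlonglongrightarrow> x n m" for X x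
      proof -
        have "norm_le 0 x M"
          by (rule norm_le_limit[OF _ that(2)]) (use that(1) in \<open>auto simp: B_def\<close>)
        moreover have "cnj (x n m) = x n m" for n m
          by (rule LIMSEQ_unique[OF tendsto_cnj[OF that(2)]]) (use that in \<open>auto simp: B_def\<close>)
        moreover have "x n (- m) = x n m" for n m
          by (rule LIMSEQ_unique[OF that(2)[of n "- m"]]) (use that in \<open>auto simp: B_def\<close>)
        ultimately show ?thesis by (simp add: B_def)
      qed
      show "norm_le 0 (\<lambda>n m. T X n m - T Y n m) (1 / 2 * d)"
        if "X \<in> B" "Y \<in> B" "norm_le 0 (\<lambda>n m. X n m - Y n m) d" for X Y d
        using V_lip[of X Y d \<rho> \<rho>] that \<rho> by (simp add: T_def B_def)
      show "norm_le 0 (\<lambda>n m. T (\<lambda>_. e) n m - (\<lambda>_. e) n m) (M + M)"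
        by (rule norm_le_diff) (use TB \<open>(\<lambda>_. e) \<in> B\<close> in \<open>auto simp: B_def\<close>)
    qed auto
    then obtain X where X: "X \<in> B" "T X = X" by blast
    show ?thesis
    proof (intro exI[of _ "X 0"] conjI)
      show "norm_le 0 (\<lambda>_. X 0) M" using X(1) norm_le_row[of X M 0] by (simp add: B_def)
      show "V \<rho> (X 0) = X 0" using fun_cong[OF X(2), of 0] by (simp add: T_def)
    qed (use X(1) in \<open>auto simp: B_def\<close>)
  qed
  then obtain Q where Q: "\<And>\<rho>. 0 \<le> \<rho> \<Longrightarrow> \<rho> \<le> t \<Longrightarrow> norm_le 0 (\<lambda>_. Q \<rho>) M"
    "\<And>\<rho> m. 0 \<le> \<rho> \<Longrightarrow> \<rho> \<le> t \<Longrightarrow> cnj (Q \<rho> m) = Q \<rho> m \<and> Q \<rho> (- m) = Q \<rho> m"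
    "\<And>\<rho>. 0 \<le> \<rho> \<Longrightarrow> \<rho> \<le> t \<Longrightarrow> V \<rho> (Q \<rho>) = Q \<rho>" by metis
  define C' where "C' = C + 4 * (C * M\<^sup>2 * CF)"
  have C': "C \<le> C'" "4 * (C * M\<^sup>2 * CF) \<le> C'" "0 \<le> C'" using C CF_nonneg by (auto simp: C'_def)
  show ?thesis
  proof (rule that[of t M C' h0 Q], unfold_locales)
    have "\<bar>wave_number h - wave_number h'\<bar> \<le> C' * \<bar>h - h'\<bar>" if "\<bar>h\<bar> \<le> h0" "\<bar>h'\<bar> \<le> h0" for h h'
      using wave_number_controlledD(2)[OF wn that] mult_right_mono[OF C'(1), of "\<bar>h - h'\<bar>"] by simp
    then show "wave_number_controlled h0 C'" using wn by (simp add: wave_number_controlled_def)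
    show "norm_le 0 (\<lambda>_ m. Q \<rho> m - Q \<rho>' m) (C' * \<bar>\<rho> - \<rho>'\<bar>)"
      if \<rho>: "0 \<le> \<rho>" "\<rho> \<le> t" "0 \<le> \<rho>'" "\<rho>' \<le> t" for \<rho> \<rho>'
    proof (rule norm_le_mono)
      show "norm_le 0 (\<lambda>_ m. Q \<rho> m - Q \<rho>' m) (C * (2 * M\<^sup>2 * CF * \<bar>\<rho> - \<rho>'\<bar>) / (1 - 1 / 2))"
      proof (rule norm_le_absorb)
        show "norm_le 0 (\<lambda>_ m. Q \<rho> m - Q \<rho>' m) (M + M)"
          by (rule norm_le_diff[OF Q(1)[OF \<rho>(1,2)] Q(1)[OF \<rho>(3,4)]])
        show "norm_le 0 (\<lambda>_ m. Q \<rho> m - Q \<rho>' m) (1 / 2 * d + C * (2 * M\<^sup>2 * CF * \<bar>\<rho> - \<rho>'\<bar>))"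
          if "norm_le 0 (\<lambda>_ m. Q \<rho> m - Q \<rho>' m) d" for d
          using V_lip[OF Q(1)[OF \<rho>(1,2)] Q(1)[OF \<rho>(3,4)] that \<rho>]
          by (simp add: Q(3) \<rho>)
      qed (use C CF_nonneg in auto)
      show "C * (2 * M\<^sup>2 * CF * \<bar>\<rho> - \<rho>'\<bar>) / (1 - 1 / 2) \<le> C' * \<bar>\<rho> - \<rho>'\<bar>"
        using mult_right_mono[OF C'(2), of "\<bar>\<rho> - \<rho>'\<bar>"] by (simp add: mult_ac)
    qed
    fix \<rho> m assume \<rho>: "0 \<le> \<rho>" "\<rho> \<le> t"
    show "Q \<rho> m = (if \<bar>m\<bar> = 1 then 1 else 0) + resolve (scaled_force \<rho> (Q \<rho>)) m"
      using fun_cong[OF Q(3)[OF \<rho>], of m] by (simp add: V_def e_def)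
    show "norm_le 0 (\<lambda>_ m. of_int m * resolve (scaled_force \<rho> (Q \<rho>)) m) (C' * \<rho>)"
    proof (rule norm_le_mono[OF res[OF force_le(1)[OF Q(1)[OF \<rho>] \<rho>]]])
      have "0 \<le> C * M\<^sup>2 * CF" using C CF_nonneg by simp
      then have "C * M\<^sup>2 * CF * \<rho> \<le> C' * \<rho>" using C'(2) \<rho>(1) by (intro mult_right_mono) linarith+
      then show "C * (CF * (\<rho> * M) * M) \<le> C' * \<rho>" by (simp add: power2_eq_square mult_ac)
    qed
  qed (use t0 tM th h0 C' Q in auto)
qed

definition evanescent :: "(int \<Rightarrow> complex) \<Rightarrow> int \<Rightarrow> complex" where
  "evanescent f m = (if 2 \<le> \<bar>m\<bar> then f m else 0)"

text \<open>A family of travelling waves \<open>\<rho> * (\<Sum>m. p \<rho> m * cis (m * (\<kappa> \<rho> * n + \<gamma> * t)))\<close>, indexed by the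
  amplitude \<open>\<rho>\<close> of the first harmonic of the strain; hence the first harmonic of the displacement
  is \<open>\<rho> / (2 sin (\<kappa> \<rho> / 2))\<close> in modulus. The bound on \<open>m * p \<rho> m\<close> pays for differences of
  \<open>cis (m * \<kappa> * n)\<close> at two wave numbers, and the higher harmonics are of higher order in \<open>\<rho>\<close>.\<close>

locale waves = chain +
  fixes t0 Cw :: real and \<kappa> :: "real \<Rightarrow> real" and p :: "real \<Rightarrow> int \<Rightarrow> complex"
  assumes t0_pos: "0 < t0" and Cw_nonneg: "0 \<le> Cw"
    and \<kappa>_range: "0 \<le> \<rho> \<Longrightarrow> \<rho> \<le> t0 \<Longrightarrow> 0 < \<kappa> \<rho> \<and> \<kappa> \<rho> < pi"
    and \<kappa>_lipschitz: "0 \<le> \<rho> \<Longrightarrow> \<rho> \<le> t0 \<Longrightarrow> 0 \<le> \<rho>' \<Longrightarrow> \<rho>' \<le> t0 \<Longrightarrow> \<bar>\<kappa> \<rho> - \<kappa> \<rho>'\<bar> \<le> Cw * \<bar>\<rho> - \<rho>'\<bar>"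
    and p_deriv: "0 \<le> \<rho> \<Longrightarrow> \<rho> \<le> t0 \<Longrightarrow> norm_le 0 (\<lambda>_ m. of_int m * p \<rho> m) Cw"
    and p_lipschitz: "0 \<le> \<rho> \<Longrightarrow> \<rho> \<le> t0 \<Longrightarrow> 0 \<le> \<rho>' \<Longrightarrow> \<rho>' \<le> t0 \<Longrightarrow>
      norm_le 0 (\<lambda>_ m. p \<rho> m - p \<rho>' m) (Cw * \<bar>\<rho> - \<rho>'\<bar>)"
    and p_high: "0 \<le> \<rho> \<Longrightarrow> \<rho> \<le> t0 \<Longrightarrow>
      norm_le 0 (\<lambda>_. evanescent (\<lambda>m. of_int m * p \<rho> m)) (Cw * \<rho>)"
    and p_0: "0 \<le> \<rho> \<Longrightarrow> \<rho> \<le> t0 \<Longrightarrow> p \<rho> 0 = 0"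
    and p_1: "0 \<le> \<rho> \<Longrightarrow> \<rho> \<le> t0 \<Longrightarrow> 2 * of_real (sin (\<kappa> \<rho> / 2)) * p \<rho> 1 = \<i>"
    and p_hermitian: "0 \<le> \<rho> \<Longrightarrow> \<rho> \<le> t0 \<Longrightarrow> hermitian (p \<rho>)"
    and p_equation: "0 \<le> \<rho> \<Longrightarrow> \<rho> \<le> t0 \<Longrightarrow>
      of_real ((of_int m * \<gamma>)\<^sup>2) * (of_real \<rho> * p \<rho> m)
       = 2 * \<i> * of_real (sin (of_int m * \<kappa> \<rho> / 2)) *
         (of_real a * (of_real \<rho> * (- 2 * \<i> * of_real (sin (of_int m * \<kappa> \<rho> / 2)) * p \<rho> m))
          + conv_series cf (\<lambda>m. of_real \<rho> * (- 2 * \<i> * of_real (sin (of_int m * \<kappa> \<rho> / 2)) * p \<rho> m)) m)"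

context wave_profiles
begin

definition profile_force :: "real \<Rightarrow> int \<Rightarrow> complex" where
  "profile_force \<rho> = scaled_force \<rho> (Q \<rho>)"

definition profile_number :: "real \<Rightarrow> real" where
  "profile_number \<rho> = wave_number (Re (profile_force \<rho> 1))"

definition stress :: "real \<Rightarrow> int \<Rightarrow> complex" where
  "stress \<rho> m = of_real a * Q \<rho> m + profile_force \<rho> m"

definition half_sin :: "real \<Rightarrow> int \<Rightarrow> real" where
  "half_sin \<rho> m = sin (of_int m * profile_number \<rho> / 2)"

text \<open>The displacement is recovered from the stress, by integrating the wave equation twice in
  time, and not from the strain, since \<open>half_sin \<rho> m\<close> may vanish.\<close>

definition displacement :: "real \<Rightarrow> int \<Rightarrow> complex" where
  "displacement \<rho> m = 2 * \<i> * of_real (half_sin \<rho> m) * stress \<rho> m / of_real ((of_int m * \<gamma>)\<^sup>2)"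

text \<open>\<open>KH * \<rho>\<close> bounds the force of a profile, \<open>LH\<close> is its Lipschitz constant in \<open>\<rho>\<close>, and \<open>Cw\<close>
  collects the constants of all estimates for the waves.\<close>

definition KH :: real where "KH = CF * M * M"

definition LH :: real where "LH = CF * (t * M) * C + 2 * M\<^sup>2 * CF"

definition Cw :: real where
  "Cw = C * LH + 2 / \<gamma>\<^sup>2 * (a * M + h0) + 2 / \<gamma>\<^sup>2 * (a * C + LH + C * LH * (a * M + h0))
    + 2 / \<gamma>\<^sup>2 * (a * C + KH)"

lemma M_nonneg: "0 \<le> M"
  by (rule norm_le_nonneg[OF Q_norm[of 0]]) (use t_pos in auto)

lemma KH_LH_nonneg: "0 \<le> KH" "0 \<le> LH"
  using CF_nonneg M_nonneg C_nonneg t_pos by (auto simp: KH_def LH_def)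

lemma Cw: "C * LH \<le> Cw" "2 / \<gamma>\<^sup>2 * (a * M + h0) \<le> Cw"
  "2 / \<gamma>\<^sup>2 * (a * C + LH + C * LH * (a * M + h0)) \<le> Cw" "2 / \<gamma>\<^sup>2 * (a * C + KH) \<le> Cw" "0 \<le> Cw"
proof -
  have "0 \<le> C * LH" "0 \<le> 2 / \<gamma>\<^sup>2 * (a * M + h0)"
    "0 \<le> 2 / \<gamma>\<^sup>2 * (a * C + LH + C * LH * (a * M + h0))" "0 \<le> 2 / \<gamma>\<^sup>2 * (a * C + KH)"
    using C_nonneg KH_LH_nonneg M_nonneg a_pos h0_pos \<gamma>_pos by simp_all
  then show "C * LH \<le> Cw" "2 / \<gamma>\<^sup>2 * (a * M + h0) \<le> Cw"
    "2 / \<gamma>\<^sup>2 * (a * C + LH + C * LH * (a * M + h0)) \<le> Cw" "2 / \<gamma>\<^sup>2 * (a * C + KH) \<le> Cw" "0 \<le> Cw"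
    unfolding Cw_def by linarith+
qed

context
  fixes \<rho> :: real
  assumes \<rho>: "0 \<le> \<rho>" "\<rho> \<le> t"
begin

lemma \<rho>M: "\<rho> * M \<le> s1"
  by (rule order_trans[OF mult_right_mono[OF \<rho>(2) M_nonneg] tM])

lemma Q_fixed_point: "Q \<rho> m = (if \<bar>m\<bar> = 1 then 1 else 0) + resolve (profile_force \<rho>) m"
  unfolding profile_force_def by (rule Q_equation[OF \<rho>])

lemma profile_force_norm: "norm_le 0 (\<lambda>_. profile_force \<rho>) (KH * \<rho>)"
  using scaled_force_bound(1)[OF Q_norm[OF \<rho>] \<rho>(1) \<rho>M] by (simp add: profile_force_def KH_def mult_ac)

lemma profile_force_small: "norm_le 0 (\<lambda>_. profile_force \<rho>) h0"
proof (rule norm_le_mono[OF profile_force_norm])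
  have "KH * \<rho> \<le> KH * t" by (rule mult_left_mono[OF \<rho>(2) KH_LH_nonneg(1)])
  also have "\<dots> \<le> h0" using force_small by (simp add: KH_def mult_ac)
  finally show "KH * \<rho> \<le> h0" .
qed

lemmas profile_force_summable = scaled_force_bound(2)[OF Q_norm[OF \<rho>] \<rho>(1) \<rho>M]

lemma profile_force_real: "cnj (profile_force \<rho> m) = profile_force \<rho> m"
  unfolding profile_force_def scaled_force_def by (rule real_conv_series[OF Q_real[OF \<rho>] profile_force_summable])

lemma profile_force_even: "profile_force \<rho> (- m) = profile_force \<rho> m"
proof -
  have "hermitian (profile_force \<rho>)"
    unfolding profile_force_def scaled_force_def
    by (rule hermitian_conv_series[OF _ profile_force_summable]) (simp add: hermitian_def Q_real[OF \<rho>] Q_even[OF \<rho>])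
  then show ?thesis by (simp add: hermitian_def profile_force_real)
qed

lemma profile_force_1_small: "\<bar>Re (profile_force \<rho> 1)\<bar> \<le> h0"
  using norm_le_coeff0[OF profile_force_small, of 1] abs_Re_le_cmod[of "profile_force \<rho> 1"] by linarith

lemmas profile_number_facts = wave_number_controlledD(1)[OF controlled profile_force_1_small, folded profile_number_def]

lemma profile_force_1_real: "profile_force \<rho> 1 = of_real (Re (profile_force \<rho> 1))"
  using profile_force_real[of 1] by (simp add: complex_eq_iff)

lemma profile_equation: "of_real ((of_int m * \<gamma>)\<^sup>2) * Q \<rho> m = of_real (4 * (half_sin \<rho> m)\<^sup>2) * stress \<rho> m"
proof -
  consider "m = 0" | "\<bar>m\<bar> = 1" | "2 \<le> \<bar>m\<bar>" by linarith
  then show ?thesis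
  proof cases
    case 1 then show ?thesis by (simp add: half_sin_def)
  next
    case 2
    then have m: "m = 1 \<or> m = - 1" by linarith
    have Hm: "profile_force \<rho> m = of_real (Re (profile_force \<rho> 1))" using m profile_force_1_real profile_force_even[of 1] by auto
    have sin_sq: "(half_sin \<rho> m)\<^sup>2 = (sin (profile_number \<rho> / 2))\<^sup>2" using m by (auto simp: half_sin_def)
    have Qm: "Q \<rho> m = 1" using Q_fixed_point[of m] m by (auto simp: resolve_def)
    have m2: "(of_int m * \<gamma>)\<^sup>2 = \<gamma>\<^sup>2" using m by auto
    have "of_real (4 * (half_sin \<rho> m)\<^sup>2) * stress \<rho> m
        = (of_real (4 * (sin (profile_number \<rho> / 2))\<^sup>2 * (a + Re (profile_force \<rho> 1))) :: complex)"
      by (simp add: stress_def Hm Qm sin_sq)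
    also have "\<dots> = of_real ((of_int m * \<gamma>)\<^sup>2) * Q \<rho> m"
      using profile_number_facts unfolding m2 Qm by simp
    finally show ?thesis by simp
  next
    case 3
    define D where "D = (of_int m * \<gamma>)\<^sup>2 - 4 * a * (half_sin \<rho> m)\<^sup>2"
    have "0 < (\<gamma>\<^sup>2 - a) * (of_int m)\<^sup>2" using \<gamma>_lower 3 by simp
    with gain_denominator[OF 3, of "profile_number \<rho>"] have D: "0 < D" unfolding D_def half_sin_def by linarith
    have "Q \<rho> m = of_real (4 * (half_sin \<rho> m)\<^sup>2 / D) * profile_force \<rho> m"
      using Q_fixed_point[of m] 3 by (simp add: resolve_def gain_def profile_number_def half_sin_def D_def)
    then have "of_real D * Q \<rho> m = of_real (4 * (half_sin \<rho> m)\<^sup>2) * profile_force \<rho> m"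
      using D by (simp add: field_simps)
    then show ?thesis by (simp add: D_def stress_def algebra_simps)
  qed
qed

lemma Q_0: "Q \<rho> 0 = 0" using Q_fixed_point[of 0] by (simp add: resolve_def)

lemma strain_of_displacement: "- 2 * \<i> * of_real (half_sin \<rho> m) * displacement \<rho> m = Q \<rho> m"
proof (cases "m = 0")
  case True then show ?thesis by (simp add: Q_0 half_sin_def)
next
  case False
  then have "of_real ((of_int m * \<gamma>)\<^sup>2) \<noteq> (0::complex)"
    using \<gamma>_pos by (simp del: of_real_power of_real_mult)
  then show ?thesis
    using profile_equation[of m] by (simp add: displacement_def field_simps power2_eq_square)
qed

lemma stress_norm: "norm_le 0 (\<lambda>_. stress \<rho>) (a * M + h0)"
  using norm_le_add[OF norm_le_cmult[OF Q_norm[OF \<rho>], of "of_real a"] profile_force_small] a_pos by (simp add: stress_def[abs_def])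

lemma displacement_le_stress: "cmod (of_int m * displacement \<rho> m) \<le> 2 / \<gamma>\<^sup>2 * cmod (stress \<rho> m)"
proof (cases "m = 0")
  case False
  then have m: "1 \<le> \<bar>real_of_int m\<bar>" by linarith
  define A where "A = \<bar>real_of_int m\<bar>"
  have A: "1 \<le> A" "(of_int m * \<gamma>)\<^sup>2 = A * A * \<gamma>\<^sup>2"
    using m by (simp_all add: A_def power_mult_distrib power2_eq_square)
  have "cmod (of_int m * displacement \<rho> m) = A * (2 * \<bar>half_sin \<rho> m\<bar> * cmod (stress \<rho> m)) / (A * A * \<gamma>\<^sup>2)"
    unfolding displacement_def norm_mult norm_divide norm_of_real norm_of_int A_def[symmetric] A(2)
    by (simp add: abs_mult)
  also have "\<dots> = 2 / \<gamma>\<^sup>2 * cmod (stress \<rho> m) * (\<bar>half_sin \<rho> m\<bar> / \<bar>of_int m\<bar>)"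
    unfolding A_def[symmetric] using A(1) \<gamma>_pos by (simp add: field_simps)
  also have "\<dots> \<le> 2 / \<gamma>\<^sup>2 * cmod (stress \<rho> m) * 1"
  proof (rule mult_left_mono)
    have "\<bar>half_sin \<rho> m\<bar> \<le> \<bar>of_int m\<bar>" unfolding half_sin_def by (rule order_trans[OF abs_sin_le_one m])
    then show "\<bar>half_sin \<rho> m\<bar> / \<bar>of_int m\<bar> \<le> 1" using m by (simp add: divide_le_eq)
  qed simp
  finally show ?thesis by simp
qed simp

lemma displacement_deriv_norm: "norm_le 0 (\<lambda>_ m. of_int m * displacement \<rho> m) Cw"
  by (rule norm_le_mono[OF norm_le_dominated_same[OF stress_norm _ displacement_le_stress] Cw(2)]) simp

lemma displacement_high_norm: "norm_le 0 (\<lambda>_ m. if 2 \<le> \<bar>m\<bar> then of_int m * displacement \<rho> m else 0) (Cw * \<rho>)"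
proof (rule norm_le_mono[OF norm_le_dominated2[OF Q_high[OF \<rho>, folded profile_force_def] profile_force_norm, of "2 / \<gamma>\<^sup>2 * a" "2 / \<gamma>\<^sup>2"]])
  show "2 / \<gamma>\<^sup>2 * a * (C * \<rho>) + 2 / \<gamma>\<^sup>2 * (KH * \<rho>) \<le> Cw * \<rho>"
    using mult_right_mono[OF Cw(4) \<rho>(1)] by (simp add: algebra_simps add_divide_distrib)
  fix n :: nat and m
  show "cmod (if 2 \<le> \<bar>m\<bar> then of_int m * displacement \<rho> m else 0)
      \<le> 2 / \<gamma>\<^sup>2 * a * cmod (of_int m * resolve (profile_force \<rho>) m) + 2 / \<gamma>\<^sup>2 * cmod (profile_force \<rho> m)"
  proof (cases "2 \<le> \<bar>m\<bar>")
    case True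
    then have m: "1 \<le> \<bar>real_of_int m\<bar>" by linarith
    have "Q \<rho> m = resolve (profile_force \<rho>) m" using Q_fixed_point[of m] True by auto
    then have "cmod (stress \<rho> m) \<le> cmod (of_real a * resolve (profile_force \<rho>) m) + cmod (profile_force \<rho> m)"
      unfolding stress_def by (metis norm_triangle_ineq)
    also have "\<dots> \<le> a * cmod (of_int m * resolve (profile_force \<rho>) m) + cmod (profile_force \<rho> m)"
      using a_pos mult_right_mono[OF m, of "a * cmod (resolve (profile_force \<rho>) m)"]
      by (simp add: norm_mult mult_ac)
    finally have "2 / \<gamma>\<^sup>2 * cmod (stress \<rho> m)
        \<le> 2 / \<gamma>\<^sup>2 * (a * cmod (of_int m * resolve (profile_force \<rho>) m) + cmod (profile_force \<rho> m))"
      by (rule mult_left_mono) simp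
    with displacement_le_stress[of m] True show ?thesis by (simp add: distrib_left)
  qed (use a_pos in simp)
qed (use a_pos in auto)

lemma displacement_1: "2 * of_real (sin (profile_number \<rho> / 2)) * displacement \<rho> 1 = \<i>"
proof -
  have Q1: "Q \<rho> 1 = 1" using Q_fixed_point[of 1] by (simp add: resolve_def)
  have "stress \<rho> 1 = of_real (a + Re (profile_force \<rho> 1))" unfolding stress_def Q1 by (subst profile_force_1_real) simp
  then have "2 * of_real (sin (profile_number \<rho> / 2)) * displacement \<rho> 1
      = \<i> * of_real (4 * (sin (profile_number \<rho> / 2))\<^sup>2 * (a + Re (profile_force \<rho> 1)) / \<gamma>\<^sup>2)"
    by (simp add: displacement_def half_sin_def power2_eq_square)
  also have "4 * (sin (profile_number \<rho> / 2))\<^sup>2 * (a + Re (profile_force \<rho> 1)) / \<gamma>\<^sup>2 = 1" using profile_number_facts \<gamma>_pos by simp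
  finally show ?thesis by simp
qed

lemma hermitian_displacement: "hermitian (displacement \<rho>)"
  unfolding hermitian_def
  by (simp add: displacement_def stress_def half_sin_def Q_even[OF \<rho>] profile_force_even Q_real[OF \<rho>] profile_force_real)

lemma displacement_equation: "of_real ((of_int m * \<gamma>)\<^sup>2) * (of_real \<rho> * displacement \<rho> m)
   = 2 * \<i> * of_real (half_sin \<rho> m) *
     (of_real a * (of_real \<rho> * (- 2 * \<i> * of_real (half_sin \<rho> m) * displacement \<rho> m))
      + conv_series cf (\<lambda>m. of_real \<rho> * (- 2 * \<i> * of_real (half_sin \<rho> m) * displacement \<rho> m)) m)"
proof -
  have "of_real a * (of_real \<rho> * Q \<rho> m) + conv_series cf (\<lambda>m. of_real \<rho> * Q \<rho> m) m
      = of_real \<rho> * stress \<rho> m"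
    unfolding force_scale[OF profile_force_summable] by (simp add: stress_def profile_force_def algebra_simps)
  moreover have "of_real ((of_int m * \<gamma>)\<^sup>2) * displacement \<rho> m = 2 * \<i> * of_real (half_sin \<rho> m) * stress \<rho> m"
  proof (cases "m = 0")
    case False
    then show ?thesis using \<gamma>_pos by (simp add: displacement_def)
  qed (simp add: half_sin_def)
  ultimately show ?thesis unfolding strain_of_displacement by (simp add: algebra_simps)
qed

end

lemma profile_force_lipschitz:
  assumes \<rho>: "0 \<le> \<rho>" "\<rho> \<le> t" "0 \<le> \<rho>'" "\<rho>' \<le> t"
  shows "norm_le 0 (\<lambda>_ m. profile_force \<rho> m - profile_force \<rho>' m) (LH * \<bar>\<rho> - \<rho>'\<bar>)"
  using scaled_force_lipschitz[OF Q_norm[OF \<rho>(1,2)] Q_norm[OF \<rho>(3,4)] Q_lipschitz[OF \<rho>] \<rho> tM]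
  by (simp add: profile_force_def LH_def algebra_simps)

lemma profile_number_lipschitz:
  assumes \<rho>: "0 \<le> \<rho>" "\<rho> \<le> t" "0 \<le> \<rho>'" "\<rho>' \<le> t"
  shows "\<bar>profile_number \<rho> - profile_number \<rho>'\<bar> \<le> C * LH * \<bar>\<rho> - \<rho>'\<bar>"
proof -
  have "\<bar>profile_number \<rho> - profile_number \<rho>'\<bar> \<le> C * \<bar>Re (profile_force \<rho> 1) - Re (profile_force \<rho>' 1)\<bar>"
    unfolding profile_number_def by (rule wave_number_controlledD(2)[OF controlled profile_force_1_small[OF \<rho>(1,2)] profile_force_1_small[OF \<rho>(3,4)]])
  also have "\<dots> \<le> C * (LH * \<bar>\<rho> - \<rho>'\<bar>)"
    using norm_le_coeff0[OF profile_force_lipschitz[OF \<rho>], of 1] abs_Re_le_cmod[of "profile_force \<rho> 1 - profile_force \<rho>' 1"] C_nonneg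
    by (intro mult_left_mono) auto
  finally show ?thesis by (simp add: mult.assoc)
qed

lemma displacement_lipschitz:
  assumes \<rho>: "0 \<le> \<rho>" "\<rho> \<le> t" "0 \<le> \<rho>'" "\<rho>' \<le> t"
  shows "norm_le 0 (\<lambda>_ m. displacement \<rho> m - displacement \<rho>' m) (Cw * \<bar>\<rho> - \<rho>'\<bar>)"
proof -
  define d where "d = \<bar>\<rho> - \<rho>'\<bar>"
  have W_lip: "norm_le 0 (\<lambda>_ m. stress \<rho> m - stress \<rho>' m) ((a * C + LH) * d)"
    using norm_le_add[OF norm_le_cmult[OF Q_lipschitz[OF \<rho>], of "of_real a"] profile_force_lipschitz[OF \<rho>]] a_pos
    by (simp add: stress_def algebra_simps d_def)
  show ?thesis
  proof (rule norm_le_mono[OF norm_le_dominated2[OF W_lip stress_norm[OF \<rho>(3,4)],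
          of "2 / \<gamma>\<^sup>2" "2 / \<gamma>\<^sup>2 * (C * LH * d)"]])
    show "2 / \<gamma>\<^sup>2 * ((a * C + LH) * d) + 2 / \<gamma>\<^sup>2 * (C * LH * d) * (a * M + h0) \<le> Cw * \<bar>\<rho> - \<rho>'\<bar>"
      using mult_right_mono[OF Cw(3), of d] by (simp add: d_def algebra_simps add_divide_distrib)
    show "0 \<le> 2 / \<gamma>\<^sup>2 * (C * LH * d)" using C_nonneg KH_LH_nonneg by (simp add: d_def)
    fix n :: nat and m
    show "cmod (displacement \<rho> m - displacement \<rho>' m)
        \<le> 2 / \<gamma>\<^sup>2 * cmod (stress \<rho> m - stress \<rho>' m) + 2 / \<gamma>\<^sup>2 * (C * LH * d) * cmod (stress \<rho>' m)"
    proof (cases "m = 0")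
      case False
      then have m: "1 \<le> \<bar>real_of_int m\<bar>" by linarith
      define x y where "x = half_sin \<rho> m" and "y = half_sin \<rho>' m"
      have x: "\<bar>x\<bar> \<le> 1" by (simp add: x_def half_sin_def)
      have m_le: "\<bar>real_of_int m\<bar> \<le> (real_of_int m)\<^sup>2"
        using mult_left_mono[OF m, of "\<bar>real_of_int m\<bar>"] by (simp add: power2_eq_square)
      have one_le: "1 \<le> (real_of_int m)\<^sup>2" using m m_le by linarith
      have "\<bar>x - y\<bar> \<le> \<bar>of_int m * profile_number \<rho> / 2 - of_int m * profile_number \<rho>' / 2\<bar>"
        unfolding x_def y_def half_sin_def by (rule abs_sin_diff_le)
      also have "\<dots> = \<bar>of_int m\<bar> * \<bar>profile_number \<rho> - profile_number \<rho>'\<bar> / 2"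
        by (simp add: abs_mult flip: right_diff_distrib diff_divide_distrib)
      also have "\<dots> \<le> \<bar>of_int m\<bar> * (C * LH * d)"
      proof -
        have "\<bar>profile_number \<rho> - profile_number \<rho>'\<bar> / 2 \<le> C * LH * d"
          unfolding d_def by (rule order_trans[OF _ profile_number_lipschitz[OF \<rho>]]) simp
        from mult_left_mono[OF this, of "\<bar>of_int m\<bar>"] show ?thesis by simp
      qed
      also have "\<dots> \<le> (of_int m)\<^sup>2 * (C * LH * d)"
        using C_nonneg KH_LH_nonneg by (intro mult_right_mono m_le) (auto simp: d_def)
      finally have xy: "\<bar>x - y\<bar> \<le> (of_int m)\<^sup>2 * (C * LH * d)" .
      have "displacement \<rho> m - displacement \<rho>' m = 2 * \<i> * (of_real x * (stress \<rho> m - stress \<rho>' m) + of_real (x - y) * stress \<rho>' m)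
          / of_real ((of_int m * \<gamma>)\<^sup>2)"
        unfolding displacement_def x_def[symmetric] y_def[symmetric] diff_divide_distrib[symmetric]
        by (simp add: algebra_simps)
      also have "cmod \<dots> \<le> 2 * (\<bar>x\<bar> * cmod (stress \<rho> m - stress \<rho>' m) + \<bar>x - y\<bar> * cmod (stress \<rho>' m))
          / (of_int m * \<gamma>)\<^sup>2"
      proof -
        have "cmod (of_real x * (stress \<rho> m - stress \<rho>' m) + of_real (x - y) * stress \<rho>' m)
          \<le> \<bar>x\<bar> * cmod (stress \<rho> m - stress \<rho>' m) + \<bar>x - y\<bar> * cmod (stress \<rho>' m)"
          by (rule order_trans[OF norm_triangle_ineq])
            (simp add: norm_mult del: of_real_diff)
        moreover have "cmod (2 * \<i> * X / of_real R) \<le> 2 * B / R" if "cmod X \<le> B" "0 \<le> R" for X B R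
          using that by (simp add: norm_divide norm_mult divide_right_mono)
        ultimately show ?thesis by (metis zero_le_power2)
      qed
      also have "\<dots> \<le> 2 * ((of_int m)\<^sup>2 * cmod (stress \<rho> m - stress \<rho>' m)
          + (of_int m)\<^sup>2 * (C * LH * d) * cmod (stress \<rho>' m)) / (of_int m * \<gamma>)\<^sup>2"
        using x one_le xy by (intro divide_right_mono mult_left_mono add_mono mult_right_mono) auto
      also have "\<dots> = 2 / \<gamma>\<^sup>2 * cmod (stress \<rho> m - stress \<rho>' m) + 2 / \<gamma>\<^sup>2 * (C * LH * d) * cmod (stress \<rho>' m)"
        using False \<gamma>_pos by (simp add: power_mult_distrib field_simps)
      finally show ?thesis .
    qed (use C_nonneg KH_LH_nonneg in \<open>simp add: displacement_def d_def\<close>)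
  qed simp
qed

lemma travelling_waves: "waves w a \<gamma> s1 cf t Cw profile_number displacement"
proof (unfold_locales)
  show "\<bar>profile_number \<rho> - profile_number \<rho>'\<bar> \<le> Cw * \<bar>\<rho> - \<rho>'\<bar>"
    if \<rho>: "0 \<le> \<rho>" "\<rho> \<le> t" "0 \<le> \<rho>'" "\<rho>' \<le> t" for \<rho> \<rho>'
    using profile_number_lipschitz[OF \<rho>] mult_right_mono[OF Cw(1), of "\<bar>\<rho> - \<rho>'\<bar>"] by simp
  show "displacement \<rho> 0 = 0" for \<rho> by (simp add: displacement_def)
qed (use t_pos Cw(5) profile_number_facts displacement_deriv_norm displacement_high_norm displacement_1 hermitian_displacement displacement_lipschitz displacement_equation[unfolded half_sin_def] in \<open>auto simp: evanescent_def[abs_def]\<close>)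

end

lemma (in chain) travelling_waves_exist:
  obtains t0 Cw \<kappa> p where "waves w a \<gamma> s1 cf t0 Cw \<kappa> p"
proof -
  obtain t M C h0 Q where "wave_profiles w a \<gamma> s1 cf t M C h0 Q" by (rule wave_profiles_exist)
  from wave_profiles.travelling_waves[OF this] show ?thesis by (rule that)
qed

section \<open>Linear estimates for the decaying part\<close>

context chain
begin

lemma delta_mono: "2 \<le> \<bar>m\<bar> \<Longrightarrow> delta a \<gamma> 2 \<le> delta a \<gamma> m"
proof -
  assume "2 \<le> \<bar>m\<bar>"
  then have "(2::real)\<^sup>2 \<le> \<bar>of_int m\<bar>\<^sup>2" by (intro power_mono) linarith+
  then have "2\<^sup>2 * \<gamma>\<^sup>2 \<le> (of_int m)\<^sup>2 * \<gamma>\<^sup>2" by (intro mult_right_mono) auto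
  then show ?thesis using a_pos by (simp add: delta_def power_mult_distrib divide_right_mono)
qed

lemma delta_2_gt_2: "2 < delta a \<gamma> 2"
  using a_pos \<gamma>_lower by (simp add: delta_def power_mult_distrib field_simps)

lemma delta_uminus [simp]: "delta a \<gamma> (- m) = delta a \<gamma> m"
  by (simp add: delta_def)

text \<open>In the evanescent modes \<open>\<bar>m\<bar> \<ge> 2\<close> the diagonal \<open>delta a \<gamma> m\<close> dominates, so that the
  equation can be solved for its diagonal term and iterated.\<close>

definition neighbours :: "(nat \<Rightarrow> int \<Rightarrow> complex) \<Rightarrow> nat \<Rightarrow> int \<Rightarrow> complex" where
  "neighbours v n m = (if 2 \<le> \<bar>m\<bar> \<and> 1 \<le> n then - (v (n + 1) m + v (n - 1) m) / of_real (delta a \<gamma> m) else 0)"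

lemma neighbours_bound:
  assumes v: "norm_le \<tau> v r" and \<tau>: "0 \<le> \<tau>" "\<tau> \<le> \<sigma>"
  shows "norm_le \<tau> (neighbours v) ((exp \<sigma> + exp (- \<sigma>)) / delta a \<gamma> 2 * r)"
proof -
  have "norm_le \<tau> (\<lambda>n m. v (n + 1) m + (if 1 \<le> n then v (n - 1) m else 0)) (exp (- \<tau> * real 1) * r + exp \<tau> * r)"
    by (rule norm_le_add[OF norm_le_shift_up[OF v] norm_le_shift_down[OF v]])
  moreover have "cmod (neighbours v n m)
      \<le> 1 / delta a \<gamma> 2 * cmod (v (n + 1) m + (if 1 \<le> n then v (n - 1) m else 0))" for n m
  proof (cases "2 \<le> \<bar>m\<bar> \<and> 1 \<le> n")
    case True
    then have "0 < delta a \<gamma> m" "delta a \<gamma> 2 \<le> delta a \<gamma> m"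
      using delta_mono[of m] delta_2_gt_2 by auto
    moreover from this have "cmod (neighbours v n m) = cmod (v (n + 1) m + v (n - 1) m) / delta a \<gamma> m"
      using True by (simp only: neighbours_def if_True simp_thms norm_divide norm_minus_cancel norm_of_real abs_of_pos)
    moreover have "cmod (v (n + 1) m + v (n - 1) m) / delta a \<gamma> m
        \<le> cmod (v (n + 1) m + v (n - 1) m) / delta a \<gamma> 2"
      using calculation delta_2_gt_2 by (intro divide_left_mono) auto
    ultimately show ?thesis using True by simp
  qed (use delta_2_gt_2 in \<open>auto simp: neighbours_def\<close>)
  ultimately have "norm_le \<tau> (neighbours v) (1 / delta a \<gamma> 2 * (exp (- \<tau> * real 1) * r + exp \<tau> * r))"
    by (intro norm_le_dominated_same) (use delta_2_gt_2 in auto)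
  then show ?thesis
  proof (rule norm_le_mono)
    have "exp \<sigma> + exp (- \<sigma>) - (exp \<tau> + exp (- \<tau>)) = (exp \<sigma> - exp \<tau>) * (1 - exp (- \<sigma> - \<tau>))"
      by (simp add: algebra_simps flip: exp_add)
    moreover have "0 \<le> (exp \<sigma> - exp \<tau>) * (1 - exp (- \<sigma> - \<tau>))"
      using \<tau> by (intro mult_nonneg_nonneg) auto
    ultimately have "(exp \<tau> + exp (- \<tau>)) * r \<le> (exp \<sigma> + exp (- \<sigma>)) * r"
      using norm_le_nonneg[OF v] by (intro mult_right_mono) auto
    then show "1 / delta a \<gamma> 2 * (exp (- \<tau> * real 1) * r + exp \<tau> * r)
        \<le> (exp \<sigma> + exp (- \<sigma>)) / delta a \<gamma> 2 * r"
      using delta_2_gt_2 divide_right_mono[of _ _ "delta a \<gamma> 2"]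
      by (simp add: algebra_simps flip: add_divide_distrib)
  qed
qed

text \<open>In the propagating modes the decaying solution is obtained by summing from infinity.
  Up to the factor \<open>- 1 / a\<close>, the kernel is the increment from \<open>j\<close> to \<open>j + 1\<close> of the solution
  \<open>sin (j \<theta>) / sin \<theta>\<close> of the homogeneous equation, with \<open>\<theta> = m * wave_number 0\<close>; written with cosines it also covers \<open>m = 0\<close>.\<close>

definition propagator :: "int \<Rightarrow> nat \<Rightarrow> real" where
  "propagator m j = - cos ((real j + 1 / 2) * (of_int m * wave_number 0)) / (a * cos (of_int m * wave_number 0 / 2))"

definition respond :: "(nat \<Rightarrow> int \<Rightarrow> complex) \<Rightarrow> nat \<Rightarrow> int \<Rightarrow> complex" where
  "respond f n m = (if \<bar>m\<bar> \<le> 1 then \<Sum>j. of_real (propagator m j) * f (n + Suc j) m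
     else if 1 \<le> n then - (f n m - f (n + 1) m) / of_real (a * delta a \<gamma> m) else 0)"

lemma wave_number_0:
  "0 < wave_number 0" "wave_number 0 < pi" "4 * (sin (wave_number 0 / 2))\<^sup>2 * a = \<gamma>\<^sup>2"
proof -
  obtain h0 L where "0 < h0" "wave_number_controlled h0 L" by (rule wave_number_control)
  from wave_number_controlledD(1)[OF this(2), of 0] this(1) show "0 < wave_number 0" "wave_number 0 < pi"
    "4 * (sin (wave_number 0 / 2))\<^sup>2 * a = \<gamma>\<^sup>2" by auto
qed

lemma small_mode_cases: "\<bar>m :: int\<bar> \<le> 1 \<Longrightarrow> m = 0 \<or> m = 1 \<or> m = - 1"
  by linarith

lemma cos_half_pos: "\<bar>m\<bar> \<le> 1 \<Longrightarrow> cos (wave_number 0 / 2) \<le> cos (of_int m * wave_number 0 / 2)"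
  and cos_half_0_pos: "0 < cos (wave_number 0 / 2)"
proof -
  show "0 < cos (wave_number 0 / 2)" using wave_number_0 by (intro cos_gt_zero) auto
  show "cos (wave_number 0 / 2) \<le> cos (of_int m * wave_number 0 / 2)" if "\<bar>m\<bar> \<le> 1"
    using small_mode_cases[OF that] by auto
qed

lemma propagator_bound:
  assumes "\<bar>m\<bar> \<le> 1"
  shows "\<bar>propagator m j\<bar> \<le> 1 / (a * cos (wave_number 0 / 2))"
proof -
  have "\<bar>propagator m j\<bar> = \<bar>cos ((real j + 1 / 2) * (of_int m * wave_number 0))\<bar>
      / (a * cos (of_int m * wave_number 0 / 2))"
    using cos_half_pos[OF assms] cos_half_0_pos a_pos by (simp add: propagator_def abs_mult)
  also have "\<dots> \<le> 1 / (a * cos (wave_number 0 / 2))"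
    using cos_half_pos[OF assms] cos_half_0_pos a_pos by (intro frac_le mult_left_mono) auto
  finally show ?thesis .
qed

lemma two_cos_eq_delta:
  assumes "\<bar>m\<bar> \<le> 1"
  shows "2 * cos (of_int m * wave_number 0) = - delta a \<gamma> m"
proof -
  have "cos (wave_number 0) = 1 - 2 * (sin (wave_number 0 / 2))\<^sup>2"
    using cos_double_sin[of "wave_number 0 / 2"] by simp
  moreover have "(sin (wave_number 0 / 2))\<^sup>2 = \<gamma>\<^sup>2 / (4 * a)"
    using wave_number_0(3) a_pos by (simp add: field_simps)
  ultimately have "2 * cos (wave_number 0) = 2 - \<gamma>\<^sup>2 / a" using a_pos by (simp add: field_simps)
  then show ?thesis using small_mode_cases[OF assms] by (auto simp: delta_def)
qed

lemma propagator_recursion: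
  assumes "\<bar>m\<bar> \<le> 1"
  shows "propagator m 0 = - 1 / a"
    and "propagator m 1 + delta a \<gamma> m * propagator m 0 = 1 / a"
    and "propagator m (j + 2) + delta a \<gamma> m * propagator m (j + 1) + propagator m j = 0"
proof -
  define \<theta> where "\<theta> = of_int m * wave_number 0"
  define c where "c = a * cos (\<theta> / 2)"
  have c: "0 < c" "cos (\<theta> / 2) \<noteq> 0"
    using cos_half_pos[OF assms] cos_half_0_pos a_pos by (simp_all add: c_def \<theta>_def)
  have k: "propagator m j = - cos ((real j + 1 / 2) * \<theta>) / c" for j by (simp add: propagator_def \<theta>_def c_def)
  have d: "delta a \<gamma> m = - (2 * cos \<theta>)" using two_cos_eq_delta[OF assms] by (simp add: \<theta>_def)
  have addition: "cos (x + \<theta>) - 2 * cos \<theta> * cos x + cos (x - \<theta>) = 0" for x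
    by (simp add: cos_add cos_diff)
  show k0: "propagator m 0 = - 1 / a" using c a_pos by (simp add: k c_def)
  show "propagator m (j + 2) + delta a \<gamma> m * propagator m (j + 1) + propagator m j = 0"
  proof -
    have "(real (j + 2) + 1 / 2) * \<theta> = (real (j + 1) + 1 / 2) * \<theta> + \<theta>"
      "(real j + 1 / 2) * \<theta> = (real (j + 1) + 1 / 2) * \<theta> - \<theta>" by (simp_all add: algebra_simps)
    then have "cos ((real (j + 2) + 1 / 2) * \<theta>) - 2 * cos \<theta> * cos ((real (j + 1) + 1 / 2) * \<theta>)
        + cos ((real j + 1 / 2) * \<theta>) = 0" using addition by metis
    then show ?thesis using c unfolding k d by (simp add: divide_simps)
  qed
  show "propagator m 1 + delta a \<gamma> m * propagator m 0 = 1 / a"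
  proof -
    have "cos (3 / 2 * \<theta>) - 2 * cos \<theta> * cos (\<theta> / 2) + cos (\<theta> / 2) = 0"
      using addition[of "\<theta> / 2"] by (simp add: algebra_simps)
    then have "cos (3 / 2 * \<theta>) - 2 * cos \<theta> * cos (\<theta> / 2) = - cos (\<theta> / 2)" by linarith
    moreover have "propagator m 1 + delta a \<gamma> m * propagator m 0
        = - (cos (3 / 2 * \<theta>) - 2 * cos \<theta> * cos (\<theta> / 2)) / c"
      unfolding k d by (simp add: algebra_simps diff_divide_distrib add_divide_distrib)
    ultimately show ?thesis using c a_pos by (simp add: c_def)
  qed
qed

lemma respond_terms:
  assumes f: "norm_le \<tau> f r" and \<tau>: "0 < \<tau>"
  defines "c \<equiv> 1 / (a * cos (wave_number 0 / 2))"
  shows "norm_le \<tau> (\<lambda>n m. if \<bar>m\<bar> \<le> 1 then of_real (propagator m j) * f (n + Suc j) m else 0)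
      (c * r * exp (- \<tau>) ^ Suc j)"
    and "summable (\<lambda>j. c * r * exp (- \<tau>) ^ Suc j)"
proof -
  have c: "0 \<le> c" using a_pos cos_half_0_pos by (simp add: c_def)
  have "norm_le \<tau> (\<lambda>n m. if \<bar>m\<bar> \<le> 1 then of_real (propagator m j) * f (n + Suc j) m else 0)
      (c * (exp (- \<tau> * real (Suc j)) * r))"
  proof (rule norm_le_dominated_same[OF norm_le_shift_up[OF f] c])
    show "cmod (if \<bar>m\<bar> \<le> 1 then of_real (propagator m j) * f (n + Suc j) m else 0)
        \<le> c * cmod (f (n + Suc j) m)" for n m
      using mult_right_mono[OF propagator_bound[of m j, folded c_def], of "cmod (f (n + Suc j) m)"] c
      by (simp add: norm_mult)
  qed
  then show "norm_le \<tau> (\<lambda>n m. if \<bar>m\<bar> \<le> 1 then of_real (propagator m j) * f (n + Suc j) m else 0)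
      (c * r * exp (- \<tau>) ^ Suc j)"
    by (simp add: exp_of_nat2_mult[symmetric] mult_ac del: of_nat_Suc power_Suc)
  show "summable (\<lambda>j. c * r * exp (- \<tau>) ^ Suc j)"
    using \<tau> by (intro summable_mult) (simp add: summable_geometric summable_mult)
qed

lemma respond_summable:
  assumes "norm_le \<tau> f r" "0 < \<tau>" "\<bar>m\<bar> \<le> 1"
  shows "summable (\<lambda>j. of_real (propagator m j) * f (n + Suc j) m)"
  using norm_le_suminf(2)[OF respond_terms[OF assms(1,2)], where n = n and m = m] assms(3) by simp

lemma respond_bound:
  assumes \<sigma>: "0 < \<sigma>"
  obtains C where "0 \<le> C"
    "\<And>\<tau> f r. \<sigma> \<le> \<tau> \<Longrightarrow> norm_le \<tau> f r \<Longrightarrow> norm_le \<tau> (respond f) (C * r)"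
proof -
  define c where "c = 1 / (a * cos (wave_number 0 / 2))"
  define d where "d = 1 / (a * delta a \<gamma> 2)"
  have cd: "0 \<le> c" "0 \<le> d" using a_pos cos_half_0_pos delta_2_gt_2 by (auto simp: c_def d_def)
  have geo: "summable (\<lambda>j. exp (- \<sigma>) ^ Suc j)"
    using \<sigma> by (simp add: summable_geometric summable_mult)
  define S where "S = (\<Sum>j. exp (- \<sigma>) ^ Suc j)"
  have S: "0 \<le> S" unfolding S_def by (rule suminf_nonneg[OF geo]) auto
  show ?thesis
  proof (rule that[of "c * S + 2 * d"])
    show "0 \<le> c * S + 2 * d" using cd S by simp
    fix \<tau> r :: real and f assume \<tau>: "\<sigma> \<le> \<tau>" and f: "norm_le \<tau> f r"
    have \<tau>0: "0 < \<tau>" using \<sigma> \<tau> by simp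
    have r: "0 \<le> r" by (rule norm_le_nonneg[OF f])
    note terms = respond_terms[OF f \<tau>0, folded c_def]
    have "(\<Sum>j. c * r * exp (- \<tau>) ^ Suc j) \<le> (\<Sum>j. c * r * exp (- \<sigma>) ^ Suc j)"
      using \<tau> cd r by (intro suminf_le terms(2) summable_mult geo mult_left_mono power_mono) auto
    also have "\<dots> = c * r * S" unfolding S_def by (rule suminf_mult[OF geo])
    finally have 1: "norm_le \<tau> (\<lambda>n m. \<Sum>j. if \<bar>m\<bar> \<le> 1 then of_real (propagator m j) * f (n + Suc j) m else 0) (c * r * S)"
      using norm_le_suminf(1)[OF terms] norm_le_mono by blast
    have "norm_le \<tau> (\<lambda>n m. f n m - f (n + 1) m) (r + exp (- \<tau> * real 1) * r)"
      by (rule norm_le_diff[OF f norm_le_shift_up[OF f]])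
    moreover have "r + exp (- \<tau> * real 1) * r \<le> 2 * r"
      using \<tau>0 r mult_right_mono[of "exp (- \<tau>)" 1 r] by simp
    ultimately have "norm_le \<tau> (\<lambda>n m. f n m - f (n + 1) m) (2 * r)" by (rule norm_le_mono)
    then have 2: "norm_le \<tau> (\<lambda>n m. if \<bar>m\<bar> \<le> 1 \<or> n = 0 then 0 else
        - (f n m - f (n + 1) m) / of_real (a * delta a \<gamma> m)) (d * (2 * r))"
    proof (rule norm_le_dominated_same[OF _ cd(2)])
      fix n m
      show "cmod (if \<bar>m\<bar> \<le> 1 \<or> n = 0 then 0 else - (f n m - f (n + 1) m) / of_real (a * delta a \<gamma> m))
          \<le> d * cmod (f n m - f (n + 1) m)"
      proof (cases "\<bar>m\<bar> \<le> 1 \<or> n = 0")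
        case False
        then have "0 < delta a \<gamma> m" "delta a \<gamma> 2 \<le> delta a \<gamma> m"
          using delta_mono[of m] delta_2_gt_2 by auto
        then have "1 / (a * delta a \<gamma> m) \<le> d" unfolding d_def
          using a_pos delta_2_gt_2 by (intro frac_le mult_left_mono) auto
        from mult_right_mono[OF this, of "cmod (f n m - f (n + 1) m)"] show ?thesis
          using False a_pos \<open>0 < delta a \<gamma> m\<close>
          by (simp add: norm_divide norm_mult norm_minus_commute)
      qed (use cd in simp)
    qed
    have "respond f = (\<lambda>n m. (\<Sum>j. if \<bar>m\<bar> \<le> 1 then of_real (propagator m j) * f (n + Suc j) m else 0)
      + (if \<bar>m\<bar> \<le> 1 \<or> n = 0 then 0 else - (f n m - f (n + 1) m) / of_real (a * delta a \<gamma> m)))"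
      by (intro ext) (auto simp: respond_def)
    then show "norm_le \<tau> (respond f) ((c * S + 2 * d) * r)"
      using norm_le_add[OF 1 2] by (simp add: algebra_simps)
  qed
qed

lemma respond_diff:
  assumes "norm_le \<tau> f r" "norm_le \<tau> g s" "0 < \<tau>"
  shows "respond f n m - respond g n m = respond (\<lambda>n m. f n m - g n m) n m"
proof (cases "\<bar>m\<bar> \<le> 1")
  case True
  then show ?thesis
    using suminf_diff[OF respond_summable[OF assms(1,3) True] respond_summable[OF assms(2,3) True], of n n]
    by (simp add: respond_def right_diff_distrib)
qed (simp add: respond_def diff_divide_distrib add_divide_distrib)

lemma respond_equation:
  assumes f: "norm_le \<tau> f r" "0 < \<tau>" and m: "\<bar>m\<bar> \<le> 1" and n: "1 \<le> n"
  shows "respond f (n + 1) m + of_real (delta a \<gamma> m) * respond f n m + respond f (n - 1) m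
    = - of_real (1 / a) * (f n m - f (n + 1) m)"
proof -
  define k where "k j = (of_real (propagator m j) :: complex)" for j
  define \<delta> where "\<delta> = (of_real (delta a \<gamma> m) :: complex)"
  note sm = respond_summable[OF f m, folded k_def]
  have s0: "summable (\<lambda>j. k j * f (n + 1 + Suc j) m)" by (rule sm)
  have s1: "summable (\<lambda>j. k (j + 1) * f (n + 1 + Suc j) m)"
    using summable_ignore_initial_segment[OF sm[of n], of 1] by simp
  have s2: "summable (\<lambda>j. k (j + 2) * f (n + 1 + Suc j) m)"
    using summable_ignore_initial_segment[OF sm[of "n - 1"], of 2] n by simp
  have r0: "respond f (n + 1) m = (\<Sum>j. k j * f (n + 1 + Suc j) m)"
    using m by (simp add: respond_def k_def)
  have r1: "respond f n m = k 0 * f (n + 1) m + (\<Sum>j. k (j + 1) * f (n + 1 + Suc j) m)"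
    using m suminf_split_initial_segment[OF sm[of n], of 1] by (simp add: respond_def k_def)
  have r2: "respond f (n - 1) m = k 0 * f n m + k 1 * f (n + 1) m + (\<Sum>j. k (j + 2) * f (n + 1 + Suc j) m)"
    using m n suminf_split_initial_segment[OF sm[of "n - 1"], of 2]
    by (simp add: respond_def k_def numeral_2_eq_2)
  have "respond f (n + 1) m + \<delta> * respond f n m + respond f (n - 1) m
      = k 0 * f n m + (k 1 + \<delta> * k 0) * f (n + 1) m
        + ((\<Sum>j. k (j + 2) * f (n + 1 + Suc j) m) + \<delta> * (\<Sum>j. k (j + 1) * f (n + 1 + Suc j) m)
           + (\<Sum>j. k j * f (n + 1 + Suc j) m))"
    unfolding r0 r1 r2 by (simp add: algebra_simps)
  also have "(\<Sum>j. k (j + 2) * f (n + 1 + Suc j) m) + \<delta> * (\<Sum>j. k (j + 1) * f (n + 1 + Suc j) m)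
           + (\<Sum>j. k j * f (n + 1 + Suc j) m)
      = (\<Sum>j. (k (j + 2) + \<delta> * k (j + 1) + k j) * f (n + 1 + Suc j) m)"
    using s0 s1 s2 by (simp add: distrib_right mult.assoc suminf_add summable_add summable_mult flip: suminf_mult)
  also have "(\<lambda>j. (k (j + 2) + \<delta> * k (j + 1) + k j) * f (n + 1 + Suc j) m) = (\<lambda>j. 0)"
  proof
    fix j
    have "k (j + 2) + \<delta> * k (j + 1) + k j = of_real (propagator m (j + 2) + delta a \<gamma> m * propagator m (j + 1) + propagator m j)"
      by (simp add: k_def \<delta>_def)
    then show "(k (j + 2) + \<delta> * k (j + 1) + k j) * f (n + 1 + Suc j) m = 0"
      unfolding propagator_recursion(3)[OF m] by simp
  qed
  also have "k 1 + \<delta> * k 0 = of_real (1 / a)"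
    unfolding k_def \<delta>_def by (simp only: flip: of_real_mult of_real_add propagator_recursion(2)[OF m])
  also have "k 0 = - of_real (1 / a)" by (simp add: k_def propagator_recursion(1)[OF m])
  finally show ?thesis unfolding \<delta>_def by (simp add: algebra_simps)
qed

lemma hermitian_respond:
  assumes f: "norm_le \<tau> f r" "0 < \<tau>" and h: "\<And>n. hermitian (f n)"
  shows "hermitian (respond f n)"
proof -
  have "respond f n (- m) = cnj (respond f n m)" for m
  proof (cases "\<bar>m\<bar> \<le> 1")
    case True
    have k: "propagator (- m) j = propagator m j" for j by (simp add: propagator_def)
    have "respond f n (- m) = (\<Sum>j. cnj (of_real (propagator m j) * f (n + Suc j) m))"
      using True h by (simp add: respond_def hermitian_def k)
    also have "\<dots> = cnj (respond f n m)"
      using bounded_linear.suminf[OF bounded_linear_cnj respond_summable[OF f True], of n] True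
      by (simp add: respond_def)
    finally show ?thesis .
  next
    case False
    then show ?thesis using h by (simp add: respond_def hermitian_def)
  qed
  then show ?thesis by (simp add: hermitian_def)
qed

end

section \<open>Superposition of a travelling wave and a decaying part\<close>

lemma cmod_cis_multiple_diff_le:
  "cmod (cis (of_int m * x) - cis (of_int m * y)) \<le> \<bar>of_int m\<bar> * cmod (cis x - cis y)"
proof -
  have nat: "cmod (cis (real k * x) - cis (real k * y)) \<le> real k * cmod (cis x - cis y)" for k
  proof (induction k)
    case (Suc k)
    have "cis (real (Suc k) * x) - cis (real (Suc k) * y)
        = cis (real k * x) * (cis x - cis y) + (cis (real k * x) - cis (real k * y)) * cis y"
      by (simp add: algebra_simps cis_mult)
    also have "cmod \<dots> \<le> cmod (cis x - cis y) + real k * cmod (cis x - cis y)"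
      using Suc by (intro order_trans[OF norm_triangle_ineq] add_mono) (simp_all add: norm_mult)
    finally show ?case by (simp add: algebra_simps)
  qed simp
  show ?thesis
  proof (cases m)
    case (nonneg k) then show ?thesis using nat[of k] by simp
  next
    case (neg k)
    have "cis (of_int m * x) - cis (of_int m * y)
        = cnj (cis (real (Suc k) * x) - cis (real (Suc k) * y))"
      by (simp add: neg cis_cnj algebra_simps)
    then show ?thesis using nat[of "Suc k"] neg by (simp del: of_nat_Suc complex_cnj_diff)
  qed
qed

text \<open>The \<open>m\<close>-th harmonic of a complex amplitude, \<open>\<zeta> \<mapsto> \<bar>\<zeta>\<bar> * (\<zeta> / \<bar>\<zeta>\<bar>) ^ m\<close>.\<close>

definition harmonic :: "int \<Rightarrow> complex \<Rightarrow> complex" where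
  "harmonic m \<zeta> = of_real (cmod \<zeta>) * cis (of_int m * Arg \<zeta>)"

lemma cmod_harmonic [simp]: "cmod (harmonic m \<zeta>) = cmod \<zeta>"
  by (simp add: harmonic_def norm_mult)

lemma harmonic_1 [simp]: "harmonic 1 \<zeta> = \<zeta>"
  using rcis_cmod_Arg[of \<zeta>] by (simp add: harmonic_def rcis_def)

lemma harmonic_uminus: "harmonic (- m) \<zeta> = cnj (harmonic m \<zeta>)"
  by (simp add: harmonic_def cis_cnj)

lemma harmonic_lipschitz: "cmod (harmonic m \<zeta> - harmonic m \<eta>) \<le> (2 * \<bar>of_int m\<bar> + 1) * cmod (\<zeta> - \<eta>)"
proof -
  define x y where "x = Arg \<zeta>" and "y = Arg \<eta>"
  have \<zeta>: "\<zeta> = of_real (cmod \<zeta>) * cis x" and \<eta>: "\<eta> = of_real (cmod \<eta>) * cis y"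
    using rcis_cmod_Arg by (simp_all add: rcis_def x_def y_def)
  have radial: "\<bar>cmod \<zeta> - cmod \<eta>\<bar> \<le> cmod (\<zeta> - \<eta>)" by (rule norm_triangle_ineq3)
  have "cmod \<eta> * cmod (cis x - cis y) = cmod (of_real (cmod \<eta>) * (cis x - cis y))"
    by (simp add: norm_mult)
  also have "of_real (cmod \<eta>) * (cis x - cis y) = of_real (cmod \<eta> - cmod \<zeta>) * cis x
      + (of_real (cmod \<zeta>) * cis x - of_real (cmod \<eta>) * cis y)"
    by (simp add: algebra_simps)
  also have "\<dots> = of_real (cmod \<eta> - cmod \<zeta>) * cis x + (\<zeta> - \<eta>)"
    by (simp only: \<zeta>[symmetric] \<eta>[symmetric])
  also have "cmod \<dots> \<le> \<bar>cmod \<eta> - cmod \<zeta>\<bar> + cmod (\<zeta> - \<eta>)"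
    by (rule order_trans[OF norm_triangle_ineq]) (simp add: norm_mult del: of_real_diff)
  also have "\<dots> \<le> 2 * cmod (\<zeta> - \<eta>)" using radial by simp
  finally have angle: "cmod \<eta> * cmod (cis x - cis y) \<le> 2 * cmod (\<zeta> - \<eta>)" .
  have "harmonic m \<zeta> - harmonic m \<eta> = of_real (cmod \<zeta> - cmod \<eta>) * cis (of_int m * x)
      + of_real (cmod \<eta>) * (cis (of_int m * x) - cis (of_int m * y))"
    by (simp add: harmonic_def x_def y_def algebra_simps)
  also have "cmod \<dots> \<le> \<bar>cmod \<zeta> - cmod \<eta>\<bar> + cmod \<eta> * cmod (cis (of_int m * x) - cis (of_int m * y))"
    by (rule order_trans[OF norm_triangle_ineq]) (simp add: norm_mult del: of_real_diff)
  also have "cmod \<eta> * cmod (cis (of_int m * x) - cis (of_int m * y))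
      \<le> cmod \<eta> * (\<bar>of_int m\<bar> * cmod (cis x - cis y))"
    by (intro mult_left_mono cmod_cis_multiple_diff_le) simp
  also have "\<dots> = \<bar>of_int m\<bar> * (cmod \<eta> * cmod (cis x - cis y))" by simp
  also have "\<dots> \<le> \<bar>of_int m\<bar> * (2 * cmod (\<zeta> - \<eta>))" by (intro mult_left_mono angle) simp
  also have "\<bar>cmod \<zeta> - cmod \<eta>\<bar> + \<bar>of_int m\<bar> * (2 * cmod (\<zeta> - \<eta>)) \<le> (2 * \<bar>of_int m\<bar> + 1) * cmod (\<zeta> - \<eta>)"
    using radial by (simp add: algebra_simps)
  finally show ?thesis by simp
qed

text \<open>The bond strains of a chain; the bond \<open>n\<close> joins the sites \<open>n - 1\<close> and \<open>n\<close>.\<close>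

definition strain :: "(nat \<Rightarrow> int \<Rightarrow> complex) \<Rightarrow> nat \<Rightarrow> int \<Rightarrow> complex" where
  "strain f n m = (if 1 \<le> n then f (n - 1) m - f n m else 0)"

lemma strain_diff: "strain f n m - strain g n m = strain (\<lambda>n m. f n m - g n m) n m"
  by (simp add: strain_def)

lemma strain_add: "strain (\<lambda>n m. f n m + g n m) n m = strain f n m + strain g n m"
  by (simp add: strain_def)

lemma hermitian_strain: "(\<And>n. hermitian (f n)) \<Longrightarrow> hermitian (strain f n)"
  by (simp add: hermitian_def strain_def)

lemma (in weighted) norm_le_strain:
  assumes "norm_le \<tau> f r"
  shows "norm_le \<tau> (strain f) ((exp \<tau> + 1) * r)"
proof -
  have "norm_le \<tau> (\<lambda>n m. if 1 \<le> n then f n m else 0) (1 * r)"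
    by (rule norm_le_dominated_same[OF assms]) auto
  from norm_le_diff[OF norm_le_shift_down[OF assms] this]
  have "norm_le \<tau> (\<lambda>n m. (if 1 \<le> n then f (n - 1) m else 0) - (if 1 \<le> n then f n m else 0))
      ((exp \<tau> + 1) * r)" by (simp add: distrib_right)
  also have "(\<lambda>n m. (if 1 \<le> n then f (n - 1) m else 0) - (if 1 \<le> n then f n m else 0)) = strain f"
    by (auto simp: strain_def intro!: ext)
  finally show ?thesis .
qed

lemma (in weighted) norm_le_boundary:
  assumes "norm_le 0 (\<lambda>_. f) r"
  shows "norm_le \<tau> (\<lambda>n m. if n = 0 then f m else 0) r"
proof -
  obtain M where M: "\<And>n m. exp (0 * real n) * cmod (f m) \<le> M m" "\<And>m. 0 \<le> M m"
    "\<And>A. finite A \<Longrightarrow> (\<Sum>m\<in>A. w m * M m) \<le> r" by (rule norm_leE[OF assms]) blast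
  show ?thesis by (rule norm_leI[where M = M]) (use M in auto)
qed

context waves
begin

definition wave :: "complex \<Rightarrow> nat \<Rightarrow> int \<Rightarrow> complex" where
  "wave \<zeta> n m = p (cmod \<zeta>) m * harmonic m \<zeta> * cis (of_int m * (\<kappa> (cmod \<zeta>) * real n))"

lemma wave_bound:
  assumes "cmod \<zeta> \<le> t0"
  shows "norm_le 0 (wave \<zeta>) (cmod \<zeta> * Cw)"
proof (rule norm_le_dominated_same[OF p_deriv[OF norm_ge_zero assms]])
  show "cmod (wave \<zeta> n m) \<le> cmod \<zeta> * cmod (of_int m * p (cmod \<zeta>) m)" for n m
  proof (cases "m = 0")
    case True then show ?thesis by (simp add: wave_def p_0 assms)
  next
    case False
    then have "1 \<le> \<bar>real_of_int m\<bar>" by linarith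
    from mult_right_mono[OF this, of "cmod (p (cmod \<zeta>) m) * cmod \<zeta>"]
    show ?thesis by (simp add: wave_def norm_mult mult_ac)
  qed
qed simp

lemma hermitian_wave:
  assumes "cmod \<zeta> \<le> t0"
  shows "hermitian (wave \<zeta> n)"
  using p_hermitian[OF norm_ge_zero assms]
  by (simp add: hermitian_def wave_def harmonic_uminus cis_cnj)

text \<open>Since the wave number depends on the amplitude, two waves drift apart linearly in \<open>n\<close>;
  their difference is therefore measured with a weight that decays in \<open>n\<close>.\<close>

lemma wave_lipschitz:
  assumes \<tau>: "0 < \<tau>"
  obtains C where "0 \<le> C" "\<And>\<zeta> \<eta>. cmod \<zeta> \<le> t0 \<Longrightarrow> cmod \<eta> \<le> t0 \<Longrightarrow>
    norm_le (- \<tau>) (\<lambda>n m. wave \<zeta> n m - wave \<eta> n m) (C * cmod (\<zeta> - \<eta>))"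
proof (rule that[of "(3 + t0 * Cw / \<tau>) * Cw + t0 * Cw"])
  show "0 \<le> (3 + t0 * Cw / \<tau>) * Cw + t0 * Cw" using \<tau> t0_pos Cw_nonneg by simp
  fix \<zeta> \<eta> assume \<zeta>: "cmod \<zeta> \<le> t0" and \<eta>: "cmod \<eta> \<le> t0"
  define d where "d = cmod (\<zeta> - \<eta>)"
  have d: "0 \<le> d" by (simp add: d_def)
  have radial: "\<bar>cmod \<zeta> - cmod \<eta>\<bar> \<le> d" unfolding d_def by (rule norm_triangle_ineq3)
  note \<rho> = norm_ge_zero[of \<zeta>] \<zeta> norm_ge_zero[of \<eta>] \<eta>
  have \<kappa>: "\<bar>\<kappa> (cmod \<zeta>) - \<kappa> (cmod \<eta>)\<bar> \<le> Cw * d"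
    using \<kappa>_lipschitz[OF \<rho>] mult_left_mono[OF radial Cw_nonneg] by linarith
  define c where "c \<xi> n m = cis (of_int m * (\<kappa> (cmod \<xi>) * real n))" for \<xi> and n :: nat and m :: int
  have A: "norm_le (- \<tau>) (\<lambda>n m. p (cmod \<zeta>) m * (harmonic m \<zeta> * c \<zeta> n m - harmonic m \<eta> * c \<eta> n m))
      ((3 + t0 * Cw / \<tau>) * d * Cw)"
  proof (rule norm_le_dominated[OF p_deriv[OF \<rho>(1,2)]])
    show "0 \<le> (3 + t0 * Cw / \<tau>) * d" using \<tau> t0_pos Cw_nonneg d by simp
    fix n m
    show "exp (- \<tau> * real n) * cmod (p (cmod \<zeta>) m * (harmonic m \<zeta> * c \<zeta> n m - harmonic m \<eta> * c \<eta> n m))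
        \<le> (3 + t0 * Cw / \<tau>) * d * (exp (0 * real n) * cmod (of_int m * p (cmod \<zeta>) m))"
    proof (cases "m = 0")
      case True then show ?thesis by (simp add: p_0 \<zeta>)
    next
      case False
      define M where "M = \<bar>real_of_int m\<bar>"
      have M: "1 \<le> M" using False unfolding M_def by linarith
      have "harmonic m \<zeta> * c \<zeta> n m - harmonic m \<eta> * c \<eta> n m
          = (harmonic m \<zeta> - harmonic m \<eta>) * c \<zeta> n m + harmonic m \<eta> * (c \<zeta> n m - c \<eta> n m)"
        by (simp add: algebra_simps)
      also have "cmod \<dots> \<le> cmod (harmonic m \<zeta> - harmonic m \<eta>) + cmod \<eta> * cmod (c \<zeta> n m - c \<eta> n m)"
        by (rule order_trans[OF norm_triangle_ineq]) (simp add: norm_mult c_def)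
      also have "\<dots> \<le> 3 * M * d + t0 * (M * (Cw * d * real n))"
      proof (intro add_mono mult_mono)
        have "cmod (harmonic m \<zeta> - harmonic m \<eta>) \<le> (2 * M + 1) * d"
          unfolding M_def d_def by (rule harmonic_lipschitz)
        also have "\<dots> \<le> (3 * M) * d" by (rule mult_right_mono) (use M d in auto)
        finally show "cmod (harmonic m \<zeta> - harmonic m \<eta>) \<le> 3 * M * d" .
        have "cmod (c \<zeta> n m - c \<eta> n m)
            \<le> \<bar>of_int m * (\<kappa> (cmod \<zeta>) * real n) - of_int m * (\<kappa> (cmod \<eta>) * real n)\<bar>"
          unfolding c_def by (rule abs_cis_diff_le)
        also have "\<dots> = M * (\<bar>\<kappa> (cmod \<zeta>) - \<kappa> (cmod \<eta>)\<bar> * real n)"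
          by (simp add: M_def abs_mult flip: right_diff_distrib left_diff_distrib)
        also have "\<dots> \<le> M * (Cw * d * real n)"
          using M by (intro mult_left_mono mult_right_mono \<kappa>) auto
        finally show "cmod (c \<zeta> n m - c \<eta> n m) \<le> M * (Cw * d * real n)" .
      qed (use \<eta> t0_pos in auto)
      also have "\<dots> = (3 + t0 * Cw * real n) * d * M" by (simp add: algebra_simps)
      finally have main: "cmod (harmonic m \<zeta> * c \<zeta> n m - harmonic m \<eta> * c \<eta> n m)
          \<le> (3 + t0 * Cw * real n) * d * M" .
      have decay: "exp (- \<tau> * real n) * (3 + t0 * Cw * real n) \<le> 3 + t0 * Cw / \<tau>"
      proof -
        have "\<tau> * real n \<le> exp (\<tau> * real n)" using exp_ge_add_one_self[of "\<tau> * real n"] by linarith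
        then have "exp (- \<tau> * real n) * real n \<le> 1 / \<tau>" using \<tau> by (simp add: exp_minus field_simps)
        then have "t0 * Cw * (exp (- \<tau> * real n) * real n) \<le> t0 * Cw * (1 / \<tau>)"
          using t0_pos Cw_nonneg by (intro mult_left_mono) auto
        moreover have "t0 * Cw * (1 / \<tau>) = t0 * Cw / \<tau>" by simp
        moreover have "exp (- \<tau> * real n) \<le> 1" using \<tau> by simp
        moreover have "exp (- \<tau> * real n) * (3 + t0 * Cw * real n)
            = 3 * exp (- \<tau> * real n) + t0 * Cw * (exp (- \<tau> * real n) * real n)"
          by (simp only: distrib_left mult_ac)
        ultimately show ?thesis by linarith
      qed
      have "exp (- \<tau> * real n) * cmod (harmonic m \<zeta> * c \<zeta> n m - harmonic m \<eta> * c \<eta> n m)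
          \<le> exp (- \<tau> * real n) * ((3 + t0 * Cw * real n) * d * M)"
        by (rule mult_left_mono[OF main]) simp
      also have "\<dots> = exp (- \<tau> * real n) * (3 + t0 * Cw * real n) * (d * M)" by simp
      also have "\<dots> \<le> (3 + t0 * Cw / \<tau>) * (d * M)"
        by (rule mult_right_mono[OF decay]) (use M d in simp)
      finally have "cmod (p (cmod \<zeta>) m) * (exp (- \<tau> * real n) *
          cmod (harmonic m \<zeta> * c \<zeta> n m - harmonic m \<eta> * c \<eta> n m))
          \<le> cmod (p (cmod \<zeta>) m) * ((3 + t0 * Cw / \<tau>) * (d * M))"
        by (rule mult_left_mono) simp
      then show ?thesis by (simp add: norm_mult M_def mult_ac)
    qed
  qed
  have B: "norm_le (- \<tau>) (\<lambda>n m. (p (cmod \<zeta>) m - p (cmod \<eta>) m) * (harmonic m \<eta> * c \<eta> n m))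
      (t0 * (Cw * \<bar>cmod \<zeta> - cmod \<eta>\<bar>))"
  proof (rule norm_le_weaken[OF norm_le_dominated_same[OF p_lipschitz[OF \<rho>]]])
    show "cmod ((p (cmod \<zeta>) m - p (cmod \<eta>) m) * (harmonic m \<eta> * c \<eta> n m))
        \<le> t0 * cmod (p (cmod \<zeta>) m - p (cmod \<eta>) m)" for n m
      using mult_left_mono[OF \<eta>, of "cmod (p (cmod \<zeta>) m - p (cmod \<eta>) m)"]
      by (simp add: norm_mult c_def mult.commute)
  qed (use \<tau> t0_pos in auto)
  have "norm_le (- \<tau>) (\<lambda>n m. wave \<zeta> n m - wave \<eta> n m)
      ((3 + t0 * Cw / \<tau>) * d * Cw + t0 * (Cw * \<bar>cmod \<zeta> - cmod \<eta>\<bar>))"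
    using norm_le_add[OF A B] by (simp add: wave_def c_def algebra_simps)
  then show "norm_le (- \<tau>) (\<lambda>n m. wave \<zeta> n m - wave \<eta> n m)
      (((3 + t0 * Cw / \<tau>) * Cw + t0 * Cw) * cmod (\<zeta> - \<eta>))"
  proof (rule norm_le_mono)
    have "t0 * (Cw * \<bar>cmod \<zeta> - cmod \<eta>\<bar>) \<le> t0 * (Cw * d)"
      using t0_pos Cw_nonneg radial by (intro mult_left_mono) auto
    then show "(3 + t0 * Cw / \<tau>) * d * Cw + t0 * (Cw * \<bar>cmod \<zeta> - cmod \<eta>\<bar>)
        \<le> ((3 + t0 * Cw / \<tau>) * Cw + t0 * Cw) * cmod (\<zeta> - \<eta>)"
      by (simp add: algebra_simps flip: d_def)
  qed
qed

lemma wave_at_0: "wave \<zeta> 0 m = p (cmod \<zeta>) m * harmonic m \<zeta>"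
  by (simp add: wave_def)

lemma wave_boundary_bound:
  assumes "cmod \<zeta> \<le> t0"
  shows "norm_le 0 (\<lambda>_ m. evanescent (wave \<zeta> 0) m) (cmod \<zeta> * (Cw * cmod \<zeta>))"
proof (rule norm_le_dominated_same[OF p_high[OF norm_ge_zero assms]])
  show "cmod (evanescent (wave \<zeta> 0) m)
      \<le> cmod \<zeta> * cmod (evanescent (\<lambda>m. of_int m * p (cmod \<zeta>) m) m)" for m
  proof (cases "2 \<le> \<bar>m\<bar>")
    case True
    then have "1 \<le> \<bar>real_of_int m\<bar>" by linarith
    from mult_right_mono[OF this, of "cmod (p (cmod \<zeta>) m) * cmod \<zeta>"] True
    show ?thesis by (simp add: evanescent_def wave_at_0 norm_mult mult_ac)
  qed (simp add: evanescent_def)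
qed simp

lemma wave_boundary_lipschitz:
  assumes \<zeta>: "cmod \<zeta> \<le> R" and \<eta>: "cmod \<eta> \<le> R" and R: "R \<le> t0"
  shows "norm_le 0 (\<lambda>_ m. evanescent (wave \<zeta> 0) m - evanescent (wave \<eta> 0) m)
    (4 * Cw * R * cmod (\<zeta> - \<eta>))"
proof -
  have \<zeta>t: "cmod \<zeta> \<le> t0" and \<eta>t: "cmod \<eta> \<le> t0" using assms by auto
  note \<rho> = norm_ge_zero[of \<zeta>] \<zeta>t norm_ge_zero[of \<eta>] \<eta>t
  define d where "d = cmod (\<zeta> - \<eta>)"
  have d: "0 \<le> d" by (simp add: d_def)
  have radial: "\<bar>cmod \<zeta> - cmod \<eta>\<bar> \<le> d" unfolding d_def by (rule norm_triangle_ineq3)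
  have R0: "0 \<le> R" by (rule order_trans[OF norm_ge_zero \<zeta>])
  have "norm_le 0 (\<lambda>_ m. evanescent (wave \<zeta> 0) m - evanescent (wave \<eta> 0) m)
    (3 * d * (Cw * cmod \<zeta>) + R * (Cw * \<bar>cmod \<zeta> - cmod \<eta>\<bar>))"
  proof (rule norm_le_dominated2[OF p_high[OF \<rho>(1,2)] p_lipschitz[OF \<rho>]])
    fix n :: nat and m
    show "cmod (evanescent (wave \<zeta> 0) m - evanescent (wave \<eta> 0) m)
       \<le> 3 * d * cmod (evanescent (\<lambda>m. of_int m * p (cmod \<zeta>) m) m)
         + R * cmod (p (cmod \<zeta>) m - p (cmod \<eta>) m)"
    proof (cases "2 \<le> \<bar>m\<bar>")
      case True
      define M where "M = \<bar>real_of_int m\<bar>"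
      have M: "1 \<le> M" using True unfolding M_def by linarith
      have "cmod (harmonic m \<zeta> - harmonic m \<eta>) \<le> (2 * M + 1) * d"
        unfolding M_def d_def by (rule harmonic_lipschitz)
      also have "\<dots> \<le> (3 * M) * d" by (rule mult_right_mono) (use M d in auto)
      finally have h: "cmod (harmonic m \<zeta> - harmonic m \<eta>) \<le> 3 * M * d" .
      have "wave \<zeta> 0 m - wave \<eta> 0 m = p (cmod \<zeta>) m * (harmonic m \<zeta> - harmonic m \<eta>)
          + (p (cmod \<zeta>) m - p (cmod \<eta>) m) * harmonic m \<eta>"
        by (simp add: wave_at_0 algebra_simps)
      also have "cmod \<dots> \<le> cmod (p (cmod \<zeta>) m) * cmod (harmonic m \<zeta> - harmonic m \<eta>)
          + cmod (p (cmod \<zeta>) m - p (cmod \<eta>) m) * cmod \<eta>"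
        by (rule order_trans[OF norm_triangle_ineq]) (simp add: norm_mult)
      also have "\<dots> \<le> cmod (p (cmod \<zeta>) m) * (3 * M * d) + cmod (p (cmod \<zeta>) m - p (cmod \<eta>) m) * R"
        by (intro add_mono mult_left_mono h \<eta>) auto
      finally show ?thesis using True by (simp add: evanescent_def norm_mult M_def mult_ac)
    qed (use R0 in \<open>simp add: evanescent_def\<close>)
  qed (use d R0 in auto)
  then show ?thesis
  proof (rule norm_le_mono)
    have "3 * d * (Cw * cmod \<zeta>) \<le> 3 * d * (Cw * R)"
      using d Cw_nonneg \<zeta> by (intro mult_left_mono) auto
    moreover have "R * (Cw * \<bar>cmod \<zeta> - cmod \<eta>\<bar>) \<le> R * (Cw * d)"
      using R0 Cw_nonneg radial by (intro mult_left_mono) auto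
    ultimately show "3 * d * (Cw * cmod \<zeta>) + R * (Cw * \<bar>cmod \<zeta> - cmod \<eta>\<bar>) \<le> 4 * Cw * R * cmod (\<zeta> - \<eta>)"
      by (simp add: algebra_simps flip: d_def)
  qed
qed

text \<open>The strain amplitude \<open>\<zeta>\<close> of the wave whose displacement at the boundary has a given
  first harmonic \<open>\<xi>\<close>.\<close>

lemma amplitude_exists:
  obtains x0 Z where "0 < x0" "2 * x0 \<le> t0"
    "\<And>\<xi>. cmod \<xi> \<le> x0 \<Longrightarrow> cmod (Z \<xi>) \<le> 2 * cmod \<xi>"
    "\<And>\<xi>. cmod \<xi> \<le> x0 \<Longrightarrow> wave (Z \<xi>) 0 1 = \<xi>"
    "\<And>\<xi> \<xi>'. cmod \<xi> \<le> x0 \<Longrightarrow> cmod \<xi>' \<le> x0 \<Longrightarrow> cmod (Z \<xi> - Z \<xi>') \<le> 4 * cmod (\<xi> - \<xi>')"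
proof -
  define x0 where "x0 = min (t0 / 2) ((1 / 2) / (Cw + 1))"
  have x0: "0 < x0" "2 * x0 \<le> t0" using t0_pos Cw_nonneg by (auto simp: x0_def)
  have Cx0: "Cw * x0 \<le> 1 / 2" using mult_small[OF Cw_nonneg, of x0 "1 / 2"] x0 by (simp add: x0_def)
  define S where "S \<zeta> = 2 * sin (\<kappa> (cmod \<zeta>) / 2)" for \<zeta>
  have S2: "\<bar>S \<zeta>\<bar> \<le> 2" for \<zeta> by (simp add: S_def abs_mult)
  have S_lip: "\<bar>S \<zeta> - S \<eta>\<bar> \<le> Cw * cmod (\<zeta> - \<eta>)" if "cmod \<zeta> \<le> t0" "cmod \<eta> \<le> t0" for \<zeta> \<eta>
  proof -
    have "\<bar>S \<zeta> - S \<eta>\<bar> = 2 * \<bar>sin (\<kappa> (cmod \<zeta>) / 2) - sin (\<kappa> (cmod \<eta>) / 2)\<bar>"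
      unfolding S_def by (simp only: abs_mult abs_numeral flip: right_diff_distrib)
    also have "\<dots> \<le> 2 * \<bar>\<kappa> (cmod \<zeta>) / 2 - \<kappa> (cmod \<eta>) / 2\<bar>"
      by (intro mult_left_mono abs_sin_diff_le) simp
    also have "\<dots> = \<bar>\<kappa> (cmod \<zeta>) - \<kappa> (cmod \<eta>)\<bar>" by (simp flip: diff_divide_distrib)
    also have "\<dots> \<le> Cw * \<bar>cmod \<zeta> - cmod \<eta>\<bar>" by (rule \<kappa>_lipschitz) (use that in auto)
    also have "\<dots> \<le> Cw * cmod (\<zeta> - \<eta>)" by (intro mult_left_mono norm_triangle_ineq3 Cw_nonneg)
    finally show ?thesis .
  qed
  have "\<exists>\<zeta>. cmod \<zeta> \<le> 2 * cmod \<xi> \<and> \<zeta> = - \<i> * of_real (S \<zeta>) * \<xi>" if \<xi>: "cmod \<xi> \<le> x0" for \<xi>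
  proof -
    have "\<exists>!\<zeta>\<in>cball 0 (2 * cmod \<xi>). - \<i> * of_real (S \<zeta>) * \<xi> = \<zeta>"
    proof (rule Banach_fix[where c = "1 / 2"])
      show "(\<lambda>\<zeta>. - \<i> * of_real (S \<zeta>) * \<xi>) ` cball 0 (2 * cmod \<xi>) \<subseteq> cball 0 (2 * cmod \<xi>)"
        using mult_right_mono[OF S2 norm_ge_zero[of \<xi>]] by (auto simp: norm_mult)
      show "dist (- \<i> * of_real (S \<zeta>) * \<xi>) (- \<i> * of_real (S \<eta>) * \<xi>) \<le> 1 / 2 * dist \<zeta> \<eta>"
        if "\<zeta> \<in> cball 0 (2 * cmod \<xi>)" "\<eta> \<in> cball 0 (2 * cmod \<xi>)" for \<zeta> \<eta>
      proof -
        have "- \<i> * of_real (S \<zeta>) * \<xi> - (- \<i> * of_real (S \<eta>) * \<xi>) = - \<i> * of_real (S \<zeta> - S \<eta>) * \<xi>"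
          by (simp add: algebra_simps)
        then have "dist (- \<i> * of_real (S \<zeta>) * \<xi>) (- \<i> * of_real (S \<eta>) * \<xi>) = \<bar>S \<zeta> - S \<eta>\<bar> * cmod \<xi>"
          unfolding dist_norm by (simp only: norm_mult norm_minus_cancel norm_ii norm_of_real mult_1)
        also have "\<dots> \<le> Cw * cmod (\<zeta> - \<eta>) * x0"
          using that \<xi> x0 by (intro mult_mono S_lip) (auto simp: Cw_nonneg)
        also have "\<dots> \<le> 1 / 2 * cmod (\<zeta> - \<eta>)"
          using mult_right_mono[OF Cx0 norm_ge_zero[of "\<zeta> - \<eta>"]] by (simp add: mult_ac)
        finally show ?thesis by (simp add: dist_norm)
      qed
    qed (auto simp: complete_eq_closed)
    then obtain \<zeta> where "\<zeta> \<in> cball 0 (2 * cmod \<xi>)" "- \<i> * of_real (S \<zeta>) * \<xi> = \<zeta>" by blast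
    then show ?thesis by (intro exI[of _ \<zeta>]) auto
  qed
  then obtain Z where Z: "\<And>\<xi>. cmod \<xi> \<le> x0 \<Longrightarrow> cmod (Z \<xi>) \<le> 2 * cmod \<xi>"
    "\<And>\<xi>. cmod \<xi> \<le> x0 \<Longrightarrow> Z \<xi> = - \<i> * of_real (S (Z \<xi>)) * \<xi>" by metis
  have Zt: "cmod (Z \<xi>) \<le> t0" if "cmod \<xi> \<le> x0" for \<xi> using Z(1)[OF that] that x0 by linarith
  show ?thesis
  proof (rule that[of x0 Z])
    show "wave (Z \<xi>) 0 1 = \<xi>" if \<xi>: "cmod \<xi> \<le> x0" for \<xi>
    proof -
      have "wave (Z \<xi>) 0 1 = p (cmod (Z \<xi>)) 1 * Z \<xi>" by (simp add: wave_at_0)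
      also have "\<dots> = p (cmod (Z \<xi>)) 1 * (- \<i> * of_real (S (Z \<xi>)) * \<xi>)" using Z(2)[OF \<xi>] by simp
      also have "\<dots> = - \<i> * (2 * of_real (sin (\<kappa> (cmod (Z \<xi>)) / 2)) * p (cmod (Z \<xi>)) 1) * \<xi>"
        by (simp add: S_def)
      also have "\<dots> = \<xi>" unfolding p_1[OF norm_ge_zero Zt[OF \<xi>]] by simp
      finally show ?thesis .
    qed
    show "cmod (Z \<xi> - Z \<xi>') \<le> 4 * cmod (\<xi> - \<xi>')" if \<xi>: "cmod \<xi> \<le> x0" and \<xi>': "cmod \<xi>' \<le> x0" for \<xi> \<xi>'
    proof -
      have "Z \<xi> - Z \<xi>' = - \<i> * of_real (S (Z \<xi>)) * \<xi> - (- \<i> * of_real (S (Z \<xi>')) * \<xi>')"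
        using Z(2)[OF \<xi>] Z(2)[OF \<xi>'] by simp
      also have "\<dots> = - \<i> * (of_real (S (Z \<xi>)) * (\<xi> - \<xi>') + of_real (S (Z \<xi>) - S (Z \<xi>')) * \<xi>')"
        by (simp add: algebra_simps)
      also have "cmod \<dots> = cmod (of_real (S (Z \<xi>)) * (\<xi> - \<xi>') + of_real (S (Z \<xi>) - S (Z \<xi>')) * \<xi>')"
        by (simp only: norm_mult norm_minus_cancel norm_ii mult_1)
      also have "\<dots> \<le> \<bar>S (Z \<xi>)\<bar> * cmod (\<xi> - \<xi>') + \<bar>S (Z \<xi>) - S (Z \<xi>')\<bar> * cmod \<xi>'"
        by (rule order_trans[OF norm_triangle_ineq]) (simp add: norm_mult del: of_real_diff)
      also have "\<dots> \<le> 2 * cmod (\<xi> - \<xi>') + Cw * cmod (Z \<xi> - Z \<xi>') * x0"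
        using S2 S_lip[OF Zt[OF \<xi>] Zt[OF \<xi>']] \<xi>'
        by (intro add_mono mult_mono) (auto simp: Cw_nonneg)
      also have "\<dots> \<le> 2 * cmod (\<xi> - \<xi>') + 1 / 2 * cmod (Z \<xi> - Z \<xi>')"
        using mult_right_mono[OF Cx0 norm_ge_zero[of "Z \<xi> - Z \<xi>'"]] by (simp add: mult_ac)
      finally show ?thesis by simp
    qed
  qed (use x0 Z in auto)
qed

text \<open>Staggering the strain by half a site makes both sides of the wave equation
  multiples of \<open>sin (m * \<kappa> / 2)\<close>, as in the equation for the profile.\<close>

lemma wave_equation:
  assumes \<zeta>: "cmod \<zeta> \<le> t0" and s: "norm_le 0 (strain (wave \<zeta>)) s" "s \<le> s1" and n: "1 \<le> n"
  shows "wave \<zeta> (n + 1) m + of_real (delta a \<gamma> m) * wave \<zeta> n m + wave \<zeta> (n - 1) m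
    = - of_real (1 / a) * (conv_series cf (strain (wave \<zeta>) n) m - conv_series cf (strain (wave \<zeta>) (n + 1)) m)"
proof -
  define \<rho> where "\<rho> = cmod \<zeta>"
  define k where "k = \<kappa> \<rho>"
  define \<psi> where "\<psi> = Arg \<zeta>"
  have \<rho>: "0 \<le> \<rho>" "\<rho> \<le> t0" using \<zeta> by (auto simp: \<rho>_def)
  define A where "A m = of_real \<rho> * (- 2 * \<i> * of_real (sin (of_int m * k / 2)) * p \<rho> m)" for m :: int
  define c where "c x = cis (of_int m * (\<psi> + k * x))" for x :: real
  have wave: "wave \<zeta> j m = of_real \<rho> * p \<rho> m * cis (of_int m * (\<psi> + k * real j))" for j m
    by (simp add: wave_def harmonic_def \<rho>_def k_def \<psi>_def mult_ac distrib_left flip: cis_mult)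
  have strain: "strain (wave \<zeta>) j = (\<lambda>m. A m * cis (of_int m * (\<psi> + k * (real j - 1 / 2))))"
    if "1 \<le> j" for j
  proof
    fix m
    have "cis (of_int m * (\<psi> + k * real (j - 1))) - cis (of_int m * (\<psi> + k * real j))
        = - 2 * \<i> * of_real (sin (of_int m * k / 2)) * cis (of_int m * (\<psi> + k * (real j - 1 / 2)))"
    proof -
      define x y where "x = of_int m * (\<psi> + k * (real j - 1 / 2))" and "y = of_int m * k / 2"
      have "of_int m * (\<psi> + k * real (j - 1)) = x - y" "of_int m * (\<psi> + k * real j) = x + y"
        using that by (simp_all add: x_def y_def algebra_simps of_nat_diff)
      then show ?thesis unfolding x_def[symmetric] y_def[symmetric]
        by (simp add: complex_eq_iff cos_add cos_diff sin_add sin_diff)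
    qed
    then show "strain (wave \<zeta>) j m = A m * cis (of_int m * (\<psi> + k * (real j - 1 / 2)))"
      using that by (simp add: strain_def wave A_def right_diff_distrib[symmetric])
  qed
  have force: "conv_series cf (strain (wave \<zeta>) j) m
      = conv_series cf A m * cis (of_int m * (\<psi> + k * (real j - 1 / 2)))" if j: "1 \<le> j" for j
  proof -
    have "summable (\<lambda>i. of_real (cf i) * conv_pow i (strain (wave \<zeta>) j) m)"
      by (rule force_summable[OF s])
    then have sm: "summable (\<lambda>i. of_real (cf i) * conv_pow i A m * cis (of_int m * (\<psi> + k * (real j - 1 / 2))))"
      unfolding strain[OF j] conv_pow_modulate by (simp add: mult.assoc)
    have "summable (\<lambda>i. of_real (cf i) * conv_pow i A m)"
      using summable_mult2[OF sm, of "inverse (cis (of_int m * (\<psi> + k * (real j - 1 / 2))))"]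
      by (simp add: mult.assoc cis_mult)
    then show ?thesis unfolding strain[OF j] by (rule conv_series_modulate)
  qed
  define C where "C = cis (of_int m * (\<psi> + k * real n))"
  define S where "S = (of_real (sin (of_int m * k / 2)) :: complex)"
  define G where "G = conv_series cf A m"
  have E: "of_real ((of_int m * \<gamma>)\<^sup>2) * (of_real \<rho> * p \<rho> m) = 2 * \<i> * S * (of_real a * A m + G)"
    using p_equation[OF \<rho>, of m] unfolding G_def A_def[abs_def] S_def k_def .
  have up: "cis (of_int m * (\<psi> + k * real (n + 1))) + cis (of_int m * (\<psi> + k * real (n - 1)))
      = (2 - 4 * S\<^sup>2) * C"
  proof -
    define x y where "x = of_int m * (\<psi> + k * real n)" and "y = of_int m * k / 2"
    have xy: "of_int m * (\<psi> + k * real (n + 1)) = x + 2 * y" "of_int m * (\<psi> + k * real (n - 1)) = x - 2 * y"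
      using n by (simp_all add: x_def y_def algebra_simps of_nat_diff)
    have "cis (x + 2 * y) + cis (x - 2 * y) = of_real (2 * cos (2 * y)) * cis x"
      by (simp add: complex_eq_iff cos_add cos_diff sin_add sin_diff)
    also have "2 * cos (2 * y) = 2 - 4 * (sin y)\<^sup>2" by (simp add: cos_double_sin)
    finally show ?thesis unfolding xy C_def x_def[symmetric] S_def y_def[symmetric] by simp
  qed
  have half: "cis (of_int m * (\<psi> + k * (real n - 1 / 2))) - cis (of_int m * (\<psi> + k * (real (n + 1) - 1 / 2)))
      = - 2 * \<i> * S * C"
  proof -
    define x y where "x = of_int m * (\<psi> + k * real n)" and "y = of_int m * k / 2"
    have xy: "of_int m * (\<psi> + k * (real n - 1 / 2)) = x - y"
      "of_int m * (\<psi> + k * (real (n + 1) - 1 / 2)) = x + y"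
      by (simp_all add: x_def y_def algebra_simps)
    show ?thesis unfolding xy C_def x_def[symmetric] S_def y_def[symmetric]
      by (simp add: complex_eq_iff cos_add cos_diff sin_add sin_diff)
  qed
  have a0: "of_real a \<noteq> (0::complex)" using a_pos by simp
  have "wave \<zeta> (n + 1) m + of_real (delta a \<gamma> m) * wave \<zeta> n m + wave \<zeta> (n - 1) m
      = of_real \<rho> * p \<rho> m * (cis (of_int m * (\<psi> + k * real (n + 1)))
          + cis (of_int m * (\<psi> + k * real (n - 1))) + of_real (delta a \<gamma> m) * C)"
    unfolding wave C_def by (simp only: algebra_simps)
  also have "\<dots> = (of_real ((of_int m * \<gamma>)\<^sup>2) * (of_real \<rho> * p \<rho> m) / of_real a - 4 * S\<^sup>2 * (of_real \<rho> * p \<rho> m)) * C"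
    unfolding up by (simp add: delta_def algebra_simps)
  also have "\<dots> = (2 * \<i> * S * A m - 4 * S\<^sup>2 * (of_real \<rho> * p \<rho> m) + 2 * \<i> * S * G / of_real a) * C"
    unfolding E using a0 by (simp add: field_simps)
  also have "2 * \<i> * S * A m - 4 * S\<^sup>2 * (of_real \<rho> * p \<rho> m) = 0"
    by (simp add: A_def S_def power2_eq_square)
  also have "(0 + 2 * \<i> * S * G / of_real a) * C = - of_real (1 / a) * (G * (- 2 * \<i> * S * C))"
    using a0 by (simp add: field_simps)
  also have "\<dots> = - of_real (1 / a) * (conv_series cf (strain (wave \<zeta>) n) m
      - conv_series cf (strain (wave \<zeta>) (n + 1)) m)"
    unfolding half[symmetric] using force[OF n] force[of "n + 1"] by (simp add: G_def right_diff_distrib)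
  finally show ?thesis .
qed

end

locale driven_chain = waves +
  fixes \<sigma> :: real and b :: "int \<Rightarrow> complex"
  assumes \<sigma>_pos: "0 < \<sigma>" and \<sigma>_small: "exp \<sigma> + exp (- \<sigma>) < delta a \<gamma> 2"
    and b_hermitian: "hermitian b" and b_norm: "norm_le 0 (\<lambda>_. b) 1"
begin

text \<open>The nonlinear force on the decaying part \<open>v\<close> is the difference of the forces with and
  without \<open>v\<close>; it decays as fast as \<open>v\<close> although the wave does not decay.\<close>

definition excess_force :: "complex \<Rightarrow> (nat \<Rightarrow> int \<Rightarrow> complex) \<Rightarrow> nat \<Rightarrow> int \<Rightarrow> complex" where
  "excess_force \<zeta> v n m = conv_series cf (\<lambda>m. strain (wave \<zeta>) n m + strain v n m) m
     - conv_series cf (strain (wave \<zeta>) n) m"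

definition boundary :: "real \<Rightarrow> complex \<Rightarrow> nat \<Rightarrow> int \<Rightarrow> complex" where
  "boundary \<epsilon> \<zeta> n m = (if n = 0 \<and> 2 \<le> \<bar>m\<bar> then of_real \<epsilon> * b m - wave \<zeta> 0 m else 0)"

definition decay_map :: "real \<Rightarrow> complex \<Rightarrow> (nat \<Rightarrow> int \<Rightarrow> complex) \<Rightarrow> nat \<Rightarrow> int \<Rightarrow> complex" where
  "decay_map \<epsilon> \<zeta> v n m = boundary \<epsilon> \<zeta> n m + neighbours v n m + respond (excess_force \<zeta> v) n m"

lemma boundary_bound:
  assumes "cmod \<zeta> \<le> R" "R \<le> t0"
  shows "norm_le \<tau> (boundary \<epsilon> \<zeta>) (\<bar>\<epsilon>\<bar> + Cw * R * R)"
proof -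
  have "norm_le 0 (\<lambda>_ m. evanescent (\<lambda>m. of_real \<epsilon> * b m) m) (\<bar>\<epsilon>\<bar> * 1)"
    by (rule norm_le_dominated_same[OF b_norm]) (auto simp: evanescent_def norm_mult)
  from norm_le_diff[OF this wave_boundary_bound[of \<zeta>]] assms
  have "norm_le 0 (\<lambda>_ m. (evanescent (\<lambda>m. of_real \<epsilon> * b m) m) - evanescent (wave \<zeta> 0) m)
      (\<bar>\<epsilon>\<bar> + cmod \<zeta> * (Cw * cmod \<zeta>))" by simp
  moreover have "cmod \<zeta> * (Cw * cmod \<zeta>) \<le> R * (Cw * R)"
    using assms Cw_nonneg order_trans[OF norm_ge_zero assms(1)] by (intro mult_mono) auto
  ultimately have "norm_le 0 (\<lambda>_ m. (evanescent (\<lambda>m. of_real \<epsilon> * b m) m) - evanescent (wave \<zeta> 0) m)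
      (\<bar>\<epsilon>\<bar> + Cw * R * R)" by (elim norm_le_mono) (simp add: mult_ac)
  from norm_le_boundary[OF this, of \<tau>]
  show ?thesis
    by (rule back_subst[where P = "\<lambda>f. norm_le \<tau> f _"]) (auto simp: boundary_def evanescent_def intro!: ext)
qed

lemma boundary_lipschitz:
  assumes "cmod \<zeta> \<le> R" "cmod \<eta> \<le> R" "R \<le> t0"
  shows "norm_le \<tau> (\<lambda>n m. boundary \<epsilon> \<zeta> n m - boundary \<epsilon> \<eta> n m) (4 * Cw * R * cmod (\<zeta> - \<eta>))"
  using norm_le_uminus[OF norm_le_boundary[OF wave_boundary_lipschitz[OF assms], of \<tau>]]
  by (rule back_subst[where P = "\<lambda>f. norm_le \<tau> f _"]) (auto simp: boundary_def evanescent_def intro!: ext)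

lemma hermitian_decay_map:
  assumes \<zeta>: "cmod \<zeta> \<le> t0" and v: "\<And>n. hermitian (v n)"
    and s: "norm_le 0 (strain (wave \<zeta>)) s" "norm_le 0 (\<lambda>n m. strain (wave \<zeta>) n m + strain v n m) s" "s \<le> s1"
    and f: "norm_le \<tau> (excess_force \<zeta> v) r" "0 < \<tau>"
  shows "hermitian (decay_map \<epsilon> \<zeta> v n)"
proof -
  note u = hermitian_wave[OF \<zeta>]
  have hu: "hermitian (strain (wave \<zeta>) n)" for n by (rule hermitian_strain[OF u])
  have hv: "hermitian (strain v n)" for n by (rule hermitian_strain[OF v])
  have hs: "hermitian (\<lambda>m. strain (wave \<zeta>) n m + strain v n m)" for n
    using hu[of n] hv[of n] by (simp add: hermitian_def)
  have "hermitian (conv_series cf (\<lambda>m. strain (wave \<zeta>) n m + strain v n m))"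
    "hermitian (conv_series cf (strain (wave \<zeta>) n))" for n
    by (rule hermitian_conv_series[OF hs force_summable[OF s(2,3)]]
        hermitian_conv_series[OF hu force_summable[OF s(1,3)]])+
  then have "hermitian (excess_force \<zeta> v n)" for n by (simp add: hermitian_def excess_force_def)
  then have "hermitian (respond (excess_force \<zeta> v) n)" by (rule hermitian_respond[OF f])
  then show ?thesis
    using u[of 0] v b_hermitian
    by (simp add: hermitian_def decay_map_def boundary_def neighbours_def)
qed

lemma excess_force_bound:
  assumes s: "norm_le 0 (strain (wave \<zeta>)) s" "norm_le 0 (\<lambda>n m. strain (wave \<zeta>) n m + strain v n m) s" "s \<le> s1"
    and v: "norm_le \<tau> (strain v) d"
  shows "norm_le \<tau> (excess_force \<zeta> v) (CF * s * d)"
  unfolding excess_force_def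
  using force_lipschitz[OF s(2,1,3), of \<tau> d] v by simp

text \<open>A wave and a decaying part that together solve the boundary value problem: the first harmonic
  of the wave makes up for what \<open>v\<close> leaves at the boundary.\<close>

definition matched :: "real \<Rightarrow> complex \<Rightarrow> (nat \<Rightarrow> int \<Rightarrow> complex) \<Rightarrow> bool" where
  "matched \<epsilon> \<zeta> v \<longleftrightarrow> cmod \<zeta> \<le> t0 \<and> wave \<zeta> 0 1 = of_real \<epsilon> * b 1 - v 0 1 \<and> decay_map \<epsilon> \<zeta> v = v \<and>
     (\<exists>r. norm_le \<sigma> v r) \<and> (\<forall>n. hermitian (v n)) \<and> (\<exists>k. norm_le \<sigma> (excess_force \<zeta> v) k) \<and>
     (\<exists>s\<le>s1. norm_le 0 (strain (wave \<zeta>)) s \<and> norm_le 0 (\<lambda>n m. strain (wave \<zeta>) n m + strain v n m) s)"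

text \<open>The fixed point problem for \<open>v\<close>, including the choice of the wave that matches the first
  harmonic at the boundary. It is solved in a ball of the norm with rate \<open>\<sigma>\<close>, by contraction in
  the norm with rate \<open>\<sigma> / 2\<close>.\<close>

lemma decaying_part_exists:
  obtains e0 where "0 < e0"
    "\<And>\<epsilon>. \<bar>\<epsilon>\<bar> < e0 \<Longrightarrow> \<exists>\<zeta> v. matched \<epsilon> \<zeta> v"
proof -
  define \<tau> where "\<tau> = \<sigma> / 2"
  have \<tau>: "0 < \<tau>" "\<tau> \<le> \<sigma>" "2 * \<tau> = \<sigma>" using \<sigma>_pos by (auto simp: \<tau>_def)
  obtain x0 Z where x0: "0 < x0" "2 * x0 \<le> t0"
    and Z_bound: "\<And>\<xi>. cmod \<xi> \<le> x0 \<Longrightarrow> cmod (Z \<xi>) \<le> 2 * cmod \<xi>"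
    and Z_wave: "\<And>\<xi>. cmod \<xi> \<le> x0 \<Longrightarrow> wave (Z \<xi>) 0 1 = \<xi>"
    and Z_lip: "\<And>\<xi> \<xi>'. cmod \<xi> \<le> x0 \<Longrightarrow> cmod \<xi>' \<le> x0 \<Longrightarrow> cmod (Z \<xi> - Z \<xi>') \<le> 4 * cmod (\<xi> - \<xi>')"
    by (rule amplitude_exists) blast
  obtain CU where CU: "0 \<le> CU" and wave_lip: "\<And>\<zeta> \<eta>. cmod \<zeta> \<le> t0 \<Longrightarrow> cmod \<eta> \<le> t0 \<Longrightarrow>
      norm_le (- \<tau>) (\<lambda>n m. wave \<zeta> n m - wave \<eta> n m) (CU * cmod (\<zeta> - \<eta>))"
    by (rule wave_lipschitz[OF \<tau>(1)]) blast
  obtain CR where CR: "0 \<le> CR"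
    and respond: "\<And>\<rho> f r. \<tau> \<le> \<rho> \<Longrightarrow> norm_le \<rho> f r \<Longrightarrow> norm_le \<rho> (respond f) (CR * r)"
    by (rule respond_bound[OF \<tau>(1)]) blast
  define q where "q = (exp \<sigma> + exp (- \<sigma>)) / delta a \<gamma> 2"
  have q: "0 \<le> q" "q < 1" using \<sigma>_small delta_2_gt_2 by (auto simp: q_def add_nonneg_nonneg)
  \<comment> \<open>With \<open>r\<close> the radius of the ball, \<open>\<bar>\<zeta>\<bar> \<le> 4 r\<close> and the strain is at most \<open>KS * r\<close>. The quadratic
    terms contribute \<open>L1 * r\<^sup>2\<close> to the norm of the map and \<open>L2 * r\<close> to its Lipschitz
    constant; both are absorbed by half of the gap \<open>1 - q\<close>.\<close>
  define KS where "KS = 8 * Cw + 2"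
  define K\<sigma> where "K\<sigma> = exp \<sigma> + 1"
  define K\<tau> where "K\<tau> = exp \<tau> + 1"
  define Ke where "Ke = (exp (- \<tau>) + 1) * (4 * CU)"
  have K: "2 \<le> KS" "0 \<le> K\<sigma>" "0 \<le> K\<tau>" "0 \<le> Ke"
    using Cw_nonneg CU by (auto simp: KS_def K\<sigma>_def K\<tau>_def Ke_def add_nonneg_nonneg)
  define L1 where "L1 = 16 * Cw + CR * (CF * KS * K\<sigma>)"
  define L2 where "L2 = 64 * Cw + CR * (CF * KS * K\<tau> + CF * (K\<sigma> * (2 * Ke + K\<tau>)))"
  have L: "0 \<le> L1" "0 \<le> L2" using Cw_nonneg CR CF_nonneg K by (auto simp: L1_def L2_def)
  define r where "r = min (x0 / 2) (min (s1 / KS) ((1 - q) / 2 / (L1 + L2 + 1)))"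
  have r0: "0 < r" using x0 s1_pos K q L by (simp add: r_def)
  have r_x0: "2 * r \<le> x0" by (simp add: r_def)
  have r_t0: "4 * r \<le> t0" using r_x0 x0 by linarith
  have r_s1: "KS * r \<le> s1"
  proof -
    have "r \<le> s1 / KS" by (simp add: r_def)
    then show ?thesis using K by (simp add: pos_le_divide_eq mult.commute)
  qed
  have r_L: "(L1 + L2) * r \<le> (1 - q) / 2"
    by (rule mult_small) (use L r0 in \<open>auto simp: r_def\<close>)
  have r_L1: "L1 * r \<le> (1 - q) / 2" and r_L2: "L2 * r \<le> (1 - q) / 2"
  proof -
    have "0 \<le> L1 * r" "0 \<le> L2 * r" using L r0 by auto
    with r_L show "L1 * r \<le> (1 - q) / 2" "L2 * r \<le> (1 - q) / 2" unfolding distrib_right by linarith+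
  qed
  define e0 where "e0 = (1 - q) / 2 * r"
  have e0: "0 < e0" "e0 \<le> r" using q r0 by (auto simp: e0_def mult_le_cancel_right1)
  have b1: "cmod (b 1) \<le> 1" using norm_le_coeff0[OF b_norm, of 1] by simp
  define B where "B = {v. norm_le \<sigma> v r \<and> (\<forall>n. hermitian (v n))}"
  show ?thesis
  proof (rule that[of e0])
    fix \<epsilon> :: real assume \<epsilon>: "\<bar>\<epsilon>\<bar> < e0"
    define \<xi> where "\<xi> v = of_real \<epsilon> * b 1 - v 0 1" for v :: "nat \<Rightarrow> int \<Rightarrow> complex"
    define \<zeta> where "\<zeta> v = Z (\<xi> v)" for v
    define T where "T v = decay_map \<epsilon> (\<zeta> v) v" for v
    {
      fix v assume v: "v \<in> B"
      have vn: "norm_le \<sigma> v r" and vh: "\<And>n. hermitian (v n)" using v by (auto simp: B_def)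
      have "cmod (\<xi> v) \<le> \<bar>\<epsilon>\<bar> * cmod (b 1) + cmod (v 0 1)"
        unfolding \<xi>_def by (rule order_trans[OF norm_triangle_ineq4]) (simp add: norm_mult)
      also have "\<dots> \<le> \<bar>\<epsilon>\<bar> * 1 + r"
        by (intro add_mono mult_left_mono b1 norm_le_coeff0[OF vn]) simp
      also have "\<dots> \<le> 2 * r" using \<epsilon> e0 by simp
      finally have x: "cmod (\<xi> v) \<le> 2 * r" .
      then have x_x0: "cmod (\<xi> v) \<le> x0" using r_x0 by simp
      have z: "cmod (\<zeta> v) \<le> 4 * r" unfolding \<zeta>_def using Z_bound[OF x_x0] x by simp
      then have z_t0: "cmod (\<zeta> v) \<le> t0" using r_t0 by simp
      have "norm_le 0 (wave (\<zeta> v)) (4 * r * Cw)"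
        by (rule norm_le_mono[OF wave_bound[OF z_t0] mult_right_mono[OF z Cw_nonneg]])
      from norm_le_strain[OF this] have su': "norm_le 0 (strain (wave (\<zeta> v))) (8 * Cw * r)"
        by (simp add: mult_ac)
      then have su: "norm_le 0 (strain (wave (\<zeta> v))) (KS * r)"
        by (rule norm_le_mono) (use r0 in \<open>simp add: KS_def algebra_simps\<close>)
      have "norm_le 0 v r" by (rule norm_le_weaken[OF vn]) (use \<sigma>_pos in simp)
      from norm_le_add[OF su' norm_le_strain[OF this]]
      have sv: "norm_le 0 (\<lambda>n m. strain (wave (\<zeta> v)) n m + strain v n m) (KS * r)"
        by (simp add: KS_def algebra_simps)
      have sd: "norm_le \<sigma> (strain v) (K\<sigma> * r)" unfolding K\<sigma>_def by (rule norm_le_strain[OF vn])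
      have ex: "norm_le \<sigma> (excess_force (\<zeta> v) v) (CF * (KS * r) * (K\<sigma> * r))"
        by (rule excess_force_bound[OF su sv r_s1 sd])
      have her: "hermitian (T v n)" for n
        unfolding T_def by (rule hermitian_decay_map[OF z_t0 vh su sv r_s1 ex \<sigma>_pos])
      note vn vh x_x0 z z_t0 su sv sd ex her
    } note facts = this
    have TB: "T v \<in> B" if v: "v \<in> B" for v
    proof -
      have "norm_le \<sigma> (T v) (\<bar>\<epsilon>\<bar> + Cw * (4 * r) * (4 * r) + q * r
          + CR * (CF * (KS * r) * (K\<sigma> * r)))"
        unfolding T_def decay_map_def
        using norm_le_add[OF norm_le_add[OF boundary_bound[OF facts(4)[OF v] r_t0]
              neighbours_bound[OF facts(1)[OF v] less_imp_le[OF \<sigma>_pos] order_refl]]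
            respond[OF \<tau>(2) facts(9)[OF v]]]
        unfolding q_def .
      moreover have "\<bar>\<epsilon>\<bar> + Cw * (4 * r) * (4 * r) + q * r + CR * (CF * (KS * r) * (K\<sigma> * r)) \<le> r"
      proof -
        have "Cw * (4 * r) * (4 * r) + CR * (CF * (KS * r) * (K\<sigma> * r)) = L1 * r * r"
          by (simp add: L1_def algebra_simps)
        also have "\<dots> \<le> (1 - q) / 2 * r" by (rule mult_right_mono[OF r_L1]) (use r0 in simp)
        finally have *: "Cw * (4 * r) * (4 * r) + CR * (CF * (KS * r) * (K\<sigma> * r)) \<le> (1 - q) / 2 * r" .
        have "(1 - q) / 2 * r + (1 - q) / 2 * r + q * r = r" by (simp add: field_simps)
        with * \<epsilon> show ?thesis unfolding e0_def by linarith
      qed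
      ultimately have "norm_le \<sigma> (T v) r" by (rule norm_le_mono)
      then show ?thesis using facts(10)[OF v] by (simp add: B_def)
    qed
    have "\<exists>v\<in>B. T v = v"
    proof (rule contraction_fixpoint[where q = "(1 + q) / 2" and \<tau> = \<tau>])
      show "(\<lambda>n m. 0) \<in> B"
        using norm_le_mono[OF norm_le_zero, of r] r0 by (simp add: B_def hermitian_def)
      show "x \<in> B" if "\<And>j. X j \<in> B" "\<And>n m. (\<lambda>j. X j n m) \<longlonglongrightarrow> x n m" for X x
      proof -
        have "norm_le \<sigma> x r"
          by (rule norm_le_limit[OF _ that(2)]) (use that(1) in \<open>auto simp: B_def\<close>)
        moreover have "x n (- m) = cnj (x n m)" for n m
        proof (rule LIMSEQ_unique[OF that(2)[of n "- m"]])
          have "X j n (- m) = cnj (X j n m)" for j using that(1)[of j] by (auto simp: B_def hermitian_def)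
          then show "(\<lambda>j. X j n (- m)) \<longlonglongrightarrow> cnj (x n m)" using tendsto_cnj[OF that(2)[of n m]] by simp
        qed
        ultimately show ?thesis by (simp add: B_def hermitian_def)
      qed
      show "norm_le \<tau> (\<lambda>n m. T v n m - T v' n m) ((1 + q) / 2 * d)"
        if v: "v \<in> B" and v': "v' \<in> B" and d: "norm_le \<tau> (\<lambda>n m. v n m - v' n m) d" for v v' d
      proof -
        have d0: "0 \<le> d" by (rule norm_le_nonneg[OF d])
        have "cmod (\<xi> v - \<xi> v') = cmod (v 0 1 - v' 0 1)"
          by (simp add: \<xi>_def norm_minus_commute)
        also have "\<dots> \<le> d" using norm_le_coeff0[OF d, of 1] by simp
        finally have "cmod (\<xi> v - \<xi> v') \<le> d" .
        then have dz: "cmod (\<zeta> v - \<zeta> v') \<le> 4 * d"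
          unfolding \<zeta>_def using Z_lip[OF facts(3)[OF v] facts(3)[OF v']] by simp
        have 1: "norm_le \<tau> (\<lambda>n m. boundary \<epsilon> (\<zeta> v) n m - boundary \<epsilon> (\<zeta> v') n m) (64 * Cw * r * d)"
        proof (rule norm_le_mono[OF boundary_lipschitz[OF facts(4)[OF v] facts(4)[OF v'] r_t0]])
          have "4 * Cw * (4 * r) * cmod (\<zeta> v - \<zeta> v') \<le> 4 * Cw * (4 * r) * (4 * d)"
            using Cw_nonneg r0 by (intro mult_left_mono dz) auto
          then show "4 * Cw * (4 * r) * cmod (\<zeta> v - \<zeta> v') \<le> 64 * Cw * r * d" by simp
        qed
        have 2: "norm_le \<tau> (\<lambda>n m. neighbours v n m - neighbours v' n m) (q * d)"
        proof -
          have "(\<lambda>n m. neighbours v n m - neighbours v' n m) = neighbours (\<lambda>n m. v n m - v' n m)"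
            by (intro ext) (simp add: neighbours_def diff_divide_distrib add_divide_distrib)
          then show ?thesis unfolding q_def
            using neighbours_bound[OF d less_imp_le[OF \<tau>(1)] \<tau>(2)] by simp
        qed
        have dv: "norm_le \<tau> (\<lambda>n m. strain v n m - strain v' n m) (K\<tau> * d)"
          unfolding strain_diff K\<tau>_def by (rule norm_le_strain[OF d])
        have du: "norm_le (- \<tau>) (\<lambda>n m. strain (wave (\<zeta> v)) n m - strain (wave (\<zeta> v')) n m) (Ke * d)"
        proof -
          have "norm_le (- \<tau>) (\<lambda>n m. wave (\<zeta> v) n m - wave (\<zeta> v') n m) (CU * (4 * d))"
            by (rule norm_le_mono[OF wave_lip[OF facts(5)[OF v] facts(5)[OF v']]])
              (rule mult_left_mono[OF dz CU])
          from norm_le_strain[OF this] show ?thesis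
            unfolding strain_diff Ke_def by (simp add: mult_ac)
        qed
        have 3: "norm_le \<tau> (\<lambda>n m. excess_force (\<zeta> v) v n m - excess_force (\<zeta> v') v' n m)
            (CF * (KS * r) * (K\<tau> * d) + CF * (K\<sigma> * r * (2 * (Ke * d) + K\<tau> * d)))"
          unfolding excess_force_def
          by (rule force_second_difference[where \<tau> = \<tau>])
            (use \<tau> facts(6-8)[OF v] facts(6-8)[OF v'] r_s1 dv du in simp_all)
        have 4: "norm_le \<tau> (\<lambda>n m. respond (excess_force (\<zeta> v) v) n m - respond (excess_force (\<zeta> v') v') n m)
            (CR * (CF * (KS * r) * (K\<tau> * d) + CF * (K\<sigma> * r * (2 * (Ke * d) + K\<tau> * d))))"
          unfolding respond_diff[OF facts(9)[OF v] facts(9)[OF v'] \<sigma>_pos]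
          by (rule respond[OF order_refl 3])
        have "norm_le \<tau> (\<lambda>n m. T v n m - T v' n m) (64 * Cw * r * d + q * d
            + CR * (CF * (KS * r) * (K\<tau> * d) + CF * (K\<sigma> * r * (2 * (Ke * d) + K\<tau> * d))))"
          using norm_le_add[OF norm_le_add[OF 1 2] 4] by (simp add: T_def decay_map_def algebra_simps)
        moreover have "64 * Cw * r * d + q * d
            + CR * (CF * (KS * r) * (K\<tau> * d) + CF * (K\<sigma> * r * (2 * (Ke * d) + K\<tau> * d))) \<le> (1 + q) / 2 * d"
        proof -
          have "64 * Cw * r * d + CR * (CF * (KS * r) * (K\<tau> * d) + CF * (K\<sigma> * r * (2 * (Ke * d) + K\<tau> * d)))
              = L2 * r * d" by (simp add: L2_def algebra_simps)
          also have "\<dots> \<le> (1 - q) / 2 * d" by (rule mult_right_mono[OF r_L2 d0])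
          finally have "64 * Cw * r * d + CR * (CF * (KS * r) * (K\<tau> * d) + CF * (K\<sigma> * r * (2 * (Ke * d) + K\<tau> * d)))
              \<le> (1 - q) / 2 * d" .
          moreover have "(1 - q) / 2 * d + q * d = (1 + q) / 2 * d" by (simp add: field_simps)
          ultimately show ?thesis by linarith
        qed
        ultimately show ?thesis by (rule norm_le_mono)
      qed
      show "norm_le \<tau> (\<lambda>n m. T (\<lambda>n m. 0) n m - 0) r"
        using TB[OF \<open>(\<lambda>n m. 0) \<in> B\<close>] norm_le_weaken[OF _ \<tau>(2)] by (auto simp: B_def)
    qed (use TB q in auto)
    then obtain v where v: "v \<in> B" "T v = v" by blast
    have "wave (\<zeta> v) 0 1 = of_real \<epsilon> * b 1 - v 0 1"
      unfolding \<zeta>_def using Z_wave[OF facts(3)[OF v(1)]] by (simp add: \<xi>_def)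
    with facts(1,2,5-7,9)[OF v(1)] v(2) r_s1
    show "\<exists>\<zeta> v. matched \<epsilon> \<zeta> v"
      unfolding T_def matched_def by blast
  qed (rule e0(1))
qed

text \<open>In the modes \<open>\<bar>m\<bar> \<ge> 2\<close>, multiplying the fixed point equation by \<open>delta a \<gamma> m\<close> gives back the
  difference equation for \<open>v\<close>; adding the equation of the wave turns the excess force into the
  full one.\<close>

lemma
  assumes "matched \<epsilon> \<zeta> v"
  shows matched_boundary: "m \<noteq> 0 \<Longrightarrow> wave \<zeta> 0 m + v 0 m = of_real \<epsilon> * b m"
    and matched_equation: "1 \<le> n \<Longrightarrow> (wave \<zeta> (n + 1) m + v (n + 1) m)
        + of_real (delta a \<gamma> m) * (wave \<zeta> n m + v n m) + (wave \<zeta> (n - 1) m + v (n - 1) m)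
      = - of_real (1 / a) * (conv_series cf (strain (\<lambda>n m. wave \<zeta> n m + v n m) n) m
          - conv_series cf (strain (\<lambda>n m. wave \<zeta> n m + v n m) (n + 1)) m)"
proof -
  obtain s k where \<zeta>: "cmod \<zeta> \<le> t0" and vh: "\<forall>n. hermitian (v n)"
    and w1: "wave \<zeta> 0 1 = of_real \<epsilon> * b 1 - v 0 1" and fp: "decay_map \<epsilon> \<zeta> v = v"
    and su: "norm_le 0 (strain (wave \<zeta>)) s" "s \<le> s1" and ex: "norm_le \<sigma> (excess_force \<zeta> v) k"
    using assms unfolding matched_def by blast
  have v_eq: "v n m = boundary \<epsilon> \<zeta> n m + neighbours v n m + respond (excess_force \<zeta> v) n m" for n m
    using fun_cong[OF fun_cong[OF fp], of n m] by (simp add: decay_map_def)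
  show "wave \<zeta> 0 m + v 0 m = of_real \<epsilon> * b m" if m: "m \<noteq> 0"
  proof -
    consider "m = 1" | "m = - 1" | "2 \<le> \<bar>m\<bar>" using m by linarith
    then show ?thesis
    proof cases
      case 1 then show ?thesis using w1 by simp
    next
      case 2
      have "wave \<zeta> 0 (- 1) + v 0 (- 1) = cnj (wave \<zeta> 0 1 + v 0 1)"
        using hermitian_wave[OF \<zeta>, of 0] vh by (simp add: hermitian_def)
      also have "\<dots> = cnj (of_real \<epsilon> * b 1)" using w1 by simp
      also have "\<dots> = of_real \<epsilon> * b (- 1)" using b_hermitian by (simp add: hermitian_def)
      finally show ?thesis using 2 by simp
    next
      case 3
      then show ?thesis using v_eq[of 0 m] by (simp add: boundary_def neighbours_def respond_def)
    qed
  qed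
  have eqv: "v (n + 1) m + of_real (delta a \<gamma> m) * v n m + v (n - 1) m
      = - of_real (1 / a) * (excess_force \<zeta> v n m - excess_force \<zeta> v (n + 1) m)" if n: "1 \<le> n" for n m
  proof (cases "\<bar>m\<bar> \<le> 1")
    case True
    have "v j m = respond (excess_force \<zeta> v) j m" for j
      using v_eq[of j m] True by (simp add: boundary_def neighbours_def)
    then show ?thesis using respond_equation[OF ex \<sigma>_pos True n] by simp
  next
    case False
    then have "0 < delta a \<gamma> m" using delta_mono[of m] delta_2_gt_2 by linarith
    then have \<delta>: "of_real (delta a \<gamma> m) \<noteq> (0::complex)" by simp
    have "v n m = - (v (n + 1) m + v (n - 1) m) / of_real (delta a \<gamma> m)
        + - (excess_force \<zeta> v n m - excess_force \<zeta> v (n + 1) m) / of_real (a * delta a \<gamma> m)"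
      using v_eq[of n m] False n by (simp add: boundary_def neighbours_def respond_def)
    also have "\<dots> = (- (v (n + 1) m + v (n - 1) m)
        + - of_real (1 / a) * (excess_force \<zeta> v n m - excess_force \<zeta> v (n + 1) m)) / of_real (delta a \<gamma> m)"
      using \<delta> a_pos by (simp add: divide_simps)
    finally have "of_real (delta a \<gamma> m) * v n m = - (v (n + 1) m + v (n - 1) m)
        + - of_real (1 / a) * (excess_force \<zeta> v n m - excess_force \<zeta> v (n + 1) m)"
      using \<delta> by (simp add: eq_divide_eq mult.commute)
    then show ?thesis by simp
  qed
  have st: "strain (\<lambda>n m. wave \<zeta> n m + v n m) = (\<lambda>n m. strain (wave \<zeta>) n m + strain v n m)"
    by (intro ext) (rule strain_add)
  show "(wave \<zeta> (n + 1) m + v (n + 1) m) + of_real (delta a \<gamma> m) * (wave \<zeta> n m + v n m)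
        + (wave \<zeta> (n - 1) m + v (n - 1) m)
      = - of_real (1 / a) * (conv_series cf (strain (\<lambda>n m. wave \<zeta> n m + v n m) n) m
          - conv_series cf (strain (\<lambda>n m. wave \<zeta> n m + v n m) (n + 1)) m)" if n: "1 \<le> n"
  proof -
    have "(wave \<zeta> (n + 1) m + v (n + 1) m) + of_real (delta a \<gamma> m) * (wave \<zeta> n m + v n m)
        + (wave \<zeta> (n - 1) m + v (n - 1) m)
      = (wave \<zeta> (n + 1) m + of_real (delta a \<gamma> m) * wave \<zeta> n m + wave \<zeta> (n - 1) m)
        + (v (n + 1) m + of_real (delta a \<gamma> m) * v n m + v (n - 1) m)" by (simp add: algebra_simps)
    then show ?thesis
      unfolding wave_equation[OF \<zeta> su n] eqv[OF n] st excess_force_def by (simp add: algebra_simps)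
  qed
qed

end

section \<open>From Fourier coefficients to the lattice\<close>

lemma summable_square_geometric: "summable (\<lambda>k. (real (Suc k))\<^sup>2 * (1 / 2) ^ k)"
proof (rule summable_ratio_test[of "3 / 4" 4])
  fix k :: nat assume k: "4 \<le> k"
  have "4 * real k \<le> real k * real k" using k by (intro mult_right_mono) auto
  moreover have "5 + real k * 2 \<le> 4 * real k" using k by simp
  ultimately have "5 + real k * 2 \<le> real k * real k" by linarith
  then have "2 * (real (Suc (Suc k)))\<^sup>2 \<le> 3 * (real (Suc k))\<^sup>2"
    by (simp add: power2_eq_square algebra_simps)
  then have "(real (Suc (Suc k)))\<^sup>2 * (1 / 2) ^ Suc k \<le> 3 / 4 * ((real (Suc k))\<^sup>2 * (1 / 2) ^ k)"
    by simp
  then show "norm ((real (Suc (Suc k)))\<^sup>2 * (1 / 2) ^ Suc k) \<le> 3 / 4 * norm ((real (Suc k))\<^sup>2 * (1 / 2) ^ k)"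
    by (simp only: norm_mult norm_power real_norm_def abs_of_nonneg abs_power2) simp
qed simp

text \<open>On half of a disc of convergence the coefficients gain a factor \<open>2 ^ (- k)\<close>, which absorbs the
  square of \<open>k + 1\<close>.\<close>

lemma real_analytic_nonlinear_part:
  assumes "real_analytic_on F S" "x \<in> S"
  obtains cf s1 where "0 < s1" "cf 0 = 0" "summable (\<lambda>k. \<bar>cf k\<bar> * (real (Suc k))\<^sup>2 * s1 ^ k)"
    "\<And>h. \<bar>h\<bar> \<le> s1 \<Longrightarrow> (\<lambda>k. cf k * h ^ Suc k) sums (F (x + h) - F x - deriv F x * h)"
proof -
  obtain P where P: "(\<lambda>h. F (x + h)) has_fps_expansion P"
    using assms unfolding real_analytic_on_def by blast
  then have R: "0 < fps_conv_radius P" and ev: "\<forall>\<^sub>F h in nhds 0. eval_fps P h = F (x + h)"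
    by (auto simp: has_fps_expansion_def)
  from ev obtain e where e: "0 < e" "\<And>h. \<bar>h\<bar> < e \<Longrightarrow> eval_fps P h = F (x + h)"
    by (auto simp: eventually_nhds_metric)
  obtain R' where R': "0 < R'" "ereal R' < fps_conv_radius P"
    using ereal_dense2[OF R] by (auto simp: zero_ereal_def)
  define s2 where "s2 = min e R' / 2"
  have s2: "0 < s2" "s2 < e" "s2 < R'" using e(1) R'(1) by (auto simp: s2_def)
  have conv: "ereal (norm h) < fps_conv_radius P" if "\<bar>h\<bar> \<le> s2" for h
    using that s2(3) R'(2) by (metis ereal_less_eq(3) le_less_trans less_imp_le real_norm_def)
  have sums: "(\<lambda>k. fps_nth P k * h ^ k) sums F (x + h)" if h: "\<bar>h\<bar> \<le> s2" for h
    using sums_eval_fps[OF conv[OF h]] e(2)[of h] h s2(2) by simp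
  have P0: "fps_nth P 0 = F x" using e(2)[of 0] e(1) by (simp add: eval_fps_at_0)
  have "(eval_fps P has_field_derivative eval_fps (fps_deriv P) 0) (at 0)"
    by (rule has_field_derivative_eval_fps) (use conv[of 0] s2 in simp)
  also have "eval_fps (fps_deriv P) 0 = fps_nth P 1" by (simp add: eval_fps_at_0)
  finally have "((\<lambda>h. F (x + h)) has_field_derivative fps_nth P 1) (at 0)"
    using ev by (subst (asm) DERIV_cong_ev[OF refl _ refl])
  then have "(F has_field_derivative fps_nth P 1) (at x)"
    using DERIV_shift[of F "fps_nth P 1" 0 x] by (simp add: add.commute)
  then have P1: "deriv F x = fps_nth P 1" by (rule DERIV_imp_deriv)
  obtain B where B: "\<And>k. \<bar>fps_nth P k * s2 ^ k\<bar> \<le> B"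
    using summable_imp_Bseq[OF sums_summable[OF sums[of s2]]] s2 by (auto simp: Bseq_def)
  define cf where "cf k = (if k = 0 then 0 else fps_nth P (Suc k))" for k
  define s1 where "s1 = s2 / 2"
  show ?thesis
  proof (rule that[of s1 cf])
    show "0 < s1" "cf 0 = 0" using s2 by (auto simp: s1_def cf_def)
    show "summable (\<lambda>k. \<bar>cf k\<bar> * (real (Suc k))\<^sup>2 * s1 ^ k)"
    proof (rule summable_comparison_test'[OF summable_mult[OF summable_square_geometric, of "B / s2"], of 0])
      fix k
      have "\<bar>cf k\<bar> \<le> \<bar>fps_nth P (Suc k)\<bar>" by (simp add: cf_def)
      then have "\<bar>cf k\<bar> * s2 ^ Suc k \<le> \<bar>fps_nth P (Suc k)\<bar> * s2 ^ Suc k"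
        using s2 by (intro mult_right_mono) auto
      also have "\<dots> \<le> B" using B[of "Suc k"] s2 by (simp add: abs_mult)
      finally have "\<bar>cf k\<bar> * s2 ^ k \<le> B / s2" using s2 by (simp add: pos_le_divide_eq mult_ac)
      then have "\<bar>cf k\<bar> * s2 ^ k * ((real (Suc k))\<^sup>2 * (1 / 2) ^ k) \<le> B / s2 * ((real (Suc k))\<^sup>2 * (1 / 2) ^ k)"
        by (intro mult_right_mono) auto
      then show "norm (\<bar>cf k\<bar> * (real (Suc k))\<^sup>2 * s1 ^ k) \<le> B / s2 * ((real (Suc k))\<^sup>2 * (1 / 2) ^ k)"
        using s2 by (simp add: s1_def power_divide abs_mult mult_ac del: of_nat_Suc)
    qed
    fix h assume "\<bar>h\<bar> \<le> s1"
    then have h: "\<bar>h\<bar> \<le> s2" using s2 by (simp add: s1_def)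
    have "(\<lambda>k. fps_nth P (Suc k) * h ^ Suc k) sums (F (x + h) - F x)"
      using sums_Suc_iff[of "\<lambda>k. fps_nth P k * h ^ k" "F (x + h) - F x"] sums[OF h] by (simp add: P0)
    from sums_diff[OF this sums_single[of 0 "\<lambda>_. deriv F x * h"]]
    have "(\<lambda>k. fps_nth P (Suc k) * h ^ Suc k - (if k = 0 then deriv F x * h else 0))
        sums (F (x + h) - F x - deriv F x * h)" .
    also have "(\<lambda>k. fps_nth P (Suc k) * h ^ Suc k - (if k = 0 then deriv F x * h else 0))
        = (\<lambda>k. cf k * h ^ Suc k)"
      by (auto simp: cf_def P1)
    finally show "(\<lambda>k. cf k * h ^ Suc k) sums (F (x + h) - F x - deriv F x * h)" .
  qed
qed

lemma fourier_has_derivative: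
  assumes f: "l1 f" and f': "l1 (\<lambda>m. of_int m * f m)"
  shows "((\<lambda>\<theta>. Re (fourier f \<theta>)) has_real_derivative Re (fourier (\<lambda>m. \<i> * of_int m * f m) \<theta>)) (at \<theta>)"
proof -
  define g where "g j \<theta> = Re (f (int_decode j) * cis (of_int (int_decode j) * \<theta>))" for j \<theta>
  define g' where "g' j \<theta> = Re (\<i> * of_int (int_decode j) * f (int_decode j) * cis (of_int (int_decode j) * \<theta>))"
    for j \<theta>
  have series: "(\<lambda>j. Re (h (int_decode j) * cis (of_int (int_decode j) * \<theta>))) sums Re (fourier h \<theta>)"
    if "l1 h" for h \<theta>
  proof -
    have "((\<lambda>m. h m * cis (of_int m * \<theta>)) has_sum fourier h \<theta>) UNIV"
      unfolding fourier_def by (rule has_sum_infsum[OF fourier_summable[OF that]])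
    then have "((\<lambda>j. h (int_decode j) * cis (of_int (int_decode j) * \<theta>)) has_sum fourier h \<theta>) UNIV"
      using has_sum_reindex_bij_betw[OF bij_int_decode, of "\<lambda>m. h m * cis (of_int m * \<theta>)"] by simp
    then show ?thesis by (intro sums_Re has_sum_imp_sums)
  qed
  have l1': "l1 (\<lambda>m. \<i> * of_int m * f m)" using f' by (simp add: norm_mult)
  have majorant: "summable (\<lambda>j. cmod (of_int (int_decode j) * f (int_decode j)))"
    using summable_on_reindex_bij_betw[OF bij_int_decode, of "\<lambda>m. cmod (of_int m * f m)"] f'
    by (intro summable_on_imp_summable) simp
  have "((\<lambda>\<theta>. \<Sum>j. g j \<theta>) has_real_derivative (\<Sum>j. g' j \<theta>)) (at \<theta>)"
  proof (rule has_field_derivative_series'(2)[where S = UNIV and f = g and f' = g' and ?x0.0 = 0])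
    show "(g j has_real_derivative g' j x) (at x within UNIV)" for j x
      unfolding g_def g'_def by (auto intro!: derivative_eq_intros)
    show "uniformly_convergent_on UNIV (\<lambda>n x. \<Sum>i<n. g' i x)"
    proof (rule Weierstrass_m_test'[OF _ majorant])
      show "norm (g' j x) \<le> cmod (of_int (int_decode j) * f (int_decode j))" for j x
        unfolding g'_def real_norm_def
        by (rule order_trans[OF abs_Re_le_cmod]) (simp add: norm_mult)
    qed
    show "summable (\<lambda>j. g j 0)" unfolding g_def by (rule sums_summable[OF series[OF f]])
  qed auto
  moreover have "(\<lambda>\<theta>. \<Sum>j. g j \<theta>) = (\<lambda>\<theta>. Re (fourier f \<theta>))"
    unfolding g_def by (intro ext sums_unique[symmetric] series f)
  moreover have "(\<Sum>j. g' j \<theta>) = Re (fourier (\<lambda>m. \<i> * of_int m * f m) \<theta>)"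
    unfolding g'_def using series[OF l1', of \<theta>] by (simp add: sums_iff)
  ultimately show ?thesis by simp
qed

lemma fourier_periodic: "fourier f (\<theta> + 2 * pi) = fourier f \<theta>"
proof -
  have "cis (of_int m * (\<theta> + 2 * pi)) = cis (of_int m * \<theta>)" for m
    using cis_multiple_2pi[of "of_int m"] by (simp add: distrib_left mult_ac flip: cis_mult)
  then show ?thesis by (simp add: fourier_def)
qed

text \<open>The rate \<open>sigma_zero\<close> is at most half the exponential decay rate of the slowest evanescent
  mode, which solves \<open>2 cosh l = delta a \<gamma> 2\<close>.\<close>

lemma sigma_zero_admissible:
  assumes "0 < a" "0 < \<gamma>" "a < \<gamma>\<^sup>2" "\<gamma>\<^sup>2 < 4 * a"
  shows "exp (sigma_zero a \<gamma>) + exp (- sigma_zero a \<gamma>) < delta a \<gamma> 2"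
proof -
  define \<sigma> where "\<sigma> = sigma_zero a \<gamma>"
  have \<sigma>: "0 < \<sigma>" unfolding \<sigma>_def by (rule sigma_zero_pos[OF assms])
  define d where "d = delta a \<gamma> 2"
  have d: "2 < d" using assms by (simp add: d_def delta_def field_simps)
  define s where "s = sqrt (d\<^sup>2 / 4 - 1)"
  have d2: "d\<^sup>2 > 4" using power_strict_mono[of 2 d 2] d by simp
  then have ss: "s\<^sup>2 = d\<^sup>2 / 4 - 1" and s0: "0 \<le> s" by (simp_all add: s_def)
  define z where "z = d / 2 - s"
  have "s < d / 2"
    by (rule power2_less_imp_less) (use ss d in \<open>auto simp: power_divide\<close>)
  then have z0: "0 < z" by (simp add: z_def)
  have prod: "z * (d / 2 + s) = 1" using ss by (simp add: z_def power2_eq_square algebra_simps)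
  then have inv: "1 / z = d / 2 + s" using z0 by (simp add: field_simps)
  define l where "l = - ln z"
  have l: "exp l + exp (- l) = d"
    using z0 inv by (simp add: l_def exp_minus inverse_eq_divide z_def)
  have "\<sigma> \<le> l / 2"
    using m_zero_eq_1[OF assms] z0 by (simp add: \<sigma>_def sigma_zero_def z_root_def l_def z_def d_def s_def)
  then have \<sigma>l: "\<sigma> < l" using \<sigma> by linarith
  have "0 < (exp l - exp \<sigma>) * (1 - exp (- \<sigma> - l))"
    using \<sigma> \<sigma>l by (intro mult_pos_pos) auto
  also have "\<dots> = exp l + exp (- l) - (exp \<sigma> + exp (- \<sigma>))"
    by (simp add: algebra_simps flip: exp_add)
  finally show ?thesis using l by (simp add: d_def \<sigma>_def)
qed

text \<open>A solution of the equations for the Fourier coefficients is a solution of the lattice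
  equations. The equation itself yields the decay in \<open>m\<close> needed to differentiate twice.\<close>

lemma (in chain) lattice_equation:
  assumes y: "norm_le 0 y r" and yh: "\<And>n. hermitian (y n)"
    and s: "norm_le 0 (strain y) s" "s \<le> s1" and n: "1 \<le> n"
    and eq: "\<And>m. y (n + 1) m + of_real (delta a \<gamma> m) * y n m + y (n - 1) m
      = - of_real (1 / a) * (conv_series cf (strain y n) m - conv_series cf (strain y (n + 1)) m)"
    and F: "\<And>h. \<bar>h\<bar> \<le> s1 \<Longrightarrow> (\<lambda>k. cf k * h ^ Suc k) sums (F (- c + h) - F (- c) - a * h)"
    and x: "\<And>j t. x j t = c * real j + C + Re (fourier (y j) (\<gamma> * t))"
  shows "\<exists>x'. \<forall>t. (x n has_real_derivative x' t) (at t) \<and>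
    (x' has_real_derivative F (x (n - 1) t - x n t) - F (x n t - x (n + 1) t)) (at t)"
proof -
  define G where "G j = conv_series cf (strain y j)" for j
  define f where "f j m = of_real a * strain y j m + G j m" for j m
  have l1y: "l1 (y j)" and l1s: "l1 (strain y j)" for j
    by (rule norm_le_l1[OF y] norm_le_l1[OF s(1)])+
  have l1G: "l1 (G j)" for j unfolding G_def by (rule norm_le_l1[OF force_norm[OF s]])
  have l1f: "l1 (f j)" for j unfolding f_def by (intro l1_add l1_cmult l1s l1G)
  have coeff: "- of_real (\<gamma>\<^sup>2) * (of_int m * of_int m * y n m) = f n m - f (n + 1) m" for m
  proof -
    have a0: "of_real a \<noteq> (0::complex)" using a_pos by simp
    have K: "of_real (\<gamma>\<^sup>2) * of_int m * of_int m = of_real a * of_real (delta a \<gamma> m) + 2 * (of_real a :: complex)"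
      using a0 by (simp add: delta_def field_simps power2_eq_square)
    have "of_real a * (y (n + 1) m + y (n - 1) m - 2 * y n m)
        + of_real (\<gamma>\<^sup>2) * of_int m * of_int m * y n m
      = of_real a * (y (n + 1) m + of_real (delta a \<gamma> m) * y n m + y (n - 1) m)"
      unfolding K by (simp add: algebra_simps)
    also have "\<dots> = - (G n m - G (n + 1) m)"
      unfolding eq G_def using a0 by simp
    finally have "of_real a * (y (n + 1) m + y (n - 1) m - 2 * y n m)
        + of_real (\<gamma>\<^sup>2) * of_int m * of_int m * y n m = - (G n m - G (n + 1) m)" .
    then show ?thesis using n by (simp add: f_def strain_def algebra_simps)
  qed
  have l1_2: "l1 (\<lambda>m. of_int m * (of_int m * y n m))"
  proof -
    have "of_int m * (of_int m * y n m) = of_real (- 1 / \<gamma>\<^sup>2) * (f n m - f (n + 1) m)" for m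
      using coeff[of m] \<gamma>_pos by (simp add: field_simps)
    then show ?thesis by (simp only: l1_cmult l1_diff l1f)
  qed
  have l1_1: "l1 (\<lambda>m. of_int m * y n m)"
  proof (rule summable_on_comparison_test[OF l1_2])
    fix m :: int
    show "cmod (of_int m * y n m) \<le> cmod (of_int m * (of_int m * y n m))"
    proof (cases "m = 0")
      case False
      then have "1 \<le> \<bar>real_of_int m\<bar>" by linarith
      from mult_right_mono[OF this, of "cmod (of_int m * y n m)"] show ?thesis by (simp add: norm_mult)
    qed simp
  qed auto
  define x' where "x' t = \<gamma> * Re (fourier (\<lambda>m. \<i> * of_int m * y n m) (\<gamma> * t))" for t
  have scale: "((\<lambda>t. \<gamma> * t) has_real_derivative \<gamma>) (at t)" for t
    by (auto intro!: derivative_eq_intros)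
  have d1: "(x n has_real_derivative x' t) (at t)" for t
  proof -
    have "((\<lambda>t. Re (fourier (y n) (\<gamma> * t))) has_real_derivative
        Re (fourier (\<lambda>m. \<i> * of_int m * y n m) (\<gamma> * t)) * \<gamma>) (at t)"
      by (rule DERIV_chain'[OF scale fourier_has_derivative[OF l1y l1_1]])
    from DERIV_add[OF DERIV_const this, of "c * real n + C"] show ?thesis
      unfolding x[abs_def] x'_def by (simp add: mult.commute)
  qed
  have d2: "(x' has_real_derivative Re (fourier (\<lambda>m. f n m - f (n + 1) m) (\<gamma> * t))) (at t)" for t
  proof -
    have "((\<lambda>t. Re (fourier (\<lambda>m. \<i> * of_int m * y n m) (\<gamma> * t))) has_real_derivative
        Re (fourier (\<lambda>m. \<i> * of_int m * (\<i> * of_int m * y n m)) (\<gamma> * t)) * \<gamma>) (at t)"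
      by (rule DERIV_chain'[OF scale fourier_has_derivative])
        (use l1_1 l1_2 in \<open>simp_all add: norm_mult\<close>)
    from DERIV_cmult[OF this, of \<gamma>]
    have "(x' has_real_derivative
        \<gamma> * (Re (fourier (\<lambda>m. \<i> * of_int m * (\<i> * of_int m * y n m)) (\<gamma> * t)) * \<gamma>)) (at t)"
      unfolding x'_def[abs_def] .
    moreover have "\<gamma> * (Re (fourier (\<lambda>m. \<i> * of_int m * (\<i> * of_int m * y n m)) (\<gamma> * t)) * \<gamma>)
        = Re (fourier (\<lambda>m. f n m - f (n + 1) m) (\<gamma> * t))"
    proof -
      have "\<i> * of_int m * (\<i> * of_int m * y n m) = - 1 * (of_int m * of_int m * y n m)" for m
        by (simp add: algebra_simps)
      then have "fourier (\<lambda>m. \<i> * of_int m * (\<i> * of_int m * y n m)) (\<gamma> * t)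
          = - 1 * fourier (\<lambda>m. of_int m * of_int m * y n m) (\<gamma> * t)"
        by (simp only: fourier_cmult)
      moreover have "fourier (\<lambda>m. f n m - f (n + 1) m) (\<gamma> * t)
          = - of_real (\<gamma>\<^sup>2) * fourier (\<lambda>m. of_int m * of_int m * y n m) (\<gamma> * t)"
        unfolding coeff[symmetric] by (rule fourier_cmult)
      ultimately show ?thesis by (simp add: power2_eq_square)
    qed
    ultimately show ?thesis by simp
  qed
  have force: "Re (fourier (f j) (\<gamma> * t)) = F (x (j - 1) t - x j t) - F (- c)" if j: "1 \<le> j" for j t
  proof -
    define E where "E = Re (fourier (strain y j) (\<gamma> * t))"
    have "hermitian (strain y j)" by (rule hermitian_strain[OF yh])
    then have real: "fourier (strain y j) (\<gamma> * t) = of_real E"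
      using fourier_real[of "strain y j" "\<gamma> * t"]
      by (simp add: E_def complex_eq_iff)
    have row: "norm_le 0 (\<lambda>_. strain y j) s" by (rule norm_le_row[OF s(1)])
    have "cmod (fourier (strain y j) (\<gamma> * t)) \<le> s"
      using norm_fourier_le[OF l1s, of j "\<gamma> * t"] norm_le_abs_summable(2)[OF s(1), of j] by simp
    then have E: "\<bar>E\<bar> \<le> s1" using s(2) unfolding real by simp
    have "(\<lambda>k. of_real (cf k) * of_real E ^ Suc k) sums fourier (G j) (\<gamma> * t)"
      using fourier_conv_series[OF row cf_sums(5)[OF norm_le_nonneg[OF s(1)] s(2)], of "\<gamma> * t"]
      unfolding real G_def .
    moreover have "(\<lambda>k. of_real (cf k) * of_real E ^ Suc k) sums (of_real (F (- c + E) - F (- c) - a * E) :: complex)"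
      using sums_of_real[OF F[OF E], where ?'a = complex] by simp
    ultimately have "fourier (G j) (\<gamma> * t) = of_real (F (- c + E) - F (- c) - a * E)"
      by (rule sums_unique2)
    moreover have "fourier (f j) (\<gamma> * t) = of_real a * fourier (strain y j) (\<gamma> * t) + fourier (G j) (\<gamma> * t)"
      unfolding f_def by (simp add: fourier_add fourier_cmult l1_cmult l1s l1G)
    ultimately have "Re (fourier (f j) (\<gamma> * t)) = F (- c + E) - F (- c)"
      by (simp add: real)
    moreover have "E = Re (fourier (y (j - 1)) (\<gamma> * t)) - Re (fourier (y j) (\<gamma> * t))"
    proof -
      have "strain y j = (\<lambda>m. y (j - 1) m - y j m)" using j by (auto simp: strain_def)
      then show ?thesis by (simp add: E_def fourier_diff l1y)
    qed
    moreover have "x (j - 1) t - x j t = - c + (Re (fourier (y (j - 1)) (\<gamma> * t)) - Re (fourier (y j) (\<gamma> * t)))"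
      using j by (simp add: x of_nat_diff algebra_simps)
    ultimately show ?thesis by simp
  qed
  have "Re (fourier (\<lambda>m. f n m - f (n + 1) m) (\<gamma> * t)) = F (x (n - 1) t - x n t) - F (x n t - x (n + 1) t)" for t
    using force[OF n, of t] force[of "n + 1" t] by (simp add: fourier_diff l1f)
  with d1 d2 show ?thesis by (intro exI[of _ x'] allI conjI) simp_all
qed

theorem theorem30:
  fixes c \<gamma> :: real and F :: "real \<Rightarrow> real"
    and w :: "int \<Rightarrow> real" and b :: "int \<Rightarrow> complex"
  assumes F_analytic: "\<exists>S. open S \<and> - c \<in> S \<and> real_analytic_on F S"
    and F_deriv_pos: "deriv F (- c) > 0"
    and gamma_pos: "\<gamma> > 0"
    and nonresonance: "\<And>m :: int. (real_of_int m * \<gamma>)\<^sup>2 / deriv F (- c) \<noteq> 4"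
    and weight: "admissible_weight w"
    and b_norm: "((\<lambda>m. w m * cmod (b m)) has_sum 1) UNIV"
    and b_conj: "\<And>m. b (- m) = cnj (b m)"
    and gamma_lower: "deriv F (- c) < \<gamma>\<^sup>2"
    and gamma_upper: "\<gamma>\<^sup>2 < 4 * deriv F (- c)"
  shows "\<exists>D :: real set. open D \<and> 0 \<in> D \<and>
    (\<forall>\<epsilon>\<in>D. \<exists>u \<in> seq_space 0 w. \<exists>v \<in> seq_space (sigma_zero (deriv F (- c)) \<gamma>) w.
      \<exists>x :: nat \<Rightarrow> real \<Rightarrow> real.
        (\<forall>t. complex_of_real (x 0 t)
             = of_real \<epsilon> * (\<Sum>\<^sub>\<infinity>m. b m * cis (\<gamma> * real_of_int m * t))) \<and>
        (\<forall>n\<ge>1. \<forall>t. complex_of_real (x n t)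
             = of_real (c * real n) + of_real \<epsilon> * b 0 - (u 0 0 + v 0 0)
               + (\<Sum>\<^sub>\<infinity>m. (u n m + v n m) * cis (real_of_int m * \<gamma> * t))) \<and>
        (\<exists>T>0. \<forall>n t. x n (t + T) = x n t) \<and>
        (\<forall>n\<ge>1. \<exists>x'. \<forall>t.
           (x n has_real_derivative x' t) (at t) \<and>
           (x' has_real_derivative
              F (x (n - 1) t - x n t) - F (x n t - x (n + 1) t)) (at t)))"
proof -
  define a where "a = deriv F (- c)"
  define \<sigma> where "\<sigma> = sigma_zero a \<gamma>"
  have a: "0 < a" "a < \<gamma>\<^sup>2" "\<gamma>\<^sup>2 < 4 * a" using F_deriv_pos gamma_lower gamma_upper by (auto simp: a_def)
  obtain S where S: "- c \<in> S" "real_analytic_on F S" using F_analytic by blast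
  obtain cf s1 where cf: "0 < s1" "cf 0 = 0" "summable (\<lambda>k. \<bar>cf k\<bar> * (real (Suc k))\<^sup>2 * s1 ^ k)"
    and F: "\<And>h. \<bar>h\<bar> \<le> s1 \<Longrightarrow> (\<lambda>k. cf k * h ^ Suc k) sums (F (- c + h) - F (- c) - a * h)"
    unfolding a_def by (rule real_analytic_nonlinear_part[OF S(2,1)]) blast
  interpret chain w a \<gamma> s1 cf
    using weight a gamma_pos cf by unfold_locales (auto simp: admissible_weight_def)
  obtain t0 Cw \<kappa> p where "waves w a \<gamma> s1 cf t0 Cw \<kappa> p" by (rule travelling_waves_exist)
  then interpret waves w a \<gamma> s1 cf t0 Cw \<kappa> p .
  interpret driven_chain w a \<gamma> s1 cf t0 Cw \<kappa> p \<sigma> b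
  proof unfold_locales
    show "0 < \<sigma>" unfolding \<sigma>_def by (rule sigma_zero_pos[OF a(1) gamma_pos a(2,3)])
    show "exp \<sigma> + exp (- \<sigma>) < delta a \<gamma> 2"
      unfolding \<sigma>_def by (rule sigma_zero_admissible[OF a(1) gamma_pos a(2,3)])
    show "hermitian b" by (simp add: hermitian_def b_conj)
    show "norm_le 0 (\<lambda>_. b) 1"
    proof (rule norm_leI[where M = "\<lambda>m. cmod (b m)"])
      show "(\<Sum>m\<in>A. w m * cmod (b m)) \<le> 1" if "finite A" for A
        by (rule finite_sum_le_has_sum[OF b_norm that]) auto
    qed simp
  qed
  obtain e0 where e0: "0 < e0" and sol: "\<And>\<epsilon>. \<bar>\<epsilon>\<bar> < e0 \<Longrightarrow> \<exists>\<zeta> v. matched \<epsilon> \<zeta> v"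
    by (rule decaying_part_exists) blast
  show ?thesis
  proof (intro exI[of _ "{- e0<..<e0}"] conjI ballI)
    fix \<epsilon> assume "\<epsilon> \<in> {- e0<..<e0}"
    then have "\<bar>\<epsilon>\<bar> < e0" by auto
    from sol[OF this] obtain \<zeta> v where matched: "matched \<epsilon> \<zeta> v" by blast
    then obtain r' s where \<zeta>: "cmod \<zeta> \<le> t0" and v: "norm_le \<sigma> v r'" and vh: "\<forall>n. hermitian (v n)"
      and s: "norm_le 0 (\<lambda>n m. strain (wave \<zeta>) n m + strain v n m) s" "s \<le> s1"
      unfolding matched_def by blast
    define u where "u = wave \<zeta>"
    note u = wave_bound[OF \<zeta>, folded u_def]
    define y where "y n m = u n m + v n m" for n m
    have y_eta: "(\<lambda>n m. u n m + v n m) = y" by (intro ext) (simp add: y_def)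
    note bc = matched_boundary[OF matched, folded u_def]
    note eq = matched_equation[OF matched, folded u_def, unfolded y_eta, folded y_def]
    have ys: "norm_le 0 (strain y) s"
      using s(1) unfolding strain_add[symmetric] u_def[symmetric] y_eta .
    have y: "norm_le 0 y (cmod \<zeta> * Cw + r')"
      using norm_le_add[OF u norm_le_weaken[OF v]] \<sigma>_pos unfolding y_eta by simp
    have yh: "hermitian (y n)" for n
      using hermitian_wave[OF \<zeta>, of n] vh by (simp add: hermitian_def y_def u_def)
    have l1y: "l1 (y n)" for n by (rule norm_le_l1[OF y])
    have l1b: "l1 b" using norm_le_l1[OF driven_chain.b_norm[OF driven_chain_axioms]] by simp
    define C where "C = Re (of_real \<epsilon> * b 0 - y 0 0)"
    have C: "of_real C = of_real \<epsilon> * b 0 - y 0 0"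
    proof -
      have "cnj (b 0) = b 0" "cnj (y 0 0) = y 0 0"
        using b_conj[of 0] yh[of 0] unfolding hermitian_def by (metis minus_zero)+
      then show ?thesis by (simp add: C_def complex_eq_iff)
    qed
    define x where "x n t = c * real n + C + Re (fourier (y n) (\<gamma> * t))" for n t
    have x_complex: "of_real (x n t) = of_real (c * real n) + (of_real \<epsilon> * b 0 - y 0 0) + fourier (y n) (\<gamma> * t)"
      for n t
    proof -
      have "of_real (Re (fourier (y n) (\<gamma> * t))) = fourier (y n) (\<gamma> * t)"
        using fourier_real[OF yh, of n "\<gamma> * t"] by (simp add: complex_eq_iff)
      then show ?thesis by (simp add: x_def flip: C)
    qed
    have x0: "complex_of_real (x 0 t) = of_real \<epsilon> * (\<Sum>\<^sub>\<infinity>m. b m * cis (\<gamma> * real_of_int m * t))" for t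
    proof -
      define z where "z m = (if m = 0 then of_real \<epsilon> * b 0 - y 0 0 else 0)" for m :: int
      have z: "(\<lambda>m. z m * cis (of_int m * (\<gamma> * t))) = (\<lambda>m. if m = 0 then of_real \<epsilon> * b 0 - y 0 0 else 0)"
        by (auto simp: z_def)
      have "((\<lambda>m. z m * cis (of_int m * (\<gamma> * t))) has_sum (of_real \<epsilon> * b 0 - y 0 0)) UNIV"
        unfolding z by (rule has_sum_finite_neutralI[of "{0}"]) auto
      then have fz: "fourier z (\<gamma> * t) = of_real \<epsilon> * b 0 - y 0 0"
        unfolding fourier_def by (rule infsumI)
      have "(\<lambda>m. of_real \<epsilon> * b m - y 0 m) = z"
        by (intro ext) (use bc in \<open>auto simp: z_def y_def\<close>)
      then have "fourier z (\<gamma> * t) = of_real \<epsilon> * fourier b (\<gamma> * t) - fourier (y 0) (\<gamma> * t)"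
        using fourier_diff[OF l1_cmult[OF l1b, of "of_real \<epsilon>"] l1y[of 0], of "\<gamma> * t"] fourier_cmult[of "of_real \<epsilon>" b]
        by simp
      then have "complex_of_real (x 0 t) = of_real \<epsilon> * fourier b (\<gamma> * t)"
        unfolding x_complex using fz by simp
      then show ?thesis by (simp add: fourier_def mult_ac)
    qed
    show "\<exists>u\<in>seq_space 0 w. \<exists>v\<in>seq_space (sigma_zero (deriv F (- c)) \<gamma>) w.
      \<exists>x :: nat \<Rightarrow> real \<Rightarrow> real.
        (\<forall>t. complex_of_real (x 0 t)
             = of_real \<epsilon> * (\<Sum>\<^sub>\<infinity>m. b m * cis (\<gamma> * real_of_int m * t))) \<and>
        (\<forall>n\<ge>1. \<forall>t. complex_of_real (x n t)
             = of_real (c * real n) + of_real \<epsilon> * b 0 - (u 0 0 + v 0 0)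
               + (\<Sum>\<^sub>\<infinity>m. (u n m + v n m) * cis (real_of_int m * \<gamma> * t))) \<and>
        (\<exists>T>0. \<forall>n t. x n (t + T) = x n t) \<and>
        (\<forall>n\<ge>1. \<exists>x'. \<forall>t.
           (x n has_real_derivative x' t) (at t) \<and>
           (x' has_real_derivative
              F (x (n - 1) t - x n t) - F (x n t - x (n + 1) t)) (at t))"
    proof (rule bexI[of _ u], rule bexI[of _ v], rule exI[of _ x], intro conjI allI impI)
      show "u \<in> seq_space 0 w" by (rule norm_le_seq_space[OF u])
      show "v \<in> seq_space (sigma_zero (deriv F (- c)) \<gamma>) w"
        using norm_le_seq_space[OF v] by (simp add: \<sigma>_def a_def)
      fix n t
      show "complex_of_real (x 0 t) = of_real \<epsilon> * (\<Sum>\<^sub>\<infinity>m. b m * cis (\<gamma> * real_of_int m * t))" by (rule x0)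
      show "complex_of_real (x n t) = of_real (c * real n) + of_real \<epsilon> * b 0 - (u 0 0 + v 0 0)
          + (\<Sum>\<^sub>\<infinity>m. (u n m + v n m) * cis (real_of_int m * \<gamma> * t))"
        unfolding x_complex by (simp add: fourier_def y_def mult.assoc)
      have "x n (t + 2 * pi / \<gamma>) = x n t" for n t
      proof -
        have "\<gamma> * (t + 2 * pi / \<gamma>) = \<gamma> * t + 2 * pi" using gamma_pos by (simp add: field_simps)
        then show ?thesis by (simp add: x_def fourier_periodic)
      qed
      then show "\<exists>T>0. \<forall>n t. x n (t + T) = x n t"
        using gamma_pos by (intro exI[of _ "2 * pi / \<gamma>"]) simp
      assume n: "1 \<le> n"
      show "\<exists>x'. \<forall>t. (x n has_real_derivative x' t) (at t) \<and>
           (x' has_real_derivative F (x (n - 1) t - x n t) - F (x n t - x (n + 1) t)) (at t)"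
        by (rule lattice_equation[OF y yh ys s(2) n eq[OF n] F x_def])
    qed
  qed (use e0 in auto)
qed

end
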